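(* As operators on $\mathcal S(\mathbb R^m)_{m|2n}$, the super Fourier transform is the operator exponential $$\mathcal F^{\pm}_{m|2n}=\exp\left(\pm\frac{i\pi}{4}(\Delta-x^2-M)\right).$$
   Context: Let $m,n\ge 0$ be integers and $M=m-2n$. Let $x_1,\dots,x_m$ be commuting real variables and $\grave x_1,\dots,\grave x_{2n}$ anti-commuting variables, with $x_i\grave x_j=\grave x_jx_i$; $\Lambda_{2n}$ is the Grassmann algebra (complex coefficients) generated by the $\grave x_j$. $\mathcal C$ is the complex unital associative algebra generated by $e_1,\dots,e_m,\grave e_1,\dots,\grave e_{2n}$ with relations $e_je_k+e_ke_j=-2\delta_{jk}$, $\grave e_{2j}\grave e_{2k}-\grave e_{2k}\grave e_{2j}=0$, $\grave e_{2j-1}\grave e_{2k-1}-\grave e_{2k-1}\grave e_{2j-1}=0$, $\grave e_{2j-1}\grave e_{2k}-\grave e_{2k}\grave e_{2j-1}=\delta_{jk}$, $e_j\grave e_k+\grave e_ke_j=0$; all generators of $\mathcal C$ commute with all variables. A second set of variables $y_i,\grave y_j$ of the same type is used; all anti-commuting variables (from both sets) anti-commute with each other. $\partial_{\grave x_j}$ is the left derivative. $\mathcal S(\mathbb R^m)_{m|2n}=\mathcal S(\mathbb R^m)\otimes\Lambda_{2n}\otimes\mathcal C$. $x^2=\sum_{j=1}^n\grave x_{2j-1}\grave x_{2j}-\sum_{j=1}^m x_j^2$ (acting as a multiplication operator) and $\Delta=4\sum_{j=1}^n\partial_{\grave x_{2j-1}}\partial_{\grave x_{2j}}-\sum_{j=1}^m\partial_{x_j}^2$.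 Pairing: $\langle x,y\rangle=-\sum_{i=1}^m x_iy_i+\frac12\sum_{j=1}^n(\grave x_{2j-1}\grave y_{2j}-\grave x_{2j}\grave y_{2j-1})$. Berezin integral: $\int_{B,x}=\pi^{-n}\partial_{\grave x_{2n}}\cdots\partial_{\grave x_1}$. Super Fourier transform on $\mathcal S(\mathbb R^m)_{m|2n}$: $$\mathcal F^{\pm}_{m|2n}(f)(y)=(2\pi)^{-M/2}\int_{\mathbb R^m}dV(\underline x)\int_{B,x}\exp(\mp i\langle x,y\rangle)f(x),$$ where after transformation the variables $y$ are identified with $x$. Operator exponential: $\Delta-x^2-M$ is the sum of the commuting operators $A_b=-\sum_{j=1}^m\partial_{x_j}^2+\sum_{j=1}^m x_j^2-m$ on $\mathcal S(\mathbb R^m)$ and $A_f=4\sum_{j=1}^n\partial_{\grave x_{2j-1}}\partial_{\grave x_{2j}}-\sum_{j=1}^n\grave x_{2j-1}\grave x_{2j}+2n$ on the finite-dimensional space $\Lambda_{2n}$. For real $\theta$, $\exp(i\theta(\Delta-x^2-M))=\exp(i\theta A_b)\exp(i\theta A_f)$ (acting trivially on $\mathcal C$), where $\exp(i\theta A_b)$ is defined by the spectral decomposition of $A_b$ in Hermite functions and $\exp(i\theta A_f)$ is the usual exponential of an endomorphism of a finite-dimensional space. *)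

theory Defs
  imports "HOL-Analysis.Analysis" "HOL-Library.Poly_Mapping" "HOL-Computational_Algebra.Polynomial"
begin

text \<open>
  Conventions. A point of \<open>\<real>\<^sup>m\<close> is given by the coordinates \<open>x 1, \<dots>, x m\<close> of some \<open>x :: nat \<Rightarrow> real\<close>, and
  a function on \<open>\<real>\<^sup>m\<close> is a function of \<open>x\<close> that depends on these coordinates only; this covers
  \<open>m = 0\<close>. For such functions, continuity in the product topology is continuity on \<open>\<real>\<^sup>m\<close>. Lebesgue measure on \<open>\<real>\<^sup>m\<close> is \<^term>\<open>PiM {1..m} (\<lambda>_. lborel)\<close>.
\<close>

section \<open>The Schwartz space\<close>

definition depends_on_coords :: "nat \<Rightarrow> ((nat \<Rightarrow> real) \<Rightarrow> complex) \<Rightarrow> bool" where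
  "depends_on_coords m \<phi> \<longleftrightarrow> (\<forall>x y. (\<forall>i\<in>{1..m}. x i = y i) \<longrightarrow> \<phi> x = \<phi> y)"

definition pdiff :: "nat \<Rightarrow> ((nat \<Rightarrow> real) \<Rightarrow> complex) \<Rightarrow> (nat \<Rightarrow> real) \<Rightarrow> complex" where
  "pdiff i \<phi> = (\<lambda>x. vector_derivative (\<lambda>t. \<phi> (x(i := t))) (at (x i)))"

text \<open>Iterated partial derivatives are indexed by lists of coordinate directions.\<close>

definition smooth :: "nat \<Rightarrow> ((nat \<Rightarrow> real) \<Rightarrow> complex) \<Rightarrow> bool" where
  "smooth m \<phi> \<longleftrightarrow> (\<forall>is\<in>lists {1..m}.
     continuous_on UNIV (fold pdiff is \<phi>) \<and>
     (\<forall>i\<in>{1..m}. \<forall>x. (\<lambda>t. fold pdiff is \<phi> (x(i := t))) differentiable (at (x i))))"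

definition schwartz :: "nat \<Rightarrow> ((nat \<Rightarrow> real) \<Rightarrow> complex) set" where
  "schwartz m = {\<phi>. depends_on_coords m \<phi> \<and> smooth m \<phi> \<and>
     (\<forall>\<alpha> :: nat \<Rightarrow> nat. \<forall>is\<in>lists {1..m}. \<exists>B. \<forall>x.
        norm (of_real (\<Prod>i=1..m. x i ^ \<alpha> i) * fold pdiff is \<phi> x) \<le> B)}"


section \<open>The Grassmann algebra\<close>

text \<open>
  An element \<open>a\<close> of the Grassmann algebra on anti-commuting generators \<open>\<xi>\<^sub>j\<close> (\<open>j :: nat\<close>) is the family of
  its coefficients: it stands for the sum of \<open>a A \<xi>\<^sub>A\<close>, where \<open>\<xi>\<^sub>A\<close> is the product of the \<open>\<xi>\<^sub>j\<close>,
  \<open>j \<in> A\<close>, in increasing order of \<open>j\<close>.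
\<close>

type_synonym grassmann = "nat set \<Rightarrow> complex"

definition gvar :: "nat \<Rightarrow> grassmann" where
  "gvar j = (\<lambda>A. if A = {j} then 1 else 0)"

definition gone :: grassmann where
  "gone = (\<lambda>A. if A = {} then 1 else 0)"

text \<open>For disjoint \<open>A\<close>, \<open>B\<close> one has \<open>\<xi>\<^sub>A \<xi>\<^sub>B = gsign A B \<cdot> \<xi>\<^bsub>A \<union> B\<^esub>\<close>: the sign counts the inversions.\<close>

definition gsign :: "nat set \<Rightarrow> nat set \<Rightarrow> complex" where
  "gsign A B = (-1) ^ card {(i, j). i \<in> A \<and> j \<in> B \<and> j < i}"

definition gmult :: "grassmann \<Rightarrow> grassmann \<Rightarrow> grassmann" where
  "gmult a b = (\<lambda>C. \<Sum>A\<in>Pow C. gsign A (C - A) * a A * b (C - A))"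

text \<open>Left derivative: the sign comes from moving \<open>\<xi>\<^sub>j\<close> to the front of the monomial.\<close>

definition gderiv :: "nat \<Rightarrow> grassmann \<Rightarrow> grassmann" where
  "gderiv j a = (\<lambda>A. if j \<in> A then 0 else (-1) ^ card {k \<in> A. k < j} * a (insert j A))"

definition gexp :: "grassmann \<Rightarrow> grassmann" where
  "gexp a = (\<lambda>A. suminf (\<lambda>k. (gmult a ^^ k) gone A / fact k))"


section \<open>The space \<open>\<S>(\<real>\<^sup>m) \<otimes> \<Lambda>\<^sub>2\<^sub>n\<close> and its operators\<close>

text \<open>
  The anti-commuting variables \<open>x\<^sub>1, \<dots>, x\<^sub>2\<^sub>n\<close> are the generators with indices \<open>1, \<dots>, 2 n\<close>, the
  variables \<open>y\<^sub>1, \<dots>, y\<^sub>2\<^sub>n\<close> those with indices \<open>2 n + 1, \<dots>, 4 n\<close>.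
\<close>

type_synonym superfun = "(nat \<Rightarrow> real) \<Rightarrow> grassmann"

definition schwartz_grassmann :: "nat \<Rightarrow> nat \<Rightarrow> superfun set" where
  "schwartz_grassmann m n =
     {f. \<forall>A. (\<lambda>x. f x A) \<in> schwartz m \<and> (\<not> A \<subseteq> {1..2*n} \<longrightarrow> (\<lambda>x. f x A) = (\<lambda>x. 0))}"

definition super_sq :: "nat \<Rightarrow> nat \<Rightarrow> superfun \<Rightarrow> superfun" where
  "super_sq m n f = (\<lambda>x A.
     (\<Sum>j=1..n. gmult (gmult (gvar (2*j-1)) (gvar (2*j))) (f x) A)
     - (\<Sum>j=1..m. of_real ((x j)\<^sup>2) * f x A))"

definition super_laplace :: "nat \<Rightarrow> nat \<Rightarrow> superfun \<Rightarrow> superfun" where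
  "super_laplace m n f = (\<lambda>x A.
     4 * (\<Sum>j=1..n. gderiv (2*j-1) (gderiv (2*j) (f x)) A)
     - (\<Sum>j=1..m. pdiff j (pdiff j (\<lambda>x. f x A)) x))"

definition superdim :: "nat \<Rightarrow> nat \<Rightarrow> int" where
  "superdim m n = int m - 2 * int n"

definition pairing :: "nat \<Rightarrow> nat \<Rightarrow> (nat \<Rightarrow> real) \<Rightarrow> (nat \<Rightarrow> real) \<Rightarrow> grassmann" where
  "pairing m n x y = (\<lambda>A.
     - of_real (\<Sum>i=1..m. x i * y i) * gone A
     + (\<Sum>j=1..n. gmult (gvar (2*j-1)) (gvar (2*n + 2*j)) A
                 - gmult (gvar (2*j)) (gvar (2*n + (2*j-1))) A) / 2)"

definition berezin :: "nat \<Rightarrow> grassmann \<Rightarrow> grassmann" where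
  "berezin n a = (\<lambda>A. fold gderiv [1..<2*n+1] a A / of_real (pi ^ n))"

text \<open>
  The transform for the sign \<open>s = 1\<close> or \<open>s = -1\<close>. The result of the Berezin integration only involves
  the variables \<open>y\<^sub>j\<close>, i.e. the generators \<open>2 n + j\<close>; reading off the coefficient at \<open>(+) (2 * n) ` B\<close>
  renames them to \<open>x\<^sub>j\<close>.
\<close>

definition fourier_scalar :: "nat \<Rightarrow> nat \<Rightarrow> real \<Rightarrow> superfun \<Rightarrow> superfun" where
  "fourier_scalar m n s f = (\<lambda>y B.
     of_real ((2 * pi) powr (- of_int (superdim m n) / 2)) *
     (\<integral>x. berezin n
            (gmult (gexp (\<lambda>A. - of_real s * \<i> * pairing m n x y A)) (f x))
            ((+) (2 * n) ` B)
      \<partial>(PiM {1..m} (\<lambda>_. lborel))))"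


section \<open>The operator exponential\<close>

definition bos_op :: "nat \<Rightarrow> ((nat \<Rightarrow> real) \<Rightarrow> complex) \<Rightarrow> (nat \<Rightarrow> real) \<Rightarrow> complex" where
  "bos_op m \<phi> = (\<lambda>x. - (\<Sum>j=1..m. pdiff j (pdiff j \<phi>) x)
     + (\<Sum>j=1..m. of_real ((x j)\<^sup>2) * \<phi> x) - of_nat m * \<phi> x)"

definition ferm_op :: "nat \<Rightarrow> grassmann \<Rightarrow> grassmann" where
  "ferm_op n a = (\<lambda>A. 4 * (\<Sum>j=1..n. gderiv (2*j-1) (gderiv (2*j) a) A)
     - (\<Sum>j=1..n. gmult (gmult (gvar (2*j-1)) (gvar (2*j))) a A) + 2 * of_nat n * a A)"

lemma super_op_decomposition:
  "super_laplace m n f x A - super_sq m n f x A - of_int (superdim m n) * f x A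
   = bos_op m (\<lambda>x. f x A) x + ferm_op n (f x) A"
  by (simp add: super_laplace_def super_sq_def superdim_def bos_op_def ferm_op_def algebra_simps)

text \<open>Physicists' Hermite polynomials.\<close>

primrec hermite :: "nat \<Rightarrow> real poly" where
  "hermite 0 = 1"
| "hermite (Suc k) = [:0, 2:] * hermite k - pderiv (hermite k)"

text \<open>The \<open>L\<^sup>2\<close>-normalised Hermite functions.\<close>

definition hermite_fun1 :: "nat \<Rightarrow> real \<Rightarrow> real" where
  "hermite_fun1 k t = poly (hermite k) t * exp (- t\<^sup>2 / 2) / sqrt (2 ^ k * fact k * sqrt pi)"

definition hermite_fun :: "nat \<Rightarrow> (nat \<Rightarrow> nat) \<Rightarrow> (nat \<Rightarrow> real) \<Rightarrow> complex" where
  "hermite_fun m k x = of_real (\<Prod>i=1..m. hermite_fun1 (k i) (x i))"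

definition hermite_eigval :: "nat \<Rightarrow> (nat \<Rightarrow> nat) \<Rightarrow> complex" where
  "hermite_eigval m k = (THE l. bos_op m (hermite_fun m k) = (\<lambda>x. l * hermite_fun m k x))"

definition hermite_coeff :: "nat \<Rightarrow> ((nat \<Rightarrow> real) \<Rightarrow> complex) \<Rightarrow> (nat \<Rightarrow> nat) \<Rightarrow> complex" where
  "hermite_coeff m \<phi> k = (\<integral>x. hermite_fun m k x * \<phi> x \<partial>(PiM {1..m} (\<lambda>_. lborel)))"

text \<open>
  The Hermite expansion of a Schwartz function converges absolutely at every point, so the spectral
  decomposition can be summed pointwise. Multi-indices are the extensional functions on \<open>{1..m}\<close>.
\<close>

definition bos_exp :: "nat \<Rightarrow> real \<Rightarrow> ((nat \<Rightarrow> real) \<Rightarrow> complex) \<Rightarrow> (nat \<Rightarrow> real) \<Rightarrow> complex" where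
  "bos_exp m \<theta> \<phi> = (\<lambda>x. \<Sum>\<^sub>\<infinity>k\<in>PiE {1..m} (\<lambda>_. UNIV).
     exp (\<i> * of_real \<theta> * hermite_eigval m k) * hermite_coeff m \<phi> k * hermite_fun m k x)"

definition ferm_exp :: "nat \<Rightarrow> real \<Rightarrow> grassmann \<Rightarrow> grassmann" where
  "ferm_exp n \<theta> a = (\<lambda>A. suminf (\<lambda>k. (\<i> * of_real \<theta>) ^ k / fact k * (ferm_op n ^^ k) a A))"

definition super_exp_scalar :: "nat \<Rightarrow> nat \<Rightarrow> real \<Rightarrow> superfun \<Rightarrow> superfun" where
  "super_exp_scalar m n \<theta> f = (\<lambda>x A. bos_exp m \<theta> (\<lambda>x. ferm_exp n \<theta> (f x) A) x)"

lemma hermite_ode: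
  "pderiv (pderiv (hermite k)) - [:0, 2:] * pderiv (hermite k) = - smult (2 * of_nat k) (hermite k)"
proof (induction k)
  case 0
  show ?case by (simp add: pderiv_1)
next
  case (Suc k)
  let ?H = "hermite k" and ?X = "[:0, 2:] :: real poly"
  have X: "pderiv ?X = [:2:]" by (simp add: pderiv_pCons)
  have D1: "pderiv (hermite (Suc k)) = smult (2 * of_nat (Suc k)) ?H"
  proof -
    have "pderiv (hermite (Suc k)) = [:2:] * ?H - (pderiv (pderiv ?H) - ?X * pderiv ?H)"
      by (simp only: hermite.simps pderiv_diff pderiv_mult X) (simp only: algebra_simps)
    also have "\<dots> = smult 2 ?H + smult (2 * of_nat k) ?H"
      unfolding Suc.IH by simp
    finally show ?thesis by (simp add: algebra_simps smult_add_left[symmetric])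
  qed
  have "pderiv (pderiv (hermite (Suc k))) - ?X * pderiv (hermite (Suc k))
        = smult (2 * of_nat (Suc k)) (pderiv ?H) - ?X * smult (2 * of_nat (Suc k)) ?H"
    unfolding D1 by (simp only: pderiv_smult)
  also have "\<dots> = - smult (2 * of_nat (Suc k)) (?X * ?H - pderiv ?H)"
    by (simp only: smult_diff_right mult_smult_right minus_diff_eq)
  finally show ?case by (simp only: hermite.simps)
qed

lemma gauss_poly_deriv:
  "((\<lambda>t. poly p t * exp (- t\<^sup>2 / 2) * c) has_real_derivative
     poly (pderiv p - [:0, 1:] * p) t * exp (- t\<^sup>2 / 2) * c) (at t)"
  by (auto intro!: derivative_eq_intros poly_DERIV simp: algebra_simps)

lemma hermite_fun1_deriv2:
  obtains h where
    "\<And>t. (hermite_fun1 k has_real_derivative h t) (at t)"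
    "\<And>t. (h has_real_derivative (t\<^sup>2 - 2 * of_nat k - 1) * hermite_fun1 k t) (at t)"
proof -
  define c where "c = inverse (sqrt (2 ^ k * fact k * sqrt pi))"
  define p where "p = hermite k"
  define q where "q = pderiv p - [:0, 1:] * p"
  have e: "hermite_fun1 k = (\<lambda>t. poly p t * exp (- t\<^sup>2 / 2) * c)"
    by (rule ext) (simp only: hermite_fun1_def p_def c_def divide_inverse[of "_ * _"])
  have 2: "poly (pderiv q - [:0, 1:] * q) t = (t\<^sup>2 - 2 * of_nat k - 1) * poly p t" for t
  proof -
    have "poly (pderiv (pderiv p) - [:0, 2:] * pderiv p) t = - 2 * of_nat k * poly p t"
      using hermite_ode[of k] by (simp add: p_def)
    then show ?thesis
      by (simp add: q_def pderiv_diff pderiv_mult pderiv_pCons algebra_simps power2_eq_square)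
  qed
  show ?thesis
  proof (rule that)
    show "(hermite_fun1 k has_real_derivative poly q t * exp (- t\<^sup>2 / 2) * c) (at t)" for t
      unfolding e q_def by (rule gauss_poly_deriv)
    show "((\<lambda>t. poly q t * exp (- t\<^sup>2 / 2) * c) has_real_derivative
            (t\<^sup>2 - 2 * of_nat k - 1) * hermite_fun1 k t) (at t)" for t
      using gauss_poly_deriv[of q c t] unfolding 2 e by (simp add: mult.assoc)
  qed
qed

lemma hermite_fun_pdiff2:
  assumes i: "i \<in> {1..m}"
  shows "pdiff i (pdiff i (hermite_fun m k)) x
         = of_real ((x i)\<^sup>2 - 2 * of_nat (k i) - 1) * hermite_fun m k x"
proof -
  obtain h where h: "\<And>t. (hermite_fun1 (k i) has_real_derivative h t) (at t)"
    "\<And>t. (h has_real_derivative (t\<^sup>2 - 2 * of_nat (k i) - 1) * hermite_fun1 (k i) t) (at t)"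
    using hermite_fun1_deriv2 by blast
  define P where "P x = (\<Prod>j\<in>{1..m}-{i}. hermite_fun1 (k j) (x j))" for x :: "nat \<Rightarrow> real"
  have P: "P (x(i := t)) = P x" for x t
    unfolding P_def by (rule prod.cong) auto
  have H: "hermite_fun m k x = of_real (hermite_fun1 (k i) (x i) * P x)" for x
    unfolding hermite_fun_def P_def using i by (subst prod.remove[of _ i]) auto
  have v: "vector_derivative (\<lambda>t. of_real (g t * P x) :: complex) (at u) = of_real (g' * P x)"
    if "(g has_real_derivative g') (at u)" for g g' u x
  proof (rule vector_derivative_at)
    have "((\<lambda>t. g t * P x) has_real_derivative g' * P x) (at u)"
      using that by (rule DERIV_cmult_right)
    then show "((\<lambda>t. of_real (g t * P x) :: complex) has_vector_derivative of_real (g' * P x)) (at u)"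
      by (intro has_vector_derivative_of_real) 
         (simp add: has_real_derivative_iff_has_vector_derivative)
  qed
  have 1: "pdiff i (hermite_fun m k) = (\<lambda>x. of_real (h (x i) * P x))"
    by (rule ext) (simp add: pdiff_def H P v[OF h(1)] del: of_real_mult)
  show ?thesis
    unfolding 1 by (simp add: pdiff_def H P v[OF h(2)] del: of_real_mult) simp
qed

lemma bos_op_hermite_fun:
  "bos_op m (hermite_fun m k) = (\<lambda>x. 2 * of_nat (\<Sum>i=1..m. k i) * hermite_fun m k x)"
proof
  fix x
  have "(\<Sum>j=1..m. pdiff j (pdiff j (hermite_fun m k)) x)
        = (\<Sum>j=1..m. of_real ((x j)\<^sup>2 - 2 * of_nat (k j) - 1) * hermite_fun m k x)"
    by (intro sum.cong refl hermite_fun_pdiff2) auto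
  then show "bos_op m (hermite_fun m k) x = 2 * of_nat (\<Sum>i=1..m. k i) * hermite_fun m k x"
    by (simp add: bos_op_def algebra_simps sum.distrib sum_subtractf sum_distrib_left sum_distrib_right)
qed

lemma hermite_nonzero: "hermite k \<noteq> 0"
proof -
  have "degree (hermite k) = k \<and> coeff (hermite k) k = 2 ^ k"
  proof (induction k)
    case (Suc k)
    have c: "coeff (hermite (Suc k)) i = 2 * (case i of 0 \<Rightarrow> 0 | Suc j \<Rightarrow> coeff (hermite k) j)
        - of_nat (Suc i) * coeff (hermite k) (Suc i)" for i
      by (simp add: coeff_pderiv coeff_pCons split: nat.splits)
    have "degree (hermite (Suc k)) \<le> Suc k"
      by (rule degree_le) (auto simp: c Suc coeff_eq_0 simp del: hermite.simps split: nat.splits)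
    moreover have k: "coeff (hermite (Suc k)) (Suc k) = 2 ^ Suc k"
      unfolding c using Suc by (simp add: coeff_eq_0)
    moreover from k have "Suc k \<le> degree (hermite (Suc k))"
      by (intro le_degree) (simp del: hermite.simps)
    ultimately show ?case by (simp del: hermite.simps)
  qed simp
  then show ?thesis by auto
qed

lemma hermite_fun_nonzero: "\<exists>x. hermite_fun m k x \<noteq> 0"
proof -
  have "\<exists>t. hermite_fun1 i t \<noteq> 0" for i
    using hermite_nonzero[of i] poly_all_0_iff_0[of "hermite i"] by (auto simp: hermite_fun1_def)
  then obtain t where "\<And>i. hermite_fun1 i (t i) \<noteq> 0" by metis
  then have "hermite_fun m k (\<lambda>i. t (k i)) \<noteq> 0" by (simp add: hermite_fun_def)
  then show ?thesis by blast
qed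

lemma hermite_eigval_eq: "hermite_eigval m k = 2 * of_nat (\<Sum>i=1..m. k i)"
  unfolding hermite_eigval_def
proof (rule the_equality)
  fix l assume "bos_op m (hermite_fun m k) = (\<lambda>x. l * hermite_fun m k x)"
  then show "l = 2 * of_nat (\<Sum>i=1..m. k i)"
    using hermite_fun_nonzero[of m k] unfolding bos_op_hermite_fun by (metis mult_right_cancel)
qed (rule bos_op_hermite_fun)


section \<open>The Clifford--Weyl algebra \<open>\<C>\<close>\<close>

text \<open>
  The free algebra on a set of generators is the monoid algebra of the free monoid (words under
  concatenation): finitely supported functions on words with the convolution product.
\<close>

datatype cw_gen = Orth nat | Symp nat

datatype cw_word = Word (letters: "cw_gen list")

instantiation cw_word :: monoid_add
begin
definition zero_cw_word :: cw_word where "0 = Word []"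
definition plus_cw_word :: "cw_word \<Rightarrow> cw_word \<Rightarrow> cw_word" where
  "u + v = Word (letters u @ letters v)"
instance by standard (auto simp: zero_cw_word_def plus_cw_word_def)
end

type_synonym cw_free = "cw_word \<Rightarrow>\<^sub>0 complex"

abbreviation cw_const :: "complex \<Rightarrow> cw_free" where
  "cw_const z \<equiv> Poly_Mapping.single 0 z"

definition cw_free_algebra :: "nat \<Rightarrow> nat \<Rightarrow> cw_free set" where
  "cw_free_algebra m n =
     {p. \<forall>w\<in>Poly_Mapping.keys p. set (letters w) \<subseteq> Orth ` {1..m} \<union> Symp ` {1..2*n}}"

definition gen_e :: "nat \<Rightarrow> cw_free" where
  "gen_e j = Poly_Mapping.single (Word [Orth j]) 1"

definition gen_s :: "nat \<Rightarrow> cw_free" where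
  "gen_s j = Poly_Mapping.single (Word [Symp j]) 1"

text \<open>Each element \<open>r\<close> of this set stands for the relation \<open>r = 0\<close>.\<close>

definition cw_relators :: "nat \<Rightarrow> nat \<Rightarrow> cw_free set" where
  "cw_relators m n =
     {gen_e j * gen_e k + gen_e k * gen_e j + cw_const (if j = k then 2 else 0) | j k.
        j \<in> {1..m} \<and> k \<in> {1..m}} \<union>
     {gen_s (2*j) * gen_s (2*k) - gen_s (2*k) * gen_s (2*j) | j k.
        j \<in> {1..n} \<and> k \<in> {1..n}} \<union>
     {gen_s (2*j-1) * gen_s (2*k-1) - gen_s (2*k-1) * gen_s (2*j-1) | j k.
        j \<in> {1..n} \<and> k \<in> {1..n}} \<union>
     {gen_s (2*j-1) * gen_s (2*k) - gen_s (2*k) * gen_s (2*j-1)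
        - cw_const (if j = k then 1 else 0) | j k.
        j \<in> {1..n} \<and> k \<in> {1..n}} \<union>
     {gen_e j * gen_s k + gen_s k * gen_e j | j k.
        j \<in> {1..m} \<and> k \<in> {1..2*n}}"

text \<open>The two-sided ideal generated by the relators.\<close>

inductive_set cw_ideal :: "nat \<Rightarrow> nat \<Rightarrow> cw_free set" for m n where
  zero: "0 \<in> cw_ideal m n"
| relator: "r \<in> cw_relators m n \<Longrightarrow> a \<in> cw_free_algebra m n \<Longrightarrow> b \<in> cw_free_algebra m n \<Longrightarrow>
    a * r * b \<in> cw_ideal m n"
| add: "p \<in> cw_ideal m n \<Longrightarrow> q \<in> cw_ideal m n \<Longrightarrow> p + q \<in> cw_ideal m n"

definition cw_cong :: "nat \<Rightarrow> nat \<Rightarrow> cw_free rel" where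
  "cw_cong m n = {(p, q). p \<in> cw_free_algebra m n \<and> q \<in> cw_free_algebra m n \<and> p - q \<in> cw_ideal m n}"

definition cw_algebra :: "nat \<Rightarrow> nat \<Rightarrow> cw_free set set" where
  "cw_algebra m n = cw_free_algebra m n // cw_cong m n"

definition cw_class :: "nat \<Rightarrow> nat \<Rightarrow> cw_free \<Rightarrow> cw_free set" where
  "cw_class m n p = cw_cong m n `` {p}"


section \<open>The space \<open>\<S>(\<real>\<^sup>m) \<otimes> \<Lambda>\<^sub>2\<^sub>n \<otimes> \<C>\<close>\<close>

text \<open>
  Since \<open>\<S>(\<real>\<^sup>m) \<otimes> \<Lambda>\<^sub>2\<^sub>n\<close> consists of complex-valued functions of a point \<open>x\<close> and an index set \<open>A\<close>, its
  tensor product with \<open>\<C>\<close> is a space of \<open>\<C>\<close>-valued functions of \<open>x\<close> and \<open>A\<close>, namely the one consisting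
  of the finite sums \<open>\<Sum>\<^sub>k \<phi>\<^sub>k \<otimes> [c\<^sub>k]\<close>, where \<open>(\<phi> \<otimes> [c]) x A = \<phi> x A \<cdot> [c]\<close>. The classes are added and
  scaled through representatives in the free algebra.
\<close>

definition tensor_sum :: "nat \<Rightarrow> nat \<Rightarrow> nat \<Rightarrow> (nat \<Rightarrow> superfun) \<Rightarrow> (nat \<Rightarrow> cw_free)
    \<Rightarrow> (nat \<Rightarrow> real) \<Rightarrow> nat set \<Rightarrow> cw_free set" where
  "tensor_sum m n N \<phi> c = (\<lambda>x A. cw_class m n (\<Sum>k<N. cw_const (\<phi> k x A) * c k))"

definition super_schwartz :: "nat \<Rightarrow> nat \<Rightarrow> ((nat \<Rightarrow> real) \<Rightarrow> nat set \<Rightarrow> cw_free set) set" where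
  "super_schwartz m n = {tensor_sum m n N \<phi> c | N \<phi> c.
     \<forall>k<N. \<phi> k \<in> schwartz_grassmann m n \<and> c k \<in> cw_free_algebra m n}"

text \<open>The operator \<open>T \<otimes> id\<close> for \<open>T\<close> acting on \<open>\<S>(\<real>\<^sup>m) \<otimes> \<Lambda>\<^sub>2\<^sub>n\<close>.\<close>

definition tensor_id :: "nat \<Rightarrow> nat \<Rightarrow> (superfun \<Rightarrow> superfun)
    \<Rightarrow> ((nat \<Rightarrow> real) \<Rightarrow> nat set \<Rightarrow> cw_free set) \<Rightarrow> (nat \<Rightarrow> real) \<Rightarrow> nat set \<Rightarrow> cw_free set" where
  "tensor_id m n T f = (THE g. \<exists>N \<phi> c.
     (\<forall>k<N. \<phi> k \<in> schwartz_grassmann m n \<and> c k \<in> cw_free_algebra m n) \<and>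
     f = tensor_sum m n N \<phi> c \<and> g = tensor_sum m n N (\<lambda>k. T (\<phi> k)) c)"

text \<open>
  For linear \<open>T\<close> the value of \<^const>\<open>tensor_id\<close> does not depend on the chosen decomposition of its
  argument.
\<close>

lemma fold_pdiff_lincomb:
  assumes \<phi>: "smooth m \<phi>" and \<psi>: "smooth m \<psi>" and is_in: "is \<in> lists {1..m}"
  shows "fold pdiff is (\<lambda>x. a * \<phi> x + b * \<psi> x) = (\<lambda>x. a * fold pdiff is \<phi> x + b * fold pdiff is \<psi> x)"
  using is_in
proof (induction "is" rule: rev_induct)
  case (snoc i js)
  then have js: "js \<in> lists {1..m}" and i: "i \<in> {1..m}" by auto
  have "vector_derivative (\<lambda>t. a * fold pdiff js \<phi> (x(i := t)) + b * fold pdiff js \<psi> (x(i := t))) (at (x i))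
      = a * pdiff i (fold pdiff js \<phi>) x + b * pdiff i (fold pdiff js \<psi>) x" for x
    unfolding pdiff_def[of i]
    by (intro vector_derivative_at has_vector_derivative_add has_vector_derivative_mult_right)
       (use \<phi> \<psi> js i in \<open>simp_all add: smooth_def vector_derivative_works[symmetric]\<close>)
  then show ?case
    unfolding fold_append comp_apply snoc.IH[OF js] by (simp add: fun_eq_iff pdiff_def[of i "\<lambda>x. _ x + _ x"])
qed simp

lemma schwartz_lincomb:
  assumes \<phi>: "\<phi> \<in> schwartz m" and \<psi>: "\<psi> \<in> schwartz m"
  shows "(\<lambda>x. a * \<phi> x + b * \<psi> x) \<in> schwartz m"
proof -
  have sm: "smooth m \<phi>" "smooth m \<psi>" using assms by (auto simp: schwartz_def)
  note F = fold_pdiff_lincomb[OF sm, of _ a b]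
  have "depends_on_coords m (\<lambda>x. a * \<phi> x + b * \<psi> x)"
    unfolding depends_on_coords_def
  proof (intro allI impI)
    fix x y :: "nat \<Rightarrow> real" assume "\<forall>i\<in>{1..m}. x i = y i"
    then have "\<phi> x = \<phi> y" "\<psi> x = \<psi> y"
      using assms unfolding schwartz_def depends_on_coords_def by blast+
    then show "a * \<phi> x + b * \<psi> x = a * \<phi> y + b * \<psi> y" by simp
  qed
  moreover have "smooth m (\<lambda>x. a * \<phi> x + b * \<psi> x)"
    unfolding smooth_def
  proof (intro ballI conjI allI)
    fix "is" assume is_in: "is \<in> lists {1..m}"
    show "continuous_on UNIV (fold pdiff is (\<lambda>x. a * \<phi> x + b * \<psi> x))"
      unfolding F[OF is_in] using sm is_in unfolding smooth_def
      by (intro continuous_intros) blast+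
    fix i x assume i: "i \<in> {1..m}"
    show "(\<lambda>t. fold pdiff is (\<lambda>x. a * \<phi> x + b * \<psi> x) (x(i := t))) differentiable (at (x i))"
      unfolding F[OF is_in] using sm is_in i unfolding smooth_def
      by (intro differentiable_add differentiable_mult differentiable_const) blast+
  qed
  moreover have "\<exists>B. \<forall>x. norm (of_real (\<Prod>i=1..m. x i ^ \<alpha> i) * fold pdiff is (\<lambda>x. a * \<phi> x + b * \<psi> x) x) \<le> B"
    if is_in: "is \<in> lists {1..m}" for \<alpha> :: "nat \<Rightarrow> nat" and "is"
  proof -
    let ?p = "\<lambda>x::nat \<Rightarrow> real. of_real (\<Prod>i=1..m. x i ^ \<alpha> i) :: complex"
    obtain B1 where B1: "\<And>x. norm (?p x * fold pdiff is \<phi> x) \<le> B1"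
      using \<phi> is_in unfolding schwartz_def by blast
    obtain B2 where B2: "\<And>x. norm (?p x * fold pdiff is \<psi> x) \<le> B2"
      using \<psi> is_in unfolding schwartz_def by blast
    have "norm (?p x * fold pdiff is (\<lambda>x. a * \<phi> x + b * \<psi> x) x) \<le> norm a * B1 + norm b * B2" for x
    proof -
      have "?p x * fold pdiff is (\<lambda>x. a * \<phi> x + b * \<psi> x) x
          = a * (?p x * fold pdiff is \<phi> x) + b * (?p x * fold pdiff is \<psi> x)"
        unfolding F[OF is_in] by (simp add: algebra_simps)
      also have "norm \<dots> \<le> norm a * B1 + norm b * B2"
        by (rule order.trans[OF norm_triangle_ineq])
           (simp only: norm_mult[of a] norm_mult[of b], intro add_mono mult_left_mono B1 B2 norm_ge_zero)
      finally show ?thesis .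
    qed
    then show ?thesis by blast
  qed
  ultimately show ?thesis unfolding schwartz_def by blast
qed

lemma zero_schwartz: "(\<lambda>x. 0) \<in> schwartz m"
proof -
  have "fold pdiff is (\<lambda>x. 0) = (\<lambda>x. 0)" for "is"
    by (induction "is") (auto simp: pdiff_def)
  then show ?thesis by (auto simp: schwartz_def smooth_def depends_on_coords_def)
qed

lemma schwartz_grassmann_lincomb:
  assumes "f \<in> schwartz_grassmann m n" "g \<in> schwartz_grassmann m n"
  shows "(\<lambda>x A. a * f x A + b * g x A) \<in> schwartz_grassmann m n"
  unfolding schwartz_grassmann_def
proof (intro CollectI allI conjI impI)
  show "(\<lambda>x. a * f x A + b * g x A) \<in> schwartz m" for A
    using assms unfolding schwartz_grassmann_def by (intro schwartz_lincomb) blast+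
  show "(\<lambda>x. a * f x A + b * g x A) = (\<lambda>x. 0)" if "\<not> A \<subseteq> {1..2*n}" for A
    using assms that unfolding schwartz_grassmann_def by (simp add: fun_eq_iff)
qed

lemma zero_schwartz_grassmann: "(\<lambda>x A. 0) \<in> schwartz_grassmann m n"
  by (simp add: schwartz_grassmann_def zero_schwartz)

lemma cw_free_algebra_const: "cw_const z \<in> cw_free_algebra m n"
  by (auto simp: cw_free_algebra_def zero_cw_word_def)

lemma cw_free_algebra_add:
  "p \<in> cw_free_algebra m n \<Longrightarrow> q \<in> cw_free_algebra m n \<Longrightarrow> p + q \<in> cw_free_algebra m n"
  using keys_add[of p q] unfolding cw_free_algebra_def by blast

lemma cw_free_algebra_mult:
  assumes "p \<in> cw_free_algebra m n" "q \<in> cw_free_algebra m n"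
  shows "p * q \<in> cw_free_algebra m n"
proof -
  have "set (letters w) \<subseteq> Orth ` {1..m} \<union> Symp ` {1..2*n}" if w: "w \<in> Poly_Mapping.keys (p * q)" for w
  proof -
    obtain u v where uv: "u \<in> Poly_Mapping.keys p" "v \<in> Poly_Mapping.keys q" "w = u + v"
      using keys_mult[of p q] w by blast
    then show ?thesis using assms by (auto simp: cw_free_algebra_def plus_cw_word_def)
  qed
  then show ?thesis by (simp add: cw_free_algebra_def)
qed

lemma cw_free_algebra_sum:
  assumes "\<And>k. k < (N::nat) \<Longrightarrow> p k \<in> cw_free_algebra m n"
  shows "(\<Sum>k<N. p k) \<in> cw_free_algebra m n"
  using assms
proof (induction N)
  case 0
  show ?case using cw_free_algebra_const[of 0 m n] by simp
qed (simp add: cw_free_algebra_add)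

lemma cw_ideal_scale: "p \<in> cw_ideal m n \<Longrightarrow> cw_const z * p \<in> cw_ideal m n"
proof (induction rule: cw_ideal.induct)
  case (relator r a b)
  then have "(cw_const z * a) * r * b \<in> cw_ideal m n"
    by (intro cw_ideal.relator cw_free_algebra_mult cw_free_algebra_const)
  then show ?case by (simp add: mult.assoc)
qed (simp_all add: cw_ideal.zero cw_ideal.add distrib_left)

lemma cw_const_minus_one: "cw_const (- 1) * p = - (p :: cw_free)"
  by (simp add: single_uminus)

lemma cw_ideal_uminus: "p \<in> cw_ideal m n \<Longrightarrow> - p \<in> cw_ideal m n"
  using cw_ideal_scale[of p m n "- 1"] by (simp add: cw_const_minus_one)

lemma equiv_cw_cong: "equiv (cw_free_algebra m n) (cw_cong m n)"
proof (rule equivI)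
  show "sym (cw_cong m n)"
    unfolding cw_cong_def by (rule symI) (use cw_ideal_uminus in force)
  show "trans (cw_cong m n)"
  proof (rule transI)
    fix p q r assume "(p, q) \<in> cw_cong m n" "(q, r) \<in> cw_cong m n"
    then show "(p, r) \<in> cw_cong m n"
      using cw_ideal.add[of "p - q" m n "q - r"] by (auto simp: cw_cong_def)
  qed
qed (auto simp: cw_cong_def refl_on_def intro: cw_ideal.zero)

lemma cw_class_eq_iff:
  assumes "p \<in> cw_free_algebra m n" "q \<in> cw_free_algebra m n"
  shows "cw_class m n p = cw_class m n q \<longleftrightarrow> p - q \<in> cw_ideal m n"
  unfolding cw_class_def using eq_equiv_class_iff[OF equiv_cw_cong assms] assms
  by (simp add: cw_cong_def)

lemma cw_ideal_separation:
  assumes v: "v \<notin> cw_ideal m n"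
  obtains l :: "cw_free \<Rightarrow> complex"
  where "\<And>p q. l (p + q) = l p + l q" "\<And>z p. l (cw_const z * p) = z * l p"
    "\<And>p. p \<in> cw_ideal m n \<Longrightarrow> l p = 0" "l v = 1"
proof -
  interpret V: vector_space "\<lambda>z (p :: cw_free). cw_const z * p"
    by unfold_locales (simp_all add: distrib_left distrib_right single_add mult_single mult.assoc[symmetric])
  interpret C: vector_space "(*) :: complex \<Rightarrow> complex \<Rightarrow> complex"
    by unfold_locales (simp_all add: algebra_simps)
  interpret VC: vector_space_pair "\<lambda>z (p :: cw_free). cw_const z * p" "(*) :: complex \<Rightarrow> complex \<Rightarrow> complex" ..
  have sub: "V.subspace (cw_ideal m n)"
    unfolding V.subspace_def by (auto intro: cw_ideal.zero cw_ideal.add cw_ideal_scale)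
  obtain B where B: "B \<subseteq> cw_ideal m n" "V.independent B" "cw_ideal m n \<subseteq> V.span B"
    using V.maximal_independent_subset by metis
  have "v \<notin> V.span B" using V.span_minimal[OF B(1) sub] v by blast
  then have "V.independent (insert v B)" using B(2) by (rule V.independent_insertI)
  then obtain l where l: "Vector_Spaces.linear (\<lambda>z (p :: cw_free). cw_const z * p) (*) l"
      and lB: "\<And>b. b \<in> insert v B \<Longrightarrow> l b = (if b = v then 1 else 0)"
    using VC.linear_independent_extend[of "insert v B" "\<lambda>b. if b = v then 1 else 0"] by blast
  have "l p = 0" if "p \<in> cw_ideal m n" for p
  proof (rule VC.linear_eq_0_on_span[OF l])
    show "l b = 0" if "b \<in> B" for b
      using that lB[of b] v B(1) by auto
    show "p \<in> V.span B" using that B(3) by blast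
  qed
  moreover have "l v = 1" using lB by simp
  ultimately show ?thesis
    using that[of l] l VC.linear_add[OF l] VC.linear_scale[OF l] by blast
qed

lemma sum_lessThan_add:
  "(\<Sum>k<N + M. f k) = (\<Sum>k<N. f k) + (\<Sum>k<M. f (N + k))" for f :: "nat \<Rightarrow> 'a::comm_monoid_add"
  by (induction M) (simp_all add: add.assoc)

lemma tensor_id_tensor_sum:
  assumes add: "\<And>f g. f \<in> schwartz_grassmann m n \<Longrightarrow> g \<in> schwartz_grassmann m n \<Longrightarrow>
      T (\<lambda>x A. f x A + g x A) = (\<lambda>x A. T f x A + T g x A)"
    and scale: "\<And>z f. f \<in> schwartz_grassmann m n \<Longrightarrow> T (\<lambda>x A. z * f x A) = (\<lambda>x A. z * T f x A)"
    and \<phi>: "\<And>k. k < N \<Longrightarrow> \<phi> k \<in> schwartz_grassmann m n"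
    and c: "\<And>k. k < N \<Longrightarrow> c k \<in> cw_free_algebra m n"
  shows "tensor_id m n T (tensor_sum m n N \<phi> c) = tensor_sum m n N (\<lambda>k. T (\<phi> k)) c"
proof -
  have T_sum: "(\<lambda>x A. \<Sum>k<K. z k * h k x A) \<in> schwartz_grassmann m n \<and>
      T (\<lambda>x A. \<Sum>k<K. z k * h k x A) = (\<lambda>x A. \<Sum>k<K. z k * T (h k) x A)"
    if "\<And>k. k < K \<Longrightarrow> h k \<in> schwartz_grassmann m n" for K :: nat and h and z :: "nat \<Rightarrow> complex"
    using that
  proof (induction K)
    case 0
    show ?case using scale[OF zero_schwartz_grassmann, of 0] by (simp add: zero_schwartz_grassmann)
  next
    case (Suc K)
    let ?S = "\<lambda>x A. \<Sum>k<K. z k * h k x A"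
    have S: "?S \<in> schwartz_grassmann m n" "T ?S = (\<lambda>x A. \<Sum>k<K. z k * T (h k) x A)"
      and K: "h K \<in> schwartz_grassmann m n"
      using Suc by auto
    have zK: "(\<lambda>x A. z K * h K x A) \<in> schwartz_grassmann m n"
      using schwartz_grassmann_lincomb[OF K K, of "z K" 0] by simp
    show ?case
      using schwartz_grassmann_lincomb[OF S(1) zK, of 1 1] add[OF S(1) zK] scale[OF K, of "z K"] S(2)
      by simp
  qed
  have null: "(\<Sum>k<K. cw_const (T (h k) y B) * d k) \<in> cw_ideal m n"
    if h: "\<And>k. k < K \<Longrightarrow> h k \<in> schwartz_grassmann m n"
      and I: "\<And>x A. (\<Sum>k<K. cw_const (h k x A) * d k) \<in> cw_ideal m n" for K :: nat and h d y B
  proof (rule ccontr)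
    assume "(\<Sum>k<K. cw_const (T (h k) y B) * d k) \<notin> cw_ideal m n"
    then obtain l :: "cw_free \<Rightarrow> complex" where l: "\<And>p q. l (p + q) = l p + l q"
        "\<And>z p. l (cw_const z * p) = z * l p" "\<And>p. p \<in> cw_ideal m n \<Longrightarrow> l p = 0"
        "l (\<Sum>k<K. cw_const (T (h k) y B) * d k) = 1"
      using cw_ideal_separation by blast
    have l_sum: "l (\<Sum>k<K. cw_const (a k) * d k) = (\<Sum>k<K. l (d k) * a k)" for a
      by (induction K) (simp_all add: l(1,2) mult.commute l(3)[OF cw_ideal.zero])
    have "(\<Sum>k<K. l (d k) * h k x A) = 0" for x A
      using l(3)[OF I] by (simp add: l_sum)
    then have "(\<lambda>x A. \<Sum>k<K. l (d k) * T (h k) x A) = (\<lambda>x A. 0)"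
      using T_sum[of K h "\<lambda>k. l (d k)", OF h] scale[OF zero_schwartz_grassmann, of 0] by simp
    then have "(\<Sum>k<K. l (d k) * T (h k) y B) = 0" by meson
    then show False using l(4) by (simp add: l_sum)
  qed
  have unique: "tensor_sum m n M (\<lambda>k. T (\<psi> k)) d = tensor_sum m n N (\<lambda>k. T (\<phi> k)) c"
    if eq: "tensor_sum m n N \<phi> c = tensor_sum m n M \<psi> d"
      and \<psi>: "\<And>k. k < M \<Longrightarrow> \<psi> k \<in> schwartz_grassmann m n"
      and d: "\<And>k. k < M \<Longrightarrow> d k \<in> cw_free_algebra m n" for M \<psi> d
  proof -
    define h where "h k = (if k < N then \<phi> k else \<psi> (k - N))" for k
    define e where "e k = (if k < N then c k else - d (k - N))" for k
    have split: "(\<Sum>k<N + M. cw_const (S (h k) x A) * e k)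
        = (\<Sum>k<N. cw_const (S (\<phi> k) x A) * c k) - (\<Sum>k<M. cw_const (S (\<psi> k) x A) * d k)"
      for x A and S :: "superfun \<Rightarrow> superfun"
      by (simp add: sum_lessThan_add h_def e_def sum_negf)
    have fa1: "(\<Sum>k<N. cw_const (a k) * c k) \<in> cw_free_algebra m n" for a
      by (intro cw_free_algebra_sum cw_free_algebra_mult cw_free_algebra_const c)
    have fa2: "(\<Sum>k<M. cw_const (a k) * d k) \<in> cw_free_algebra m n" for a
      by (intro cw_free_algebra_sum cw_free_algebra_mult cw_free_algebra_const d)
    have "(\<Sum>k<N + M. cw_const (h k x A) * e k) \<in> cw_ideal m n" for x A
      using fun_cong[OF fun_cong[OF eq], of x A] split[of "\<lambda>f. f" x A]
      by (simp add: tensor_sum_def cw_class_eq_iff fa1 fa2)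
    moreover have "h k \<in> schwartz_grassmann m n" if "k < N + M" for k
      using that \<phi> \<psi> by (auto simp: h_def)
    ultimately have "(\<Sum>k<N + M. cw_const (T (h k) x A) * e k) \<in> cw_ideal m n" for x A
      by (intro null) auto
    then have "cw_class m n (\<Sum>k<N. cw_const (T (\<phi> k) x A) * c k)
        = cw_class m n (\<Sum>k<M. cw_const (T (\<psi> k) x A) * d k)" for x A
      by (simp add: split cw_class_eq_iff fa1 fa2)
    then show ?thesis by (simp add: tensor_sum_def)
  qed
  show ?thesis
    unfolding tensor_id_def
  proof (rule the_equality)
    show "\<exists>N' \<phi>' c'. (\<forall>k<N'. \<phi>' k \<in> schwartz_grassmann m n \<and> c' k \<in> cw_free_algebra m n) \<and>
        tensor_sum m n N \<phi> c = tensor_sum m n N' \<phi>' c' \<and>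
        tensor_sum m n N (\<lambda>k. T (\<phi> k)) c = tensor_sum m n N' (\<lambda>k. T (\<phi>' k)) c'"
      using \<phi> c by blast
  qed (use unique in blast)
qed

definition super_fourier :: "nat \<Rightarrow> nat \<Rightarrow> real
    \<Rightarrow> ((nat \<Rightarrow> real) \<Rightarrow> nat set \<Rightarrow> cw_free set) \<Rightarrow> (nat \<Rightarrow> real) \<Rightarrow> nat set \<Rightarrow> cw_free set" where
  "super_fourier m n s = tensor_id m n (fourier_scalar m n s)"

definition super_exp :: "nat \<Rightarrow> nat \<Rightarrow> real
    \<Rightarrow> ((nat \<Rightarrow> real) \<Rightarrow> nat set \<Rightarrow> cw_free set) \<Rightarrow> (nat \<Rightarrow> real) \<Rightarrow> nat set \<Rightarrow> cw_free set" where
  "super_exp m n \<theta> = tensor_id m n (super_exp_scalar m n \<theta>)"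

end

theory Submission
  imports Defs "HOL-Complex_Analysis.Laurent_Convergence" "HOL-Probability.Sinc_Integral"
    "HOL-Real_Asymp.Real_Asymp"
begin

text \<open>
  The two operators are compared separately on \<open>\<S>(\<real>\<^sup>m)\<close> and on \<open>\<Lambda>\<^sub>2\<^sub>n\<close>.

  Bosonic part. For \<open>\<bar>r\<bar> < 1\<close>, Mehler's formula sums the series of
  \<open>r\<^sup>k h\<^sub>k(x) h\<^sub>k(y)\<close> in closed form. The closed form extends continuously to \<open>r = \<plusminus>\<i>\<close>, where it
  is the Fourier kernel, and \<open>(\<plusminus>\<i>)\<^sup>k\<close> is \<open>exp (\<plusminus>\<i>\<pi>/4 \<cdot> 2k)\<close>. Since the Hermite coefficients of a Schwartz
  function decay rapidly, letting \<open>r\<close> tend to \<open>\<plusminus>\<i>\<close> along the imaginary axis (Abel summation on one side,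
  dominated convergence on the other) gives the claim. Mehler's formula itself holds because both sides
  satisfy the same linear differential equation in \<open>r\<close>; evaluated on the diagonal at real \<open>r\<close>, it also
  bounds the Hermite functions.

  Fermionic part. The fermionic operator is a sum of commuting operators, one for each pair of
  variables \<open>x\<^sub>2\<^sub>j\<^sub>-\<^sub>1, x\<^sub>2\<^sub>j\<close>, each with eigenvalues in \<open>{0, 2, 4}\<close>; so its exponential is a product of explicit
  operators. The Berezin transform and this product both turn the derivative by one variable of a pair
  into multiplication by the other one, and they agree on the monomial of top degree, from which
  derivatives produce all other monomials.
\<close>

section \<open>Mehler's formula\<close>

text \<open>At \<open>r = +-i\<close> the series of \<open>r^k h_k(x) h_k(y)\<close> sits on the
  boundary of its disc of convergence, so Mehler's formula cannot simply be evaluated there; the two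
  sides are compared only after integration against a Schwartz function. The imaginary axis is a
  good path to the boundary: on it \<open>1 - r^2\<close> is real and at least 1, and the kernel is
  a decaying Gaussian times a phase. Its modulus is at most 1, so \<open>|phi|\<close> itself is a
  dominating function.

  The normalising constants split along with the variables: \<open>(2 pi)^(-M/2)\<close> is
  \<open>(2 pi)^(-m/2)\<close> times \<open>(2 pi)^n\<close>. The first factor consists of the
  \<open>m\<close> constants \<open>1 / sqrt (2 pi)\<close> in the limits of the one-dimensional
  kernels. The second, against the \<open>pi^(-n)\<close> of the Berezin integral, leaves
  \<open>2^n\<close>, which is the value of the fermionic exponential on the monomial of top degree.

  The algebra \<open>C\<close> enters only at the end: both operators act on the other tensor
  factor, so agreement on \<open>schwartz_grassmann\<close> suffices.\<close>

lemma pderiv_hermite_Suc: "pderiv (hermite (Suc k)) = smult (2 * of_nat (Suc k)) (hermite k)"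
proof -
  have "pderiv (hermite (Suc k)) = [:2:] * hermite k - (pderiv (pderiv (hermite k)) - [:0, 2:] * pderiv (hermite k))"
    by (simp add: pderiv_diff pderiv_smult pderiv_pCons pderiv_mult algebra_simps)
  also have "\<dots> = smult 2 (hermite k) + smult (2 * of_nat k) (hermite k)"
    unfolding hermite_ode by simp
  finally show ?thesis by (simp add: algebra_simps smult_add_left[symmetric])
qed

lemma poly_hermite_Suc_Suc:
  "poly (hermite (Suc (Suc k))) x
     = 2 * x * poly (hermite (Suc k)) x - 2 * of_nat (Suc k) * poly (hermite k) x"
  by (subst hermite.simps(2)) (simp add: pderiv_hermite_Suc del: hermite.simps)

text \<open>The factor common to all \<open>k\<close>, a Gaussian over \<open>sqrt pi\<close>, is
  split off from the products of Hermite functions (see \<open>hermite_fun1_mult\<close>). What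
  remains starts with 1 and obeys a recurrence whose coefficients are polynomials in
  \<open>k\<close>, \<open>x\<close> and \<open>y\<close>.\<close>

definition mehler_coeff :: "real \<Rightarrow> real \<Rightarrow> nat \<Rightarrow> real" where
  "mehler_coeff x y k = poly (hermite k) x * poly (hermite k) y / (2 ^ k * fact k)"

text \<open>
  The recurrence for the Taylor coefficients of a solution \<open>f\<close> of
  \<open>(1 - r\<^sup>2)\<^sup>2 f' = (p + (1 - q) r + p r\<^sup>2 - r\<^sup>3) f\<close>.
\<close>

definition mehler_recurrence :: "'a \<Rightarrow> 'a \<Rightarrow> (nat \<Rightarrow> 'a :: field_char_0) \<Rightarrow> nat \<Rightarrow> bool" where
  "mehler_recurrence p q c k \<longleftrightarrow>
     of_nat (Suc k) * c (Suc k) = p * c k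
       + (if k \<ge> 1 then (1 + 2 * of_nat (k - 1) - q) * c (k - 1) else 0)
       + (if k \<ge> 2 then p * c (k - 2) else 0)
       - (if k \<ge> 3 then of_nat (k - 2) * c (k - 3) else 0)"

lemma mehler_recurrence_unique:
  assumes "\<And>k. mehler_recurrence p q c k" "\<And>k. mehler_recurrence p q d k" "c 0 = d 0"
  shows "c k = d k"
proof (induction k rule: less_induct)
  case (less k)
  show ?case
  proof (cases k)
    case 0
    then show ?thesis using assms by simp
  next
    case (Suc j)
    have "of_nat (Suc j) * c (Suc j) = of_nat (Suc j) * d (Suc j)"
      using assms(1,2)[of j] less Suc by (simp add: mehler_recurrence_def)
    then show ?thesis using Suc by (simp del: of_nat_Suc)
  qed
qed

lemma mehler_recurrence_of_real:
  assumes "mehler_recurrence p q c k"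
  shows "mehler_recurrence (of_real p) (of_real q) (\<lambda>k. of_real (c k) :: complex) k"
  using arg_cong[OF assms[unfolded mehler_recurrence_def], of "of_real :: real \<Rightarrow> complex"]
  unfolding mehler_recurrence_def of_real_mult of_real_add of_real_diff if_distrib[of of_real]
    of_real_of_nat_eq of_real_1 of_real_0 of_real_numeral .

text \<open>Products of solutions of two three-term recurrences satisfy a longer recurrence, because
  the products that mix neighbouring degrees in \<open>x\<close> and \<open>y\<close> can be
  eliminated.\<close>

lemma mehler_recurrence_mehler_coeff:
  "mehler_recurrence (2 * x * y) (2 * (x\<^sup>2 + y\<^sup>2)) (mehler_coeff x y) k"
proof (cases "k \<ge> 3")
  \<comment> \<open>For \<open>k < 3\<close> the recurrence is truncated and involves only the
    coefficients up to index 3, which are computed explicitly.\<close>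
  case False
  then consider "k = 0" | "k = 1" | "k = 2" by linarith
  note cs = this
  have h01: "poly (hermite 0) z = 1" "poly (hermite (Suc 0)) z = 2 * z" for z
    by (simp_all add: pderiv_1)
  have h2: "poly (hermite 2) z = 4 * z ^ 2 - 2" for z
    using poly_hermite_Suc_Suc[of 0 z] unfolding h01 by (simp add: numeral_2_eq_2[symmetric] power2_eq_square)
  have h3: "poly (hermite 3) z = 8 * z ^ 3 - 12 * z" for z
    using poly_hermite_Suc_Suc[of 1 z] h2
    by (simp add: h01 numeral_2_eq_2[symmetric] numeral_3_eq_3[symmetric] power2_eq_square
        power3_eq_cube algebra_simps del: hermite.simps)
  have c: "mehler_coeff x y 0 = 1" "mehler_coeff x y (Suc 0) = 2 * x * y"
      "mehler_coeff x y 2 = (2 * x\<^sup>2 - 1) * (2 * y\<^sup>2 - 1) / 2"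
      "mehler_coeff x y 3 = (2 * x ^ 3 - 3 * x) * (2 * y ^ 3 - 3 * y) / 3"
    unfolding mehler_coeff_def h01 h2 h3
    by (simp_all add: fact_numeral eval_nat_numeral(2,3) power3_eq_cube power2_eq_square field_simps)
  from cs show ?thesis
    by cases (simp_all add: mehler_recurrence_def numeral_2_eq_2[symmetric] numeral_3_eq_3[symmetric] c,
        simp_all add: algebra_simps power3_eq_cube power2_eq_square)
next
  case True
  then obtain j where j: "k = j + 3" by (metis add.commute le_Suc_ex)
  define u where "u i = poly (hermite (j + i)) x" for i
  define v where "v i = poly (hermite (j + i)) y" for i
  define K where "K = real k"
  have K: "real j = K - 3" using j by (simp add: K_def)
  have u: "u 2 = 2 * x * u 1 - 2 * (K - 2) * u 0" "u 3 = 2 * x * u 2 - 2 * (K - 1) * u 1"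
      "u 4 = 2 * x * u 3 - 2 * K * u 2"
    using poly_hermite_Suc_Suc[of j x] poly_hermite_Suc_Suc[of "j+1" x] poly_hermite_Suc_Suc[of "j+2" x]
    by (simp_all add: u_def K eval_nat_numeral)
  have v: "v 2 = 2 * y * v 1 - 2 * (K - 2) * v 0" "v 3 = 2 * y * v 2 - 2 * (K - 1) * v 1"
      "v 4 = 2 * y * v 3 - 2 * K * v 2"
    using poly_hermite_Suc_Suc[of j y] poly_hermite_Suc_Suc[of "j+1" y] poly_hermite_Suc_Suc[of "j+2" y]
    by (simp_all add: v_def K eval_nat_numeral)
  \<comment> \<open>Expanding \<open>u 4 * v 4\<close> leaves the mixed products
    \<open>u 3 * v 2\<close> and \<open>u 2 * v 3\<close>. The three-term recurrences solved for
    their lowest term, here already multiplied together, allow them to be replaced by diagonal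
    products \<open>u i * v i\<close>.\<close>
  have "4 * (K - 2)\<^sup>2 * (u 0 * v 0) = (2 * x * u 1 - u 2) * (2 * y * v 1 - v 2)"
    by (simp add: u(1) v(1) algebra_simps power2_eq_square)
  moreover have "2 * (K - 1) * u 1 = 2 * x * u 2 - u 3" "2 * (K - 1) * v 1 = 2 * y * v 2 - v 3"
    by (simp_all add: u(2) v(2))
  ultimately have main: "u 4 * v 4 = 2 * x * y * (2 * (u 3 * v 3) + 8 * K * (K - 1) * (u 1 * v 1))
      + (2 * K - 1 - 2 * (x\<^sup>2 + y\<^sup>2)) * 4 * K * (u 2 * v 2) - 16 * K * (K - 1) * (K - 2)\<^sup>2 * (u 0 * v 0)"
    unfolding u(3) v(3) by algebra
  define D where "D = (2 ^ j * fact j :: real)"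
  have D: "D \<noteq> 0" by (simp add: D_def)
  have K0: "K > 2" using True by (simp add: K_def)
  \<comment> \<open>The factors \<open>K - 2\<close>, \<open>K - 1\<close>, \<open>K\<close>,
    \<open>K + 1\<close> are \<open>j + 1\<close>, ..., \<open>j + 4\<close>, by which the
    factorials grow beyond \<open>fact j\<close>.\<close>
  have c: "mehler_coeff x y j = u 0 * v 0 / D" "mehler_coeff x y (j + 1) = u 1 * v 1 / (2 * (K - 2) * D)"
    "mehler_coeff x y (j + 2) = u 2 * v 2 / (4 * (K - 1) * (K - 2) * D)"
    "mehler_coeff x y (j + 3) = u 3 * v 3 / (8 * K * (K - 1) * (K - 2) * D)"
    "mehler_coeff x y (j + 4) = u 4 * v 4 / (16 * (K + 1) * K * (K - 1) * (K - 2) * D)"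
    by (simp_all add: mehler_coeff_def u_def v_def D_def eval_nat_numeral K algebra_simps)
  have "(K + 1) * mehler_coeff x y (j + 4) = 2 * x * y * mehler_coeff x y (j + 3)
      + (1 - 2 * (x\<^sup>2 + y\<^sup>2)) * mehler_coeff x y (j + 2)
      + (2 * x * y * mehler_coeff x y (j + 1) + 2 * (K - 1) * mehler_coeff x y (j + 2))
      - (K - 2) * mehler_coeff x y j"
  proof -
    have "(K + 1) * mehler_coeff x y (j + 4) = u 4 * v 4 / (16 * K * (K - 1) * (K - 2) * D)"
      unfolding c using K0 D by (simp add: divide_simps)
    also have "\<dots> = 2 * x * y * mehler_coeff x y (j + 3)
      + (2 * K - 1 - 2 * (x\<^sup>2 + y\<^sup>2)) * mehler_coeff x y (j + 2)
      + 2 * x * y * mehler_coeff x y (j + 1) - (K - 2) * mehler_coeff x y j"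
      unfolding c main using K0 D by (simp add: divide_simps) (simp add: algebra_simps power2_eq_square)
    finally show ?thesis by (simp add: algebra_simps)
  qed
  then show ?thesis
    unfolding mehler_recurrence_def using j
    by (simp add: K_def algebra_simps eval_nat_numeral)
qed

text \<open>The second factor is the principal branch of \<open>(1 - r^2)^(-1/2)\<close>. It is
  holomorphic on the unit disc, where \<open>1 - r^2\<close> stays in the right half plane.\<close>

definition mehler :: "complex \<Rightarrow> real \<Rightarrow> real \<Rightarrow> complex" where
  "mehler r x y = exp ((2 * x * y * r - (x\<^sup>2 + y\<^sup>2) * r\<^sup>2) / (1 - r\<^sup>2)) * exp (- Ln (1 - r\<^sup>2) / 2)"

lemma mehler_denominator:
  fixes r :: complex
  assumes "norm r < 1"
  shows "1 - r\<^sup>2 \<notin> \<real>\<^sub>\<le>\<^sub>0" "1 - r\<^sup>2 \<noteq> 0"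
proof -
  have "norm (r\<^sup>2) < 1" using assms by (simp add: norm_power power_less_one_iff)
  then have "Re (1 - r\<^sup>2) > 0" using complex_Re_le_cmod[of "r\<^sup>2"] by simp
  then show "1 - r\<^sup>2 \<notin> \<real>\<^sub>\<le>\<^sub>0" "1 - r\<^sup>2 \<noteq> 0"
    by (auto simp: complex_nonpos_Reals_iff)
qed

lemma mehler_has_field_derivative:
  assumes r: "norm r < 1"
  shows "((\<lambda>r. mehler r x y) has_field_derivative
    mehler r x y * ((2 * x * y + (1 - 2 * (x\<^sup>2 + y\<^sup>2)) * r + 2 * x * y * r\<^sup>2 - r ^ 3) / (1 - r\<^sup>2)\<^sup>2)) (at r)"
proof -
  note d = mehler_denominator[OF r]
  \<comment> \<open>This \<open>q\<close> is half of the parameter \<open>q\<close> of the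
    recurrence.\<close>
  define p q :: complex where "p = 2 * x * y" and "q = x\<^sup>2 + y\<^sup>2"
  have 1: "((\<lambda>r. (p * r - q * r\<^sup>2) / (1 - r\<^sup>2)) has_field_derivative
      ((p - 2 * q * r) * (1 - r\<^sup>2) + (p * r - q * r\<^sup>2) * (2 * r)) / (1 - r\<^sup>2)\<^sup>2) (at r)"
    using d(2) by (auto intro!: derivative_eq_intros simp: power2_eq_square)
  have 2: "((\<lambda>r. - Ln (1 - r\<^sup>2) / 2) has_field_derivative r / (1 - r\<^sup>2)) (at r)"
    using d by (auto intro!: derivative_eq_intros simp: field_simps)
  have "((\<lambda>r. exp ((p * r - q * r\<^sup>2) / (1 - r\<^sup>2)) * exp (- Ln (1 - r\<^sup>2) / 2)) has_field_derivative
    exp ((p * r - q * r\<^sup>2) / (1 - r\<^sup>2)) * exp (- Ln (1 - r\<^sup>2) / 2) *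
      ((((p - 2 * q * r) * (1 - r\<^sup>2) + (p * r - q * r\<^sup>2) * (2 * r)) + r * (1 - r\<^sup>2)) / (1 - r\<^sup>2)\<^sup>2)) (at r)"
    by (rule DERIV_cong[OF DERIV_mult[OF DERIV_fun_exp[OF 1] DERIV_fun_exp[OF 2]]])
       (use d(2) in \<open>simp add: add_divide_distrib power2_eq_square distrib_left mult_ac\<close>)
  also have "((p - 2 * q * r) * (1 - r\<^sup>2) + (p * r - q * r\<^sup>2) * (2 * r)) + r * (1 - r\<^sup>2)
      = p + (1 - 2 * q) * r + p * r\<^sup>2 - r ^ 3"
    by (simp add: algebra_simps power2_eq_square power3_eq_cube)
  finally show ?thesis by (simp add: mehler_def p_def q_def)
qed

lemma mehler_holomorphic: "(\<lambda>r. mehler r x y) holomorphic_on ball 0 1"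
proof (rule holomorphic_onI)
  fix r :: complex assume "r \<in> ball 0 1"
  then have "norm r < 1" by simp
  from mehler_has_field_derivative[OF this]
  show "(\<lambda>r. mehler r x y) field_differentiable (at r within ball 0 1)"
    using field_differentiable_def field_differentiable_at_within by blast
qed

lemma mehler_sums:
  assumes r: "norm r < 1"
  shows "(\<lambda>k. of_real (mehler_coeff x y k) * r ^ k) sums mehler r x y"
proof -
  let ?f = "\<lambda>r. mehler r x y"
  define p q :: complex where "p = 2 * x * y" and "q = 2 * (x\<^sup>2 + y\<^sup>2)"
  define F where "F = fps_expansion ?f 0"
  have F: "?f has_fps_expansion F"
    unfolding F_def using mehler_holomorphic by (intro has_fps_expansion_fps_expansion[of "ball 0 1"]) auto
  have ode: "(1 - 2 * r ^ 2 + r ^ 4) * deriv ?f r = ?f r * (p + (1 - q) * r + p * r\<^sup>2 - r ^ 3)"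
    if "r \<in> ball 0 1" for r
  proof -
    have "norm r < 1" using that by simp
    moreover have "1 - 2 * r ^ 2 + r ^ 4 = (1 - r\<^sup>2)\<^sup>2"
      by (simp add: algebra_simps power2_eq_square power4_eq_xxxx)
    ultimately show ?thesis
      using DERIV_imp_deriv[OF mehler_has_field_derivative, of r x y] mehler_denominator(2)[of r]
      by (simp add: p_def q_def)
  qed
  \<comment> \<open>The differential equation, cleared of its denominator, read as an identity of
    formal power series. Comparing coefficients turns it into the recurrence.\<close>
  have E: "fps_deriv F - 2 * (fps_deriv F * fps_X ^ 2) + fps_deriv F * fps_X ^ 4
      = fps_const p * F + fps_const (1 - q) * (F * fps_X ^ 1) + fps_const p * (F * fps_X ^ 2) - F * fps_X ^ 3"
  proof (rule fps_expansion_unique_complex)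
    let ?g = "\<lambda>r. deriv ?f r - 2 * (deriv ?f r * r ^ 2) + deriv ?f r * r ^ 4"
    let ?h = "\<lambda>r. p * ?f r + (1 - q) * (?f r * r ^ 1) + p * (?f r * r ^ 2) - ?f r * r ^ 3"
    show g: "?g has_fps_expansion fps_deriv F - 2 * (fps_deriv F * fps_X ^ 2) + fps_deriv F * fps_X ^ 4"
      by (intro fps_expansion_intros F)
    have "?h has_fps_expansion
        fps_const p * F + fps_const (1 - q) * (F * fps_X ^ 1) + fps_const p * (F * fps_X ^ 2) - F * fps_X ^ 3"
      by (intro fps_expansion_intros F)
    moreover have "\<forall>\<^sub>F r in nhds 0. ?h r = ?g r"
    proof (rule eventually_mono)
      show "\<forall>\<^sub>F r in nhds 0. r \<in> ball (0::complex) 1"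
        by (intro eventually_nhds_in_open) auto
      show "?h r = ?g r" if "r \<in> ball 0 1" for r
        using ode[OF that] by (simp add: algebra_simps)
    qed
    ultimately show "?g has_fps_expansion
        fps_const p * F + fps_const (1 - q) * (F * fps_X ^ 1) + fps_const p * (F * fps_X ^ 2) - F * fps_X ^ 3"
      by (subst (asm) has_fps_expansion_cong[OF _ refl]) auto
  qed
  have rec: "mehler_recurrence p q (fps_nth F) k" for k
  proof -
    have two: "fps_nth (2 * G) k = 2 * fps_nth G k" for G :: "complex fps"
      by (metis fps_mult_left_const_nth fps_numeral_fps_const)
    have eq: "of_nat (Suc k) * fps_nth F (Suc k)
        - 2 * (if k < 2 then 0 else of_nat (k - 2 + 1) * fps_nth F (k - 2 + 1))
        + (if k < 4 then 0 else of_nat (k - 4 + 1) * fps_nth F (k - 4 + 1))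
      = p * fps_nth F k + (1 - q) * (if k < 1 then 0 else fps_nth F (k - 1))
        + p * (if k < 2 then 0 else fps_nth F (k - 2)) - (if k < 3 then 0 else fps_nth F (k - 3))"
      using arg_cong[OF E, of "\<lambda>G. fps_nth G k"]
      unfolding fps_add_nth fps_sub_nth fps_mult_left_const_nth fps_X_power_mult_right_nth fps_deriv_nth two
        Suc_eq_plus1 .
    \<comment> \<open>The largest shift is by four, so from 4 on every shifted coefficient is
      present.\<close>
    have "k = 0 \<or> k = 1 \<or> k = 2 \<or> k = 3 \<or> k \<ge> 4" by linarith
    then consider "k = 0" | "k = 1" | "k = 2" | "k = 3" | j where "k = Suc (Suc (Suc (Suc j)))"
      by (metis add_Suc add_0 le_Suc_ex numeral_eq_Suc pred_numeral_simps BitM.simps eval_nat_numeral)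
    then show ?thesis
    proof cases
      case 5
      then show ?thesis using eq
        unfolding mehler_recurrence_def by (simp del: of_nat_Suc) (simp add: algebra_simps)
    qed (use eq in \<open>simp_all add: mehler_recurrence_def del: of_nat_Suc\<close>, simp_all add: algebra_simps numeral_2_eq_2[symmetric])
  qed
  have rec': "mehler_recurrence p q (\<lambda>k. of_real (mehler_coeff x y k)) k" for k
    using mehler_recurrence_of_real[OF mehler_recurrence_mehler_coeff[of x y k]]
    by (simp add: p_def q_def)
  have "fps_nth F 0 = of_real (mehler_coeff x y 0)"
    by (simp add: F_def fps_expansion_def mehler_def mehler_coeff_def)
  then have "fps_nth F k = of_real (mehler_coeff x y k)" for k
    by (rule mehler_recurrence_unique[where c = "fps_nth F" and d = "\<lambda>k. of_real (mehler_coeff x y k)", OF rec rec'])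
  moreover have "(\<lambda>k. fps_nth F k * r ^ k) sums mehler r x y"
    using r mehler_holomorphic by (intro has_fps_expansion_imp_sums_complex[OF F, of 1]) (auto simp: one_ereal_def)
  ultimately show ?thesis by simp
qed


section \<open>The kernel of the normalised Hermite functions, on the diagonal and on the imaginary
  axis\<close>

definition hermite_kernel :: "complex \<Rightarrow> real \<Rightarrow> real \<Rightarrow> complex" where
  "hermite_kernel r x y = of_real (exp (- (x\<^sup>2 + y\<^sup>2) / 2) / sqrt pi) * mehler r x y"

lemma hermite_fun1_mult:
  "hermite_fun1 k x * hermite_fun1 k y = exp (- (x\<^sup>2 + y\<^sup>2) / 2) / sqrt pi * mehler_coeff x y k"
proof -
  have "sqrt (2 ^ k * fact k * sqrt pi) * sqrt (2 ^ k * fact k * sqrt pi) = 2 ^ k * fact k * sqrt pi"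
    by simp
  moreover have "exp (- x\<^sup>2 / 2) * exp (- y\<^sup>2 / 2) = exp (- (x\<^sup>2 + y\<^sup>2) / 2)"
    by (simp add: exp_add[symmetric] add_divide_distrib diff_divide_distrib)
  ultimately show ?thesis
    unfolding hermite_fun1_def mehler_coeff_def times_divide_times_eq by (simp add: mult_ac)
qed

lemma hermite_kernel_sums:
  assumes "norm r < 1"
  shows "(\<lambda>k. of_real (hermite_fun1 k x * hermite_fun1 k y) * r ^ k) sums hermite_kernel r x y"
  using sums_mult[OF mehler_sums[OF assms], of "of_real (exp (- (x\<^sup>2 + y\<^sup>2) / 2) / sqrt pi)" x y]
  by (simp only: hermite_kernel_def hermite_fun1_mult of_real_mult mult.assoc)

lemma exp_half_Ln_of_real:
  assumes "a > 0"
  shows "exp (- Ln (of_real a) / 2) = of_real (1 / sqrt a)"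
proof -
  have "exp (- Ln (of_real a) / 2) = of_real (exp (- ln a / 2))"
    using assms by (simp add: Ln_of_real flip: exp_of_real)
  also have "exp (- ln a / 2) = 1 / sqrt a"
    using assms by (simp add: exp_minus ln_sqrt[symmetric] inverse_eq_divide)
  finally show ?thesis .
qed

text \<open>On the diagonal the factor \<open>1 - r\<close> cancels in Mehler's exponent, and what
  is left of it together with the Gaussian weight is at most 1. The series has nonnegative terms
  here, so this value dominates each of them.\<close>

lemma hermite_kernel_diagonal:
  assumes "0 \<le> r" "r < 1"
  shows "hermite_kernel (of_real r) x x
    = of_real (exp (- (x\<^sup>2 * (1 - r) / (1 + r))) / sqrt (pi * (1 - r\<^sup>2)))"
proof -
  have r: "1 - r\<^sup>2 > 0" using assms by (simp add: power_less_one_iff abs_square_less_1)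
  have f: "1 - r\<^sup>2 = (1 - r) * (1 + r)" by (simp add: algebra_simps power2_eq_square)
  have "(2 * of_real x * of_real x * of_real r - ((of_real x)\<^sup>2 + (of_real x)\<^sup>2) * (of_real r)\<^sup>2) / (1 - (of_real r)\<^sup>2)
      = complex_of_real ((2 * x * x * r - (x\<^sup>2 + x\<^sup>2) * r\<^sup>2) / (1 - r\<^sup>2))"
    by simp
  also have "(2 * x * x * r - (x\<^sup>2 + x\<^sup>2) * r\<^sup>2) / (1 - r\<^sup>2) = 2 * x\<^sup>2 * r / (1 + r)"
    unfolding f using assms by (simp add: divide_simps) (simp add: algebra_simps power2_eq_square)
  finally have "mehler (of_real r) x x = of_real (exp (2 * x\<^sup>2 * r / (1 + r)) * (1 / sqrt (1 - r\<^sup>2)))"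
    using exp_half_Ln_of_real[OF r] unfolding mehler_def by (simp flip: exp_of_real)
  moreover have "exp (- (x\<^sup>2 + x\<^sup>2) / 2) * exp (2 * x\<^sup>2 * r / (1 + r)) = exp (- (x\<^sup>2 * (1 - r) / (1 + r)))"
    unfolding exp_add[symmetric] using assms by (simp add: field_simps)
  ultimately show ?thesis
    by (simp add: hermite_kernel_def real_sqrt_mult flip: of_real_mult of_real_divide)
qed

text \<open>Only polynomial growth in \<open>k\<close>, uniform in \<open>x\<close>, matters: it
  will be outweighed by powers of \<open>r\<close> or by the decay of the Hermite
  coefficients.\<close>

lemma hermite_fun1_bound: "\<bar>hermite_fun1 k x\<bar> \<le> 2 * (real k + 1)"
proof -
  \<comment> \<open>The balance point: \<open>1 / r^k\<close> stays below \<open>exp 1\<close>,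
    hence below 3, while \<open>1 - r = 1 / (k + 1)\<close> makes the diagonal value at most
    \<open>sqrt (k + 1)\<close>.\<close>
  define r where "r = real k / (real k + 1)"
  have r: "0 \<le> r" "r < 1" by (simp_all add: r_def)
  have "(\<lambda>j. of_real ((hermite_fun1 j x)\<^sup>2 * r ^ j)) sums hermite_kernel (of_real r) x x"
    using hermite_kernel_sums[of "of_real r" x x] r by (simp add: power2_eq_square)
  then have sums: "(\<lambda>j. (hermite_fun1 j x)\<^sup>2 * r ^ j) sums
      (exp (- (x\<^sup>2 * (1 - r) / (1 + r))) / sqrt (pi * (1 - r\<^sup>2)))"
    unfolding hermite_kernel_diagonal[OF r] by (simp only: sums_of_real_iff)
  have "(hermite_fun1 k x)\<^sup>2 * r ^ k = (\<Sum>j\<in>{k}. (hermite_fun1 j x)\<^sup>2 * r ^ j)" by simp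
  also have "\<dots> \<le> exp (- (x\<^sup>2 * (1 - r) / (1 + r))) / sqrt (pi * (1 - r\<^sup>2))"
    using sums r unfolding sums_unique[OF sums]
    by (intro sum_le_suminf) (auto simp: sums_iff)
  also have "\<dots> \<le> 1 / sqrt (1 / (real k + 1))"
  proof (intro frac_le)
    have "1 / (real k + 1) = 1 - r" by (simp add: r_def field_simps)
    also have "\<dots> = 1 * (1 - r)" by simp
    also have "\<dots> \<le> (pi * (1 + r)) * (1 - r)"
      using r pi_ge_two by (intro mult_right_mono) (auto intro: order.trans[OF _ mult_mono[of 1 pi 1 "1 + r"]])
    also have "\<dots> = pi * (1 - r\<^sup>2)" by (simp add: algebra_simps power2_eq_square)
    finally show "sqrt (1 / (real k + 1)) \<le> sqrt (pi * (1 - r\<^sup>2))" by simp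
  qed (use r in auto)
  also have "\<dots> = sqrt (real k + 1)" by (simp add: real_sqrt_divide)
  also have "\<dots> \<le> real k + 1" by (simp add: real_le_lsqrt real_sqrt_le_iff' power2_eq_square)
  finally have 1: "(hermite_fun1 k x)\<^sup>2 * r ^ k \<le> real k + 1" .
  have 2: "1 \<le> 3 * r ^ k"
  proof (cases "k = 0")
    case False
    then have "1 / r = 1 + 1 / real k" by (simp add: r_def field_simps)
    also have "\<dots> \<le> exp (1 / real k)" by (rule exp_ge_add_one_self)
    finally have "(1 / r) ^ k \<le> exp (1 / real k) ^ k"
      using r by (intro power_mono) auto
    also have "\<dots> = exp 1" using False by (simp flip: exp_of_nat_mult)
    also have "\<dots> \<le> 3" by (rule exp_le)
    finally show ?thesis using False r by (simp add: r_def power_divide field_simps)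
  qed auto
  have "(hermite_fun1 k x)\<^sup>2 * 1 \<le> (hermite_fun1 k x)\<^sup>2 * (3 * r ^ k)"
    by (intro mult_left_mono 2) auto
  also have "\<dots> \<le> 3 * (real k + 1)" using 1 by simp
  also have "\<dots> \<le> (2 * (real k + 1))\<^sup>2" by (simp add: power2_eq_square algebra_simps)
  finally have "(hermite_fun1 k x)\<^sup>2 \<le> (2 * (real k + 1))\<^sup>2" by simp
  then show ?thesis by (simp add: abs_le_square_iff[symmetric])
qed

text \<open>Since \<open>s^2 = 1\<close>, the square of the argument is \<open>- r^2\<close>, so all
  of Mehler's formula is real except for the linear term in the exponent, which becomes the phase.
  As \<open>r\<close> tends to 1 the Gaussian flattens out and \<open>2 r / (1 + r^2)\<close> tends
  to 1.\<close>

lemma hermite_kernel_imag: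
  assumes s: "s = 1 \<or> s = - 1"
  shows "hermite_kernel (\<i> * of_real s * of_real r) x y
    = of_real (exp (- ((x\<^sup>2 + y\<^sup>2) * (1 - r\<^sup>2) / (2 * (1 + r\<^sup>2)))) / sqrt (pi * (1 + r\<^sup>2)))
      * exp (\<i> * of_real (s * (2 * r / (1 + r\<^sup>2)) * (x * y)))"
proof -
  have r: "1 + r\<^sup>2 > 0" by (simp add: add_pos_nonneg)
  then have r0: "1 + r\<^sup>2 \<noteq> 0" by simp
  have sq: "(\<i> * of_real s * of_real r)\<^sup>2 = - of_real (r\<^sup>2)"
    using s by (auto simp: power_mult_distrib)
  have sq1: "1 - (\<i> * of_real s * of_real r)\<^sup>2 = of_real (1 + r\<^sup>2)"
    unfolding sq by simp
  have "(2 * of_real x * of_real y * (\<i> * of_real s * of_real r) - ((of_real x)\<^sup>2 + (of_real y)\<^sup>2) * (\<i> * of_real s * of_real r)\<^sup>2)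
        / (1 - (\<i> * of_real s * of_real r)\<^sup>2)
      = complex_of_real ((x\<^sup>2 + y\<^sup>2) * r\<^sup>2 / (1 + r\<^sup>2)) + \<i> * of_real (s * (2 * r / (1 + r\<^sup>2)) * (x * y))"
    unfolding sq1 unfolding sq by (simp add: field_simps add_divide_distrib)
  then have m: "mehler (\<i> * of_real s * of_real r) x y
      = of_real (exp ((x\<^sup>2 + y\<^sup>2) * r\<^sup>2 / (1 + r\<^sup>2))) * exp (\<i> * of_real (s * (2 * r / (1 + r\<^sup>2)) * (x * y)))
        * of_real (1 / sqrt (1 + r\<^sup>2))"
    unfolding mehler_def sq1 exp_half_Ln_of_real[OF r] by (simp only: exp_add exp_of_real)
  have e: "exp (- (x\<^sup>2 + y\<^sup>2) / 2) * exp ((x\<^sup>2 + y\<^sup>2) * r\<^sup>2 / (1 + r\<^sup>2))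
      = exp (- ((x\<^sup>2 + y\<^sup>2) * (1 - r\<^sup>2) / (2 * (1 + r\<^sup>2))))"
    unfolding exp_add[symmetric] using r0 by (simp add: divide_simps) (simp add: algebra_simps)
  show ?thesis
    unfolding hermite_kernel_def m e[symmetric] by (simp add: real_sqrt_mult)
qed

text \<open>Uniformity in \<open>r\<close>, \<open>x\<close> and \<open>y\<close> is the point: it
  survives products over coordinates and allows dominated convergence as \<open>r\<close> tends to
  1.\<close>

lemma norm_hermite_kernel_imag_le:
  assumes s: "s = 1 \<or> s = - 1" and r: "0 \<le> r" "r < 1"
  shows "norm (hermite_kernel (\<i> * of_real s * of_real r) x y) \<le> 1"
proof -
  have "norm (hermite_kernel (\<i> * of_real s * of_real r) x y)
      = exp (- ((x\<^sup>2 + y\<^sup>2) * (1 - r\<^sup>2) / (2 * (1 + r\<^sup>2)))) / sqrt (pi * (1 + r\<^sup>2))"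
    unfolding hermite_kernel_imag[OF s] norm_mult norm_exp_i_times norm_of_real by (simp add: add_nonneg_nonneg)
  also have "\<dots> \<le> 1 / 1"
  proof (intro frac_le)
    have "1 - r\<^sup>2 \<ge> 0" using r by (simp add: power_le_one)
    then show "exp (- ((x\<^sup>2 + y\<^sup>2) * (1 - r\<^sup>2) / (2 * (1 + r\<^sup>2)))) \<le> 1"
      by (simp add: add_nonneg_nonneg)
    have "1 * 1 \<le> pi * (1 + r\<^sup>2)" using pi_ge_two by (intro mult_mono) auto
    then show "1 \<le> sqrt (pi * (1 + r\<^sup>2))" by simp
  qed auto
  finally show ?thesis by simp
qed

lemma hermite_kernel_imag_tendsto:
  assumes s: "s = 1 \<or> s = - 1" and R: "R \<longlonglongrightarrow> 1"
  shows "(\<lambda>j. hermite_kernel (\<i> * of_real s * of_real (R j)) x y)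
      \<longlonglongrightarrow> of_real (1 / sqrt (2 * pi)) * exp (\<i> * of_real (s * (x * y)))"
  unfolding hermite_kernel_imag[OF s]
  by (rule tendsto_eq_intros refl R | simp add: add_pos_nonneg power2_eq_square mult.commute)+

section \<open>The Grassmann algebra\<close>

text \<open>The sign of moving generator \<open>i\<close> to or from the front of a monomial, past
  the generators of smaller index.\<close>

definition gsgn :: "nat \<Rightarrow> nat set \<Rightarrow> complex" where
  "gsgn i A = (-1) ^ card {k \<in> A. k < i}"

text \<open>
  Multiplication by a generator from the left. It agrees with \<^const>\<open>gmult\<close> on finite sets only, as
  \<^const>\<open>gmult\<close> vanishes on infinite ones; with \<open>gext\<close> the anticommutation relations need no finiteness
  assumption.
\<close>

definition gext :: "nat \<Rightarrow> grassmann \<Rightarrow> grassmann" where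
  "gext i a = (\<lambda>A. if i \<in> A then gsgn i A * a (A - {i}) else 0)"

lemma gderiv_altdef: "gderiv i a = (\<lambda>A. if i \<in> A then 0 else gsgn i A * a (insert i A))"
  by (auto simp: gderiv_def gsgn_def fun_eq_iff)

lemma gsgn_insert:
  "gsgn i (insert j A) = (if j \<notin> A \<and> j < i then - gsgn i A else gsgn i A)"
proof (cases "j < i \<and> j \<notin> A")
  case True
  then have "{k \<in> insert j A. k < i} = insert j {k \<in> A. k < i}" by auto
  then show ?thesis using True by (simp add: gsgn_def)
next
  case False
  then have "{k \<in> insert j A. k < i} = {k \<in> A. k < i}" by auto
  then show ?thesis using False unfolding gsgn_def by auto
qed

lemma gsgn_remove:
  "gsgn i (A - {j}) = (if j \<in> A \<and> j < i then - gsgn i A else gsgn i A)"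
  using gsgn_insert[of i j "A - {j}"] by (cases "j \<in> A") (auto simp: insert_absorb split: if_splits)

lemma gsgn_mult_self [simp]: "gsgn i A * gsgn i A = 1" "gsgn i A * (gsgn i A * z) = z"
  by (simp_all add: gsgn_def mult.assoc[symmetric] flip: power_add)

text \<open>With the next two lemmas, these are the canonical anticommutation relations. They allow
  derivatives to be moved through multiplications without following the individual
  monomials.\<close>

lemma gext_gext: "gext i (gext j a) A = - gext j (gext i a) A"
  by (cases "i = j") (auto simp: gext_def gsgn_remove insert_commute Diff_insert2[symmetric])

lemma gderiv_gderiv: "gderiv i (gderiv j a) A = - gderiv j (gderiv i a) A"
  by (cases "i = j") (auto simp: gderiv_altdef gsgn_insert insert_commute)

lemma gderiv_gext: "gderiv i (gext j a) A = (if i = j then a A else 0) - gext j (gderiv i a) A"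
  by (cases "i = j")
     (auto simp: gderiv_altdef gext_def gsgn_insert gsgn_remove insert_absorb insert_Diff_if)

definition grassmann_linear :: "(grassmann \<Rightarrow> grassmann) \<Rightarrow> bool" where
  "grassmann_linear T \<longleftrightarrow>
     (\<forall>a b c d. T (\<lambda>A. c * a A + d * b A) = (\<lambda>A. c * T a A + d * T b A))"

lemma grassmann_linearD:
  "grassmann_linear T \<Longrightarrow> T (\<lambda>A. c * a A + d * b A) = (\<lambda>A. c * T a A + d * T b A)"
  by (simp add: grassmann_linear_def)

lemma grassmann_linear_scale: "grassmann_linear T \<Longrightarrow> T (\<lambda>A. c * a A) = (\<lambda>A. c * T a A)"
  using grassmann_linearD[of T c a 0 a] by simp

lemma grassmann_linear_uminus: "grassmann_linear T \<Longrightarrow> T (\<lambda>A. - a A) = (\<lambda>A. - T a A)"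
  using grassmann_linear_scale[of T "-1" a] by simp

lemma grassmann_linear_zero: "grassmann_linear T \<Longrightarrow> T (\<lambda>A. 0) = (\<lambda>A. 0)"
  using grassmann_linear_scale[of T 0 "\<lambda>A. 0"] by simp

lemma grassmann_linear_add:
  "grassmann_linear T \<Longrightarrow> T (\<lambda>A. a A + b A) = (\<lambda>A. T a A + T b A)"
  using grassmann_linearD[of T 1 a 1 b] by simp

lemma grassmann_linear_diff:
  "grassmann_linear T \<Longrightarrow> T (\<lambda>A. a A - b A) = (\<lambda>A. T a A - T b A)"
  using grassmann_linearD[of T 1 a "-1" b] by simp

lemma grassmann_linear_sum:
  assumes "grassmann_linear T"
  shows "T (\<lambda>A. \<Sum>k\<in>K. a k A) = (\<lambda>A. \<Sum>k\<in>K. T (a k) A)"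
  by (induction K rule: infinite_finite_induct)
     (simp_all add: grassmann_linear_zero[OF assms] grassmann_linear_add[OF assms])

lemma grassmann_linear_gext: "grassmann_linear (gext i)"
  by (auto simp: grassmann_linear_def gext_def fun_eq_iff algebra_simps)

lemma grassmann_linear_gderiv: "grassmann_linear (gderiv i)"
  by (auto simp: grassmann_linear_def gderiv_altdef fun_eq_iff algebra_simps)

lemma grassmann_linear_funpow:
  "grassmann_linear T \<Longrightarrow> grassmann_linear (T ^^ k)"
  by (induction k) (auto simp: grassmann_linear_def)

lemma grassmann_linear_fold_gderiv: "grassmann_linear (fold gderiv l)"
proof (induction l)
  case (Cons i l)
  then show ?case
    using grassmann_linear_gderiv[of i] by (simp add: grassmann_linear_def)
qed (simp add: grassmann_linear_def)

section \<open>The exponential of the fermionic operator\<close>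

text \<open>The coefficient form of \<open>4 d_(2j-1) d_(2j) - x_(2j-1) x_(2j)\<close>, see
  \<open>pair_flip_eq\<close>. The two indices are adjacent and enter or leave together, so the
  other generators contribute no sign.\<close>

definition pair_flip :: "nat \<Rightarrow> grassmann \<Rightarrow> grassmann" where
  "pair_flip j a = (\<lambda>A.
     if 2*j-1 \<in> A \<and> 2*j \<in> A then - a (A - {2*j-1, 2*j})
     else if 2*j-1 \<notin> A \<and> 2*j \<notin> A then - 4 * a (A \<union> {2*j-1, 2*j})
     else 0)"

text \<open>For \<open>s = 1\<close> or \<open>s = -1\<close> this is the exponential of
  \<open>(i s pi / 4) (2 + pair_flip j)\<close>. On monomials with both or neither index of the
  pair, \<open>pair_flip j\<close> squares to 4, hence has eigenvalues 2 and -2; the exponential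
  takes the values -1 and 1 there and so equals \<open>- pair_flip j / 2\<close>. On the other
  monomials \<open>pair_flip j\<close> is 0 and the exponential is the scalar
  \<open>i s\<close>.\<close>

definition pair_fourier :: "real \<Rightarrow> nat \<Rightarrow> grassmann \<Rightarrow> grassmann" where
  "pair_fourier s j a = (\<lambda>A.
     if (2*j-1 \<in> A) = (2*j \<in> A) then - pair_flip j a A / 2 else \<i> * of_real s * a A)"

primrec grassmann_fourier :: "real \<Rightarrow> nat \<Rightarrow> grassmann \<Rightarrow> grassmann" where
  "grassmann_fourier s 0 a = a"
| "grassmann_fourier s (Suc n) a = grassmann_fourier s n (pair_fourier s (Suc n) a)"

text \<open>The fermionic operator is the case \<open>c = 0\<close>; the additional scalar is a
  generalisation for the induction on the number of pairs.\<close>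

definition pair_sum :: "nat \<Rightarrow> complex \<Rightarrow> grassmann \<Rightarrow> grassmann" where
  "pair_sum n c a = (\<lambda>A. c * a A + (\<Sum>j=1..n. 2 * a A + pair_flip j a A))"

lemma grassmann_linear_pair_flip: "grassmann_linear (pair_flip j)"
  by (auto simp: grassmann_linear_def pair_flip_def fun_eq_iff algebra_simps)

lemma grassmann_linear_pair_fourier: "grassmann_linear (pair_fourier s j)"
  by (auto simp: grassmann_linear_def pair_fourier_def fun_eq_iff algebra_simps
      add_divide_distrib diff_divide_distrib grassmann_linearD[OF grassmann_linear_pair_flip])

lemma grassmann_linear_grassmann_fourier: "grassmann_linear (grassmann_fourier s n)"
proof (induction n)
  case (Suc n)
  then show ?case
    using grassmann_linear_pair_fourier[of s "Suc n"] by (simp add: grassmann_linear_def)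
qed (simp add: grassmann_linear_def)

lemma grassmann_linear_pair_sum: "grassmann_linear (pair_sum n c)"
  unfolding grassmann_linear_def pair_sum_def
  by (simp add: grassmann_linearD[OF grassmann_linear_pair_flip] fun_eq_iff algebra_simps
      sum.distrib sum_distrib_left)

lemma pair_flip_commute:
  assumes "i \<ge> 1" "j \<ge> 1" "i \<noteq> j"
  shows "pair_flip i (pair_flip j a) A = pair_flip j (pair_flip i a) A"
proof -
  \<comment> \<open>Forgetting that the two indices are adjacent leaves a statement about sets in
    which only distinctness of the indices of the two pairs matters.\<close>
  define F :: "nat \<Rightarrow> nat \<Rightarrow> grassmann \<Rightarrow> grassmann" where
    "F p q a = (\<lambda>A. if p \<in> A \<and> q \<in> A then - a (A - {p, q})
       else if p \<notin> A \<and> q \<notin> A then - 4 * a (A \<union> {p, q}) else 0)" for p q a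
  have F: "F p q (F p' q' a) A = F p' q' (F p q a) A"
    if ne: "p \<noteq> p'" "p \<noteq> q'" "q \<noteq> p'" "q \<noteq> q'" for p q p' q'
  proof -
    have e: "A - {p,q} - {p',q'} = A - {p',q'} - {p,q}" "A \<union> {p,q} \<union> {p',q'} = A \<union> {p',q'} \<union> {p,q}"
      "A \<union> {p,q} - {p',q'} = (A - {p',q'}) \<union> {p,q}" "A \<union> {p',q'} - {p,q} = (A - {p,q}) \<union> {p',q'}"
      using ne by auto
    have mem: "p' \<in> A - {p,q} \<longleftrightarrow> p' \<in> A" "p' \<in> A \<union> {p,q} \<longleftrightarrow> p' \<in> A"
      "q' \<in> A - {p,q} \<longleftrightarrow> q' \<in> A" "q' \<in> A \<union> {p,q} \<longleftrightarrow> q' \<in> A"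
      "p \<in> A - {p',q'} \<longleftrightarrow> p \<in> A" "p \<in> A \<union> {p',q'} \<longleftrightarrow> p \<in> A"
      "q \<in> A - {p',q'} \<longleftrightarrow> q \<in> A" "q \<in> A \<union> {p',q'} \<longleftrightarrow> q \<in> A"
      using ne by auto
    show ?thesis
      unfolding F_def mem e
      by (cases "p \<in> A"; cases "q \<in> A"; cases "p' \<in> A"; cases "q' \<in> A"; simp)
  qed
  have "pair_flip k = F (2*k-1) (2*k)" for k
    by (simp add: fun_eq_iff pair_flip_def F_def)
  moreover have "2*i-1 \<noteq> 2*j-1" "2*i-1 \<noteq> 2*j" "2*i \<noteq> 2*j-1" "2*i \<noteq> 2*j"
    using assms by presburger+
  ultimately show ?thesis using F by simp
qed

lemma pair_flip_square:
  assumes "j \<ge> 1"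
  shows "pair_flip j (pair_flip j a) A = (if (2*j-1 \<in> A) = (2*j \<in> A) then 4 * a A else 0)"
proof -
  have ne: "2*j-1 \<noteq> 2*j" using assms by auto
  have 1: "A - {2*j-1,2*j} \<union> {2*j-1,2*j} = A" if "2*j-1 \<in> A" "2*j \<in> A"
    using that by auto
  have 2: "A \<union> {2*j-1,2*j} - {2*j-1,2*j} = A" if "2*j-1 \<notin> A" "2*j \<notin> A"
    using that by auto
  show ?thesis using ne 1 2 by (auto simp: pair_flip_def)
qed

lemma pair_sum_commute:
  assumes "n < j"
  shows "pair_flip j (pair_sum n c a) = pair_sum n c (pair_flip j a)"
proof -
  note lin = grassmann_linear_pair_flip[of j]
  have *: "pair_flip j (\<lambda>A. 2 * a A + pair_flip i a A) = (\<lambda>A. 2 * pair_flip j a A + pair_flip i (pair_flip j a) A)"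
    if "i \<in> {1..n}" for i
    using that assms by (subst grassmann_linear_add[OF lin], subst grassmann_linear_scale[OF lin])
       (auto intro!: ext pair_flip_commute)
  show ?thesis
    unfolding pair_sum_def
    by (subst grassmann_linear_add[OF lin], subst grassmann_linear_scale[OF lin],
        subst grassmann_linear_sum[OF lin]) (auto intro!: sum.cong ext simp: *)
qed

text \<open>
  On an eigenvector of the last summand, that summand acts as a scalar, which is absorbed into \<open>c\<close>.
\<close>

lemma pair_sum_funpow_eigen:
  assumes "\<And>A. 2 * a A + pair_flip (Suc n) a A = l * a A"
  shows "(pair_sum (Suc n) c ^^ k) a = (pair_sum n (c + l) ^^ k) a"
proof -
  \<comment> \<open>The iterates remain in the eigenspace because \<open>pair_flip (Suc n)\<close>
    commutes with \<open>pair_sum n\<close>.\<close>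
  have eig: "2 * ((pair_sum n (c + l) ^^ k) a) A + pair_flip (Suc n) ((pair_sum n (c + l) ^^ k) a) A
        = l * (pair_sum n (c + l) ^^ k) a A" for k A
  proof -
    have "pair_flip (Suc n) ((pair_sum n (c + l) ^^ k) a) = (pair_sum n (c + l) ^^ k) (pair_flip (Suc n) a)"
      by (induction k) (simp_all add: pair_sum_commute)
    also have "pair_flip (Suc n) a = (\<lambda>A. (l - 2) * a A)"
      using assms by (auto simp: fun_eq_iff algebra_simps eq_diff_eq)
    also have "(pair_sum n (c + l) ^^ k) \<dots> = (\<lambda>A. (l - 2) * (pair_sum n (c + l) ^^ k) a A)"
      by (intro grassmann_linear_scale grassmann_linear_funpow grassmann_linear_pair_sum)
    finally show ?thesis by (simp add: algebra_simps)
  qed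
  show ?thesis
  proof (induction k)
    case (Suc k)
    have "(pair_sum (Suc n) c ^^ Suc k) a = pair_sum (Suc n) c ((pair_sum n (c + l) ^^ k) a)"
      by (simp add: Suc)
    also have "\<dots> = pair_sum n (c + l) ((pair_sum n (c + l) ^^ k) a)"
      by (rule ext) (simp add: pair_sum_def[of "Suc n"] eig, simp add: pair_sum_def[of n] algebra_simps)
    finally show ?case by simp
  qed simp
qed

lemma exp_quarter_turns:
  assumes "s = 1 \<or> s = -1"
  shows "exp (\<i> * of_real (s * pi / 4) * 2) = \<i> * of_real s"
    "exp (\<i> * of_real (s * pi / 4) * 4) = -1"
proof -
  have "exp (\<i> * of_real (s * pi / 4) * 2) = cis (s * pi / 2)"
    by (simp add: cis_conv_exp algebra_simps)
  also have "\<dots> = \<i> * of_real s"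
    using assms by (auto simp: cis.ctr complex_eq_iff)
  finally show "exp (\<i> * of_real (s * pi / 4) * 2) = \<i> * of_real s" .
  have "exp (\<i> * of_real (s * pi / 4) * 4) = cis (s * pi)"
    by (simp add: cis_conv_exp algebra_simps)
  also have "\<dots> = -1"
    using assms by (auto simp: cis.ctr complex_eq_iff)
  finally show "exp (\<i> * of_real (s * pi / 4) * 4) = -1" .
qed

text \<open>By induction on the number of pairs: split \<open>a\<close> into eigenvectors of the
  last summand, for the eigenvalues 2, 4 and 0. On each of them the last summand moves into the
  constant, and the induction hypothesis applies with \<open>c + 2\<close>, \<open>c + 4\<close> and
  \<open>c\<close>.\<close>

lemma pair_sum_exp_sums:
  assumes s: "s = 1 \<or> s = -1" and \<theta>: "\<theta> = s * pi / 4"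
  shows "(\<lambda>k. (\<i> * of_real \<theta>) ^ k / fact k * (pair_sum n c ^^ k) a A) sums
           (exp (\<i> * of_real \<theta> * c) * grassmann_fourier s n a A)"
proof (induction n arbitrary: a A c)
  case 0
  have "(pair_sum 0 c ^^ k) a = (\<lambda>A. c ^ k * a A)" for k
    by (induction k) (simp_all add: pair_sum_def mult.assoc)
  moreover have "(\<lambda>k. ((\<i> * of_real \<theta> * c) ^ k /\<^sub>R fact k) * a A) sums (exp (\<i> * of_real \<theta> * c) * a A)"
    by (intro sums_mult2 exp_converges)
  ultimately show ?case
    by (simp add: power_mult_distrib scaleR_conv_of_real field_simps)
next
  case (Suc n)
  \<comment> \<open>\<open>a2\<close> collects the monomials with exactly one index of the last
    pair, where the eigenvalue is 2. On the rest \<open>?e\<close>, the square of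
    \<open>pair_flip\<close> is 4, so \<open>(?e + ?S / 2) / 2\<close> and
    \<open>(?e - ?S / 2) / 2\<close> project onto its eigenvalues 2 and -2, that is, onto the
    eigenvalues 4 and 0 of the summand.\<close>
  let ?e = "\<lambda>A. if (2 * Suc n - 1 \<in> A) = (2 * Suc n \<in> A) then a A else 0"
  let ?S = "pair_flip (Suc n) a"
  define a2 where "a2 A = (if (2 * Suc n - 1 \<in> A) = (2 * Suc n \<in> A) then 0 else a A)" for A
  define a4 where "a4 A = (1/2) * ?e A + (1/4) * ?S A" for A
  define a0 where "a0 A = (1/2) * ?e A + (-1/4) * ?S A" for A
  have S: "pair_flip (Suc n) ?e = ?S" "pair_flip (Suc n) ?S = (\<lambda>A. 4 * ?e A)"
    by (auto simp: fun_eq_iff pair_flip_square) (auto simp: pair_flip_def)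
  have a: "a = (\<lambda>A. a2 A + (a4 A + a0 A))"
    by (auto simp: fun_eq_iff a2_def a4_def a0_def)
  have S0: "?S A = 0" if "(2 * Suc n - 1 \<in> A) \<noteq> (2 * Suc n \<in> A)" for A
    using that by (auto simp: pair_flip_def)
  have S2: "pair_flip (Suc n) a2 = (\<lambda>A. 0)"
    by (auto simp: fun_eq_iff pair_flip_def a2_def)
  have S4: "pair_flip (Suc n) a4 = (\<lambda>A. 2 * a4 A)"
    unfolding a4_def[abs_def] grassmann_linearD[OF grassmann_linear_pair_flip] S
    by (simp add: fun_eq_iff)
  have S0': "pair_flip (Suc n) a0 = (\<lambda>A. -2 * a0 A)"
    unfolding a0_def[abs_def] grassmann_linearD[OF grassmann_linear_pair_flip] S
    by (simp add: fun_eq_iff)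
  have eig: "(pair_sum (Suc n) c ^^ k) a2 = (pair_sum n (c + 2) ^^ k) a2"
    "(pair_sum (Suc n) c ^^ k) a4 = (pair_sum n (c + 4) ^^ k) a4"
    "(pair_sum (Suc n) c ^^ k) a0 = (pair_sum n (c + 0) ^^ k) a0" for k
    by (rule pair_sum_funpow_eigen, simp add: S2 S4 S0')+
  have "(\<lambda>k. (\<i> * of_real \<theta>) ^ k / fact k * (pair_sum (Suc n) c ^^ k) a A) =
     (\<lambda>k. (\<i> * of_real \<theta>) ^ k / fact k * (pair_sum n (c + 2) ^^ k) a2 A +
      ((\<i> * of_real \<theta>) ^ k / fact k * (pair_sum n (c + 4) ^^ k) a4 A +
       (\<i> * of_real \<theta>) ^ k / fact k * (pair_sum n (c + 0) ^^ k) a0 A))"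
    by (subst a) (simp only: grassmann_linear_add[OF grassmann_linear_funpow[OF grassmann_linear_pair_sum]]
        eig distrib_left)
  also have "\<dots> sums (exp (\<i> * of_real \<theta> * (c + 2)) * grassmann_fourier s n a2 A +
      (exp (\<i> * of_real \<theta> * (c + 4)) * grassmann_fourier s n a4 A +
       exp (\<i> * of_real \<theta> * (c + 0)) * grassmann_fourier s n a0 A))"
    by (intro sums_add Suc.IH)
  also have "\<dots> = exp (\<i> * of_real \<theta> * c) * (\<i> * of_real s * grassmann_fourier s n a2 A +
      (- grassmann_fourier s n a4 A + grassmann_fourier s n a0 A))"
    unfolding distrib_left exp_add exp_quarter_turns[OF s, folded \<theta>] by (simp add: algebra_simps)
  also have "\<i> * of_real s * grassmann_fourier s n a2 A +
      (- grassmann_fourier s n a4 A + grassmann_fourier s n a0 A)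
      = grassmann_fourier s n (\<lambda>A. \<i> * of_real s * a2 A + (- a4 A + a0 A)) A"
    by (simp only: grassmann_linear_add[OF grassmann_linear_grassmann_fourier]
        grassmann_linear_scale[OF grassmann_linear_grassmann_fourier]
        grassmann_linear_uminus[OF grassmann_linear_grassmann_fourier])
  \<comment> \<open>The halves of \<open>?e\<close> cancel in \<open>- a4 + a0\<close>, which leaves
    \<open>- ?S / 2\<close>.\<close>
  also have "(\<lambda>A. \<i> * of_real s * a2 A + (- a4 A + a0 A)) = pair_fourier s (Suc n) a"
    using S0 by (auto simp: fun_eq_iff pair_fourier_def a2_def a4_def a0_def)
  finally show ?case by simp
qed

section \<open>The Berezin transform\<close>

lemma gsgn_Suc: "gsgn (Suc i) A = (if i \<in> A then - gsgn i A else gsgn i A)"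
proof (cases "i \<in> A")
  case True
  then have "{k \<in> A. k < Suc i} = insert i {k \<in> A. k < i}" by auto
  then show ?thesis using True by (simp add: gsgn_def)
next
  case False
  then have "{k \<in> A. k < Suc i} = {k \<in> A. k < i}" by (auto simp: less_Suc_eq)
  then show ?thesis using False by (simp add: gsgn_def)
qed

lemma gsgn_Un:
  assumes "A \<inter> B = {}"
  shows "gsgn i (A \<union> B) = gsgn i A * gsgn i B"
proof -
  have "{k \<in> A \<union> B. k < i} = {k \<in> A. k < i} \<union> {k \<in> B. k < i}" by auto
  moreover have "card \<dots> = card {k \<in> A. k < i} + card {k \<in> B. k < i}"
    using assms by (intro card_Un_disjoint) auto
  ultimately show ?thesis by (simp add: gsgn_def power_add)
qed

lemma gsign_insert:
  assumes "finite A" "finite B" "i \<notin> A"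
  shows "gsign (insert i A) B = gsgn i B * gsign A B"
proof -
  have fin: "finite {(u, v). u \<in> A \<and> v \<in> B \<and> v < u}"
    by (rule finite_subset[of _ "A \<times> B"]) (use assms in auto)
  have "{(u, v). u \<in> insert i A \<and> v \<in> B \<and> v < u}
      = ({i} \<times> {v \<in> B. v < i}) \<union> {(u, v). u \<in> A \<and> v \<in> B \<and> v < u}"
    by auto
  moreover have "card \<dots> = card {v \<in> B. v < i} + card {(u, v). u \<in> A \<and> v \<in> B \<and> v < u}"
    using assms fin by (subst card_Un_disjoint) (auto simp: card_cartesian_product_singleton)
  ultimately show ?thesis by (simp add: gsign_def gsgn_def power_add)
qed

text \<open>Associativity for a single generator on the left. Removing \<open>i\<close> from the
  left factor matches the subsets summed over, and the sign of \<open>i\<close> against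
  \<open>C\<close> is the product of its signs against the two factors. Iteration turns left
  multiplication by products of generators into compositions of \<open>gext\<close>.\<close>

lemma gmult_gext:
  assumes "finite C"
  shows "gmult (gext i b) a C = gext i (gmult b a) C"
proof (cases "i \<in> C")
  case False
  then show ?thesis by (auto simp: gmult_def gext_def intro!: sum.neutral)
next
  case True
  have "gmult (gext i b) a C = (\<Sum>A\<in>{A \<in> Pow C. i \<in> A}. gsign A (C - A) * gext i b A * a (C - A))"
    unfolding gmult_def using assms by (intro sum.mono_neutral_right) (auto simp: gext_def)
  also have "\<dots> = (\<Sum>A\<in>Pow (C - {i}). gsign (insert i A) (C - insert i A) * gext i b (insert i A) * a (C - insert i A))"
    using True by (intro sum.reindex_bij_witness[of _ "insert i" "\<lambda>A. A - {i}"]) (auto simp: insert_absorb)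
  also have "\<dots> = (\<Sum>A\<in>Pow (C - {i}). gsgn i C * (gsign A (C - {i} - A) * b A * a (C - {i} - A)))"
  proof (intro sum.cong refl)
    fix A assume A: "A \<in> Pow (C - {i})"
    have D: "C - insert i A = C - {i} - A" by auto
    have "gsgn i C = gsgn i (C - {i})" by (simp add: gsgn_remove)
    also have "C - {i} = A \<union> (C - {i} - A)" using A by auto
    also have "gsgn i \<dots> = gsgn i A * gsgn i (C - {i} - A)"
      by (rule gsgn_Un) auto
    finally have C: "gsgn i C = gsgn i A * gsgn i (C - {i} - A)" .
    have "gsign (insert i A) (C - {i} - A) = gsgn i (C - {i} - A) * gsign A (C - {i} - A)"
      using A assms by (intro gsign_insert) (auto intro: finite_subset[of A C])
    moreover have "i \<notin> A" "insert i A - {i} = A" using A by auto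
    then have "gext i b (insert i A) = gsgn i A * b A"
      by (simp add: gext_def gsgn_insert)
    ultimately show "gsign (insert i A) (C - insert i A) * gext i b (insert i A) * a (C - insert i A)
        = gsgn i C * (gsign A (C - {i} - A) * b A * a (C - {i} - A))"
      unfolding D C by (simp add: mult_ac)
  qed
  also have "\<dots> = gext i (gmult b a) C"
    using True by (simp add: gext_def gmult_def sum_distrib_left)
  finally show ?thesis .
qed

lemma gmult_gone: "finite C \<Longrightarrow> gmult gone a C = a C"
proof -
  assume "finite C"
  then have "gmult gone a C = (\<Sum>A\<in>{{}}. gsign A (C - A) * gone A * a (C - A))"
    unfolding gmult_def by (intro sum.mono_neutral_right) (auto simp: gone_def)
  then show ?thesis by (simp add: gsign_def gone_def)
qed

lemma gmult_infinite: "infinite C \<Longrightarrow> gmult a b C = 0"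
  by (simp add: gmult_def)

lemma grassmann_linear_gmult_left: "grassmann_linear (\<lambda>b. gmult b a)"
  by (simp add: grassmann_linear_def gmult_def fun_eq_iff algebra_simps sum.distrib sum_distrib_left)

lemma gvar_eq_gext: "gvar i = gext i gone"
proof
  fix A
  have "{k \<in> {i}. k < i} = {}" by auto
  then have "gsgn i {i} = 1" unfolding gsgn_def by (simp only: card.empty power_0)
  then show "gvar i A = gext i gone A"
    by (auto simp: gvar_def gext_def gone_def)
qed

lemma gmult_gvar: "finite C \<Longrightarrow> gmult (gvar i) a C = gext i a C"
  by (simp add: gvar_eq_gext gmult_gext) (simp add: gext_def gmult_gone)

lemma gmult_gvar_gvar: "gmult (gvar i) (gvar j) = gext i (gext j gone)"
proof
  fix C show "gmult (gvar i) (gvar j) C = gext i (gext j gone) C"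
  proof (cases "finite C")
    case False
    then have "C - {i} - {j} \<noteq> {}" by (metis finite.emptyI infinite_remove)
    then show ?thesis using False by (simp add: gmult_infinite gext_def gone_def)
  qed (simp add: gmult_gvar, simp add: gvar_eq_gext)
qed

section \<open>The exponential of the pairing as an operator, and its Berezin integral\<close>

definition partner :: "nat \<Rightarrow> nat" where
  "partner i = (if odd i then i + 1 else i - 1)"

text \<open>\<open>partner\<close> and \<open>orient\<close> encode the symplectic form: the
  fermionic part of the pairing is half of a single sum over all \<open>i\<close> of
  \<open>orient i\<close> times \<open>x_i\<close> times \<open>y\<close> with index
  \<open>partner i\<close>.\<close>

definition orient :: "nat \<Rightarrow> complex" where
  "orient i = (if odd i then 1 else - 1)"

lemma partner_in: "i \<in> {1..2*n} \<Longrightarrow> partner i \<in> {1..2*n}"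
  unfolding partner_def by (cases "odd i"; cases "i = 2*n") auto

text \<open>Left multiplication by the exponent of the Fourier kernel: \<open>c\<close> is its
  bosonic part, a scalar at fixed points, and \<open>\<kappa>\<close> will be
  \<open>- i s / 2\<close>. Powers of an operator replace powers of an element, so the calculations
  below do not involve \<open>gmult\<close>.\<close>

definition pairing_op :: "nat \<Rightarrow> complex \<Rightarrow> complex \<Rightarrow> grassmann \<Rightarrow> grassmann" where
  "pairing_op n c \<kappa> a = (\<lambda>A. c * a A
     + \<kappa> * (\<Sum>i=1..2*n. orient i * gext i (gext (2*n + partner i) a) A))"

definition pairing_exp :: "nat \<Rightarrow> complex \<Rightarrow> complex \<Rightarrow> grassmann \<Rightarrow> grassmann" where
  "pairing_exp n c \<kappa> a = (\<lambda>A. suminf (\<lambda>k. (pairing_op n c \<kappa> ^^ k) a A / fact k))"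

lemma grassmann_linear_pairing_op: "grassmann_linear (pairing_op n c \<kappa>)"
  unfolding grassmann_linear_def pairing_op_def
  by (simp add: grassmann_linearD[OF grassmann_linear_gext] fun_eq_iff algebra_simps
      sum.distrib sum_distrib_left)

text \<open>The exponent is even: a generator passes each quadratic term with two sign
  changes.\<close>

lemma gext_pairing_op: "gext w (pairing_op n c \<kappa> a) = pairing_op n c \<kappa> (gext w a)"
proof -
  note lin = grassmann_linear_gext[of w]
  have "gext w (gext i (gext v a)) A = gext i (gext v (gext w a)) A" for i v A
  proof -
    have "gext v (gext w a) = (\<lambda>A. - gext w (gext v a) A)" using gext_gext by blast
    then show ?thesis
      by (simp add: grassmann_linear_uminus[OF grassmann_linear_gext] gext_gext[of w i])
  qed
  then show ?thesis
    unfolding pairing_op_def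
    by (simp add: grassmann_linear_add[OF lin] grassmann_linear_scale[OF lin] grassmann_linear_sum[OF lin])
qed

text \<open>The product rule for an even left factor: no sign appears, and only the summand
  containing \<open>x_l\<close> contributes a derivative, since the \<open>y\<close> variables have
  indices above \<open>2 n\<close>.\<close>

lemma gderiv_pairing_op:
  assumes l: "l \<in> {1..2*n}"
  shows "gderiv l (pairing_op n c \<kappa> a)
    = (\<lambda>A. pairing_op n c \<kappa> (gderiv l a) A + \<kappa> * orient l * gext (2*n + partner l) a A)"
proof -
  note lin = grassmann_linear_gderiv[of l]
  have *: "gderiv l (gext i (gext v a)) A = (if i = l then gext v a A else 0) + gext i (gext v (gderiv l a)) A"
    if "l \<noteq> v" for i v A
  proof -
    have "gderiv l (gext v a) = (\<lambda>A. - gext v (gderiv l a) A)" using gderiv_gext[of l v a] that by auto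
    then show ?thesis
      by (simp add: gderiv_gext grassmann_linear_uminus[OF grassmann_linear_gext])
  qed
  have ne: "l \<noteq> 2*n + partner i" if "i \<in> {1..2*n}" for i
    using that l unfolding partner_def by (auto split: if_splits elim: oddE evenE)
  have "gderiv l (pairing_op n c \<kappa> a) A = c * gderiv l a A
     + \<kappa> * (\<Sum>i=1..2*n. orient i * ((if i = l then gext (2*n + partner i) a A else 0)
         + gext i (gext (2*n + partner i) (gderiv l a)) A))" for A
    unfolding pairing_op_def
    by (subst grassmann_linear_add[OF lin], subst (1 2) grassmann_linear_scale[OF lin], subst grassmann_linear_sum[OF lin])
       (simp add: grassmann_linear_scale[OF lin] * ne del: One_nat_def)
  also have "\<dots> A = pairing_op n c \<kappa> (gderiv l a) A + \<kappa> * orient l * gext (2*n + partner l) a A" for A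
    using l by (simp add: pairing_op_def algebra_simps sum.distrib if_distrib[of "\<lambda>z. _ * z"] cong: if_cong)
  finally show ?thesis by auto
qed

text \<open>The derivative of the exponent commutes with the exponent, so the power rule has its
  commutative form. At \<open>k = 0\<close> the truncated \<open>k - 1\<close> is multiplied by
  0.\<close>

lemma gderiv_pairing_op_funpow:
  assumes l: "l \<in> {1..2*n}"
  shows "gderiv l ((pairing_op n c \<kappa> ^^ k) a) = (\<lambda>A. (pairing_op n c \<kappa> ^^ k) (gderiv l a) A
     + of_nat k * (\<kappa> * orient l) * gext (2*n + partner l) ((pairing_op n c \<kappa> ^^ (k - 1)) a) A)"
proof (induction k)
  case (Suc k)
  let ?T = "pairing_op n c \<kappa>"
  note lin = grassmann_linear_pairing_op[of n c \<kappa>]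
  have "gderiv l ((?T ^^ Suc k) a) = (\<lambda>A. (?T ^^ Suc k) (gderiv l a) A
      + of_nat k * (\<kappa> * orient l) * gext (2*n + partner l) (?T ((?T ^^ (k - 1)) a)) A
      + \<kappa> * orient l * gext (2*n + partner l) ((?T ^^ k) a) A)"
    by (simp add: gderiv_pairing_op[OF l] Suc.IH grassmann_linear_add[OF lin] grassmann_linear_scale[OF lin] gext_pairing_op)
  also have "\<dots> = (\<lambda>A. (?T ^^ Suc k) (gderiv l a) A
      + of_nat (Suc k) * (\<kappa> * orient l) * gext (2*n + partner l) ((?T ^^ k) a) A)"
    by (cases k) (simp_all add: algebra_simps fun_eq_iff)
  finally show ?case by simp
qed simp

text \<open>Each application removes further indices from the set at which \<open>a\<close> is
  evaluated. The bound therefore ranges over all sets \<open>A - F\<close>, which form a finite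
  family stable under these removals.\<close>

lemma pairing_op_funpow_bound:
  assumes M: "\<And>F. F \<subseteq> {1..4*n} \<Longrightarrow> norm (a (A - F)) \<le> M" and F: "F \<subseteq> {1..4*n}"
  shows "norm ((pairing_op n c \<kappa> ^^ k) a (A - F)) \<le> (norm c + norm \<kappa> * (2 * real n)) ^ k * M"
  using F
proof (induction k arbitrary: F)
  case (Suc k)
  let ?b = "(pairing_op n c \<kappa> ^^ k) a" and ?L = "norm c + norm \<kappa> * (2 * real n)"
  have M0: "M \<ge> 0" using order.trans[OF norm_ge_zero M[of "{}"]] by simp
  have LM: "0 \<le> ?L ^ k * M" using M0 by simp
  have *: "norm (orient i * gext i (gext (2*n + partner i) ?b) (A - F)) \<le> ?L ^ k * M" if i: "i \<in> {1..2*n}" for i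
  proof -
    have "2*n + partner i \<in> {1..4*n}" using partner_in[OF i] by auto
    then have "insert (2*n + partner i) (insert i F) \<subseteq> {1..4*n}" using i Suc.prems by auto
    then have "norm (?b (A - insert (2*n + partner i) (insert i F))) \<le> ?L ^ k * M"
      by (rule Suc.IH)
    moreover have "A - F - {i} - {2*n + partner i} = A - insert (2*n + partner i) (insert i F)" by auto
    ultimately show ?thesis
      using LM by (simp add: gext_def gsgn_def orient_def norm_mult norm_power)
  qed
  have "norm ((pairing_op n c \<kappa> ^^ Suc k) a (A - F)) \<le> norm c * norm (?b (A - F))
      + norm \<kappa> * (\<Sum>i=1..2*n. norm (orient i * gext i (gext (2*n + partner i) ?b) (A - F)))"
    unfolding funpow.simps comp_apply pairing_op_def[of _ _ _ ?b]
    by (rule order.trans[OF norm_triangle_ineq]) (auto simp: norm_mult intro!: add_mono mult_left_mono sum_norm_le)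
  also have "\<dots> \<le> norm c * (?L ^ k * M) + norm \<kappa> * (\<Sum>i=1..2*n. ?L ^ k * M)"
    by (intro add_mono mult_left_mono sum_mono Suc.IH Suc.prems *) auto
  also have "\<dots> = ?L ^ Suc k * M" by (simp add: algebra_simps)
  finally show ?case .
qed (use M in simp)

lemma pairing_op_summable:
  "summable (\<lambda>k. (pairing_op n c \<kappa> ^^ k) a A / fact k)"
proof -
  let ?L = "norm c + norm \<kappa> * (2 * real n)"
  \<comment> \<open>A maximum over the finitely many sets reachable from \<open>A\<close>; thus
    \<open>a\<close> itself may be unbounded and \<open>A\<close> infinite.\<close>
  define M where "M = Max ((\<lambda>F. norm (a (A - F))) ` Pow {1..4*n})"
  have M: "norm (a (A - F)) \<le> M" if "F \<subseteq> {1..4*n}" for F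
    unfolding M_def using that by (intro Max_ge) auto
  have "summable (\<lambda>k. ?L ^ k / fact k * M)"
    using summable_exp_generic[of ?L] by (intro summable_mult2) (simp add: divide_inverse mult.commute)
  then show ?thesis
  proof (rule summable_comparison_test'[where N = 0])
    show "norm ((pairing_op n c \<kappa> ^^ k) a A / fact k) \<le> ?L ^ k / fact k * M" for k
      using pairing_op_funpow_bound[where a = a and A = A and M = M and F = "{}" and n = n and c = c and \<kappa> = \<kappa> and k = k] M by (simp add: norm_divide divide_right_mono)
  qed
qed

lemma grassmann_linear_pairing_exp: "grassmann_linear (pairing_exp n c \<kappa>)"
  unfolding grassmann_linear_def
proof (intro allI ext)
  fix a b c' d A
  have S: "(\<lambda>k. (pairing_op n c \<kappa> ^^ k) a A / fact k) sums pairing_exp n c \<kappa> a A" for a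
    unfolding pairing_exp_def by (rule summable_sums[OF pairing_op_summable])
  have "(\<lambda>k. (pairing_op n c \<kappa> ^^ k) (\<lambda>A. c' * a A + d * b A) A / fact k) sums
      (c' * pairing_exp n c \<kappa> a A + d * pairing_exp n c \<kappa> b A)"
    using sums_add[OF sums_mult[OF S[of a], of c'] sums_mult[OF S[of b], of d]]
    by (simp add: grassmann_linearD[OF grassmann_linear_funpow[OF grassmann_linear_pairing_op]] add_divide_distrib)
  then show "pairing_exp n c \<kappa> (\<lambda>A. c' * a A + d * b A) A = c' * pairing_exp n c \<kappa> a A + d * pairing_exp n c \<kappa> b A"
    using S sums_unique2 by blast
qed

text \<open>The power rule summed over all powers: \<open>k / fact k\<close> shifts the exponential
  series by one index.\<close>

lemma gderiv_pairing_exp: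
  assumes l: "l \<in> {1..2*n}"
  shows "gderiv l (pairing_exp n c \<kappa> a) A
    = pairing_exp n c \<kappa> (gderiv l a) A + \<kappa> * orient l * gext (2*n + partner l) (pairing_exp n c \<kappa> a) A"
proof -
  let ?T = "pairing_op n c \<kappa>" and ?w = "2*n + partner l"
  have S: "(\<lambda>k. (?T ^^ k) b A / fact k) sums pairing_exp n c \<kappa> b A" for b A
    unfolding pairing_exp_def by (rule summable_sums[OF pairing_op_summable])
  have 1: "(\<lambda>k. gderiv l ((?T ^^ k) a) A / fact k) sums gderiv l (pairing_exp n c \<kappa> a) A"
    using sums_mult[OF S[of a "insert l A"], of "gsgn l A"] by (auto simp: gderiv_altdef)
  have X: "(\<lambda>k. gext ?w ((?T ^^ k) a) A / fact k) sums gext ?w (pairing_exp n c \<kappa> a) A"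
    using sums_mult[OF S[of a "A - {?w}"], of "gsgn ?w A"] by (auto simp: gext_def)
  have "(\<lambda>k. of_nat (Suc k) * (\<kappa> * orient l) * gext ?w ((?T ^^ (Suc k - 1)) a) A / fact (Suc k)) sums
      (\<kappa> * orient l * gext ?w (pairing_exp n c \<kappa> a) A)"
    using sums_mult[OF X, of "\<kappa> * orient l"] by (simp add: field_simps del: of_nat_Suc)
  then have "(\<lambda>k. of_nat k * (\<kappa> * orient l) * gext ?w ((?T ^^ (k - 1)) a) A / fact k) sums
      (\<kappa> * orient l * gext ?w (pairing_exp n c \<kappa> a) A)"
    by (subst (asm) sums_Suc_iff) simp
  from sums_add[OF S[of "gderiv l a" A] this]
  have "(\<lambda>k. gderiv l ((?T ^^ k) a) A / fact k) sums
     (pairing_exp n c \<kappa> (gderiv l a) A + \<kappa> * orient l * gext ?w (pairing_exp n c \<kappa> a) A)"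
    by (simp add: gderiv_pairing_op_funpow[OF l] add_divide_distrib)
  with 1 show ?thesis by (rule sums_unique2)
qed

text \<open>The Berezin integral of a derivative vanishes: the derivative can be moved, up to sign,
  next to its copy in the list, and its square is 0.\<close>

lemma fold_gderiv_gderiv: "l \<in> set L \<Longrightarrow> fold gderiv L (gderiv l a) = (\<lambda>A. 0)"
proof (induction L arbitrary: a)
  case (Cons i L)
  have swap: "gderiv i (gderiv l a) = (\<lambda>A. - gderiv l (gderiv i a) A)"
    using gderiv_gderiv by blast
  show ?case
  proof (cases "i = l")
    case True
    have "gderiv l (gderiv l a) = (\<lambda>A. 0)" by (auto simp: gderiv_altdef)
    then show ?thesis using True by (simp add: grassmann_linear_zero[OF grassmann_linear_fold_gderiv])
  next
    case False
    then show ?thesis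
      using Cons by (simp add: swap grassmann_linear_uminus[OF grassmann_linear_fold_gderiv])
  qed
qed simp

text \<open>For the Berezin integral the list has even length \<open>2 n\<close>, so the sign
  disappears.\<close>

lemma fold_gderiv_gext:
  "w \<notin> set L \<Longrightarrow> fold gderiv L (gext w a) = (\<lambda>A. (-1) ^ length L * gext w (fold gderiv L a) A)"
proof (induction L arbitrary: a)
  case (Cons i L)
  then have "gderiv i (gext w a) = (\<lambda>A. - gext w (gderiv i a) A)"
    using gderiv_gext[of i w a] by auto
  then show ?case
    using Cons by (simp add: grassmann_linear_uminus[OF grassmann_linear_fold_gderiv])
qed simp

text \<open>Renaming the \<open>y\<close> variables to \<open>x\<close> variables preserves the
  order of the indices, hence all signs.\<close>

lemma gext_shift: "gext (d + j) a ((+) d ` B) = gext j (\<lambda>B. a ((+) d ` B)) B"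
proof -
  have "{k \<in> (+) d ` B. k < d + j} = (+) d ` {k \<in> B. k < j}" by auto
  then have "gsgn (d + j) ((+) d ` B) = gsgn j B"
    unfolding gsgn_def by (simp add: card_image)
  moreover have "(+) d ` B - {d + j} = (+) d ` (B - {j})" by auto
  ultimately show ?thesis by (auto simp: gext_def)
qed

text \<open>The factor \<open>2 ^ n\<close> is \<open>(2 pi)^n / pi^n\<close>: the fermionic share
  of the constant of the Fourier transform times that of the Berezin integral.\<close>

definition berezin_fourier :: "nat \<Rightarrow> complex \<Rightarrow> complex \<Rightarrow> grassmann \<Rightarrow> grassmann" where
  "berezin_fourier n c \<kappa> a =
     (\<lambda>B. 2 ^ n * fold gderiv [1..<2*n+1] (pairing_exp n c \<kappa> a) ((+) (2*n) ` B))"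

lemma grassmann_linear_berezin_fourier: "grassmann_linear (berezin_fourier n c \<kappa>)"
  unfolding grassmann_linear_def berezin_fourier_def
  by (simp only: grassmann_linearD[OF grassmann_linear_pairing_exp] grassmann_linearD[OF grassmann_linear_fold_gderiv])
     (simp add: algebra_simps)

text \<open>Integration by parts: the total derivative integrates to 0, and the derivative of the
  exponential is multiplication by a \<open>y\<close> variable, which leaves the integral.\<close>

lemma berezin_fourier_gderiv:
  assumes l: "l \<in> {1..2*n}"
  shows "berezin_fourier n c \<kappa> (gderiv l a)
    = (\<lambda>B. - \<kappa> * orient l * gext (partner l) (berezin_fourier n c \<kappa> a) B)"
proof
  fix B
  let ?L = "[1..<2*n+1]" and ?W = "pairing_exp n c \<kappa>"
  note lin = grassmann_linear_fold_gderiv[of ?L]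
  have W: "?W (gderiv l a) = (\<lambda>A. gderiv l (?W a) A - \<kappa> * orient l * gext (2*n + partner l) (?W a) A)"
    by (simp add: gderiv_pairing_exp[OF l] fun_eq_iff)
  have w: "2*n + partner l \<notin> set ?L"
    using l by (auto simp: partner_def elim!: oddE evenE)
  have l': "l \<in> set ?L" using l by (simp only: set_upt) auto
  have "fold gderiv ?L (?W (gderiv l a)) ((+) (2*n) ` B)
      = - \<kappa> * orient l * gext (2*n + partner l) (fold gderiv ?L (?W a)) ((+) (2*n) ` B)"
    unfolding W grassmann_linear_diff[OF lin] grassmann_linear_scale[OF lin] fold_gderiv_gderiv[OF l']
      fold_gderiv_gext[OF w] by simp
  then show "berezin_fourier n c \<kappa> (gderiv l a) B
      = - \<kappa> * orient l * gext (partner l) (berezin_fourier n c \<kappa> a) B"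
    unfolding gext_shift berezin_fourier_def grassmann_linear_scale[OF grassmann_linear_gext]
    by (simp only: mult_ac)
qed

definition gmonom :: "nat set \<Rightarrow> grassmann" where
  "gmonom C = (\<lambda>A. if A = C then 1 else 0)"

lemma gext_gmonom: "i \<in> C \<Longrightarrow> gext i (gmonom C) = (\<lambda>A. 0)"
  by (auto simp: gext_def gmonom_def fun_eq_iff)

text \<open>Each derivative removes the smallest generator still present, which stands in front, so
  no sign arises.\<close>

lemma fold_gderiv_gmonom:
  "k \<le> N \<Longrightarrow> fold gderiv [1..<k+1] (gmonom {1..N}) = gmonom {k+1..N}"
proof (induction k)
  case (Suc k)
  have "gderiv (Suc k) (gmonom {k+1..N}) A = gmonom {Suc k+1..N} A" for A
  proof -
    have "{k+1..N} = insert (Suc k) {Suc k+1..N}"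
      using Suc.prems by auto
    then have eq: "insert (Suc k) A = {k+1..N} \<longleftrightarrow> A = {Suc k+1..N}" if "Suc k \<notin> A"
      using that insert_ident[of "Suc k" A "{Suc k+1..N}"] by simp
    have "{j \<in> {Suc k+1..N}. j < Suc k} = {}" by auto
    then have sgn: "gsgn (Suc k) {Suc k+1..N} = 1" unfolding gsgn_def by (simp only: card.empty power_0)
    show ?thesis
    proof (cases "Suc k \<in> A")
      case True
      then show ?thesis by (auto simp: gderiv_altdef gmonom_def)
    next
      case False
      then show ?thesis using sgn unfolding gderiv_altdef gmonom_def eq[OF False] by simp
    qed
  qed
  then show ?case using Suc by auto
qed simp

text \<open>Every fermionic term of the exponent contains some \<open>x_i\<close>, which annihilates
  the top monomial; only the scalar \<open>c\<close> survives in the exponential.\<close>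

lemma berezin_fourier_top: "berezin_fourier n c \<kappa> (gmonom {1..2*n}) = (\<lambda>B. 2 ^ n * exp c * gone B)"
proof -
  let ?t = "gmonom {1..2*n}"
  have "pairing_op n c \<kappa> ?t = (\<lambda>A. c * ?t A)"
  proof -
    have "gext i (gext w ?t) A = 0" if "i \<in> {1..2*n}" for i w A
      using that by (subst gext_gext) (simp only: gext_gmonom grassmann_linear_zero[OF grassmann_linear_gext], simp)
    then show ?thesis by (simp add: pairing_op_def)
  qed
  then have "(pairing_op n c \<kappa> ^^ k) ?t = (\<lambda>A. c ^ k * ?t A)" for k
    by (induction k) (simp_all add: grassmann_linear_scale[OF grassmann_linear_pairing_op] mult_ac)
  moreover have "(\<lambda>k. c ^ k * ?t A / fact k) sums (exp c * ?t A)" for A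
    using sums_mult2[OF exp_converges[of c], of "?t A"] by (simp add: scaleR_conv_of_real field_simps)
  ultimately have "pairing_exp n c \<kappa> ?t = (\<lambda>A. exp c * ?t A)"
    by (simp add: pairing_exp_def sums_iff)
  then have "fold gderiv [1..<2*n+1] (pairing_exp n c \<kappa> ?t) = (\<lambda>A. exp c * gmonom {2*n+1..2*n} A)"
    by (simp only: grassmann_linear_scale[OF grassmann_linear_fold_gderiv] fold_gderiv_gmonom[OF order.refl])
  then show ?thesis
    unfolding berezin_fourier_def by (auto simp: gmonom_def gone_def fun_eq_iff)
qed

section \<open>The same relations for the fermionic exponential, and comparison\<close>

lemma pair_fourier_simps:
  "2*j-1 \<in> A \<Longrightarrow> 2*j \<in> A \<Longrightarrow> pair_fourier s j a A = a (A - {2*j-1, 2*j}) / 2"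
  "2*j-1 \<notin> A \<Longrightarrow> 2*j \<notin> A \<Longrightarrow> pair_fourier s j a A = 2 * a (A \<union> {2*j-1, 2*j})"
  "2*j-1 \<in> A \<Longrightarrow> 2*j \<notin> A \<Longrightarrow> pair_fourier s j a A = \<i> * of_real s * a A"
  "2*j-1 \<notin> A \<Longrightarrow> 2*j \<in> A \<Longrightarrow> pair_fourier s j a A = \<i> * of_real s * a A"
  by (simp_all add: pair_fourier_def pair_flip_def)

text \<open>Both members of the pair lie on the same side of \<open>l\<close>. Adding or removing
  them together therefore does not change the sign attached to \<open>l\<close>; the next lemma uses
  the same argument.\<close>

lemma pair_fourier_gderiv_other:
  assumes "j \<ge> 1" "l \<noteq> 2*j-1" "l \<noteq> 2*j"
  shows "pair_fourier s j (gderiv l a) = gderiv l (pair_fourier s j a)"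
proof
  fix A
  have lt: "2*j-1 < l \<longleftrightarrow> 2*j < l" "2*j-1 \<noteq> 2*j" using assms by auto
  have e: "insert l (A - {2*j-1, 2*j}) = insert l A - {2*j-1, 2*j}"
    "insert l (A \<union> {2*j-1, 2*j}) = insert l A \<union> {2*j-1, 2*j}" using assms by auto
  have sgn: "gsgn l (A \<union> {2*j-1, 2*j}) = gsgn l A" if "2*j-1 \<notin> A" "2*j \<notin> A"
    using that lt by (auto simp: gsgn_insert)
  have "A - {2*j-1, 2*j} = A - {2*j-1} - {2*j}" by auto
  then have sgn': "gsgn l (A - {2*j-1, 2*j}) = gsgn l A" if "2*j-1 \<in> A" "2*j \<in> A"
    using that lt by (auto simp: gsgn_remove)
  have mem: "2*j-1 \<in> insert l A \<longleftrightarrow> 2*j-1 \<in> A" "2*j \<in> insert l A \<longleftrightarrow> 2*j \<in> A"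
    "l \<in> A - {2*j-1, 2*j} \<longleftrightarrow> l \<in> A" "l \<in> A \<union> {2*j-1, 2*j} \<longleftrightarrow> l \<in> A"
    using assms by auto
  show "pair_fourier s j (gderiv l a) A = gderiv l (pair_fourier s j a) A"
    by (cases "2*j-1 \<in> A"; cases "2*j \<in> A"; simp only: pair_fourier_simps gderiv_altdef mem e sgn sgn' not_False_eq_True split: if_split; simp)
qed

lemma pair_fourier_gext_other:
  assumes "j \<ge> 1" "l \<noteq> 2*j-1" "l \<noteq> 2*j"
  shows "pair_fourier s j (gext l a) = gext l (pair_fourier s j a)"
proof
  fix A
  have lt: "2*j-1 < l \<longleftrightarrow> 2*j < l" "2*j-1 \<noteq> 2*j" using assms by auto
  have e: "A - {2*j-1, 2*j} - {l} = A - {l} - {2*j-1, 2*j}"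
    "A \<union> {2*j-1, 2*j} - {l} = (A - {l}) \<union> {2*j-1, 2*j}" using assms by auto
  have sgn: "gsgn l (A \<union> {2*j-1, 2*j}) = gsgn l A" if "2*j-1 \<notin> A" "2*j \<notin> A"
    using that lt by (auto simp: gsgn_insert)
  have "A - {2*j-1, 2*j} = A - {2*j-1} - {2*j}" by auto
  then have sgn': "gsgn l (A - {2*j-1, 2*j}) = gsgn l A" if "2*j-1 \<in> A" "2*j \<in> A"
    using that lt by (auto simp: gsgn_remove)
  have mem: "2*j-1 \<in> A - {l} \<longleftrightarrow> 2*j-1 \<in> A" "2*j \<in> A - {l} \<longleftrightarrow> 2*j \<in> A"
    "l \<in> A - {2*j-1, 2*j} \<longleftrightarrow> l \<in> A" "l \<in> A \<union> {2*j-1, 2*j} \<longleftrightarrow> l \<in> A"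
    using assms by auto
  show "pair_fourier s j (gext l a) A = gext l (pair_fourier s j a) A"
    by (cases "2*j-1 \<in> A"; cases "2*j \<in> A"; simp only: pair_fourier_simps gext_def mem e sgn sgn' not_False_eq_True split: if_split; simp)
qed

text \<open>A calculation in the four-dimensional algebra of one pair. The constant
  \<open>i s / 2\<close> is \<open>- \<kappa>\<close> for \<open>\<kappa> = - i s / 2\<close>, so
  this is the rule found for the Berezin transform in \<open>berezin_fourier_gderiv\<close>.\<close>

lemma pair_fourier_gderiv_pair:
  assumes s: "s = 1 \<or> s = - 1" and j: "j \<ge> 1" and l: "l = 2*j-1 \<or> l = 2*j"
  shows "pair_fourier s j (gderiv l a)
    = (\<lambda>B. \<i> * of_real s / 2 * orient l * gext (partner l) (pair_fourier s j a) B)"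
proof
  fix A
  define p where "p = 2*j-1"
  have q: "2*j = Suc p" using j by (simp add: p_def)
  have p: "odd p" using j by (simp add: p_def)
  have l': "l = p \<or> l = Suc p" using l unfolding q by simp
  have pp: "orient p = 1" "partner p = Suc p" "orient (Suc p) = - 1" "partner (Suc p) = p"
    using p by (simp_all add: orient_def partner_def)
  have ii: "\<i> * (g * (\<i> * z)) = - (g * z)" for g z
    by (simp add: mult.left_commute[of \<i> g])
  note simps = pair_fourier_simps[of j, folded p_def, unfolded q]
  have e: "p \<in> A \<Longrightarrow> Suc p \<in> A \<Longrightarrow> insert p (A - {p, Suc p}) = A - {Suc p}"
    "p \<in> A \<Longrightarrow> Suc p \<in> A \<Longrightarrow> insert (Suc p) (A - {p, Suc p}) = A - {p}"
    "p \<in> A \<Longrightarrow> Suc p \<notin> A \<Longrightarrow> A - {p} \<union> {p, Suc p} = insert (Suc p) A"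
    "p \<notin> A \<Longrightarrow> Suc p \<in> A \<Longrightarrow> A - {Suc p} \<union> {p, Suc p} = insert p A"
    by auto
  have "A - {p, Suc p} = A - {p} - {Suc p}" by auto
  then have g: "gsgn p (A - {p, Suc p}) = gsgn p A" by (simp add: gsgn_remove)
  show "pair_fourier s j (gderiv l a) A = \<i> * of_real s / 2 * orient l * gext (partner l) (pair_fourier s j a) A"
    using s l'
    by (elim disjE; cases "p \<in> A"; cases "Suc p \<in> A"; simp only: simps gderiv_altdef gext_def pp e g gsgn_Suc
        Diff_iff Un_iff insert_iff empty_iff simp_thms n_not_Suc_n if_True if_False; simp add: ii)
qed

lemma grassmann_fourier_gext: "w > 2*n \<Longrightarrow> grassmann_fourier s n (gext w a) = gext w (grassmann_fourier s n a)"
  by (induction n arbitrary: a) (simp_all add: pair_fourier_gext_other)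

lemma grassmann_fourier_gderiv:
  assumes s: "s = 1 \<or> s = - 1"
  shows "l \<in> {1..2*n} \<Longrightarrow> grassmann_fourier s n (gderiv l a)
    = (\<lambda>B. \<i> * of_real s / 2 * orient l * gext (partner l) (grassmann_fourier s n a) B)"
proof (induction n arbitrary: a)
  case (Suc n)
  show ?case
  proof (cases "l \<le> 2*n")
    case True
    then show ?thesis using Suc by (simp add: pair_fourier_gderiv_other)
  next
    \<comment> \<open>Here \<open>l\<close> belongs to the last pair. The multiplication produced
      has an index beyond the remaining pairs and so passes through their factors.\<close>
    case False
    then have l: "l = 2 * Suc n - 1 \<or> l = 2 * Suc n" using Suc.prems by auto
    then have "partner l > 2*n" by (auto simp: partner_def)
    moreover have n: "Suc n \<ge> 1" by simp
    ultimately show ?thesis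
      unfolding grassmann_fourier.simps pair_fourier_gderiv_pair[OF s n l]
        grassmann_linear_scale[OF grassmann_linear_grassmann_fourier] by (simp only: grassmann_fourier_gext)
  qed
qed simp

text \<open>Each pair contributes one factor 2, which accounts for the \<open>2 ^ n\<close> built
  into \<open>berezin_fourier\<close>.\<close>

lemma grassmann_fourier_top: "grassmann_fourier s n (gmonom {1..2*n}) = (\<lambda>B. 2 ^ n * gone B)"
proof (induction n)
  case 0
  show ?case by (auto simp: gmonom_def gone_def)
next
  case (Suc n)
  let ?p = "2 * Suc n - 1" and ?q = "2 * Suc n"
  have "pair_fourier s (Suc n) (gmonom {1..2 * Suc n}) A = 2 * gmonom {1..2*n} A" for A
  proof -
    have I: "{1..2 * Suc n} = {1..2*n} \<union> {?p, ?q}"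
      by (simp add: atLeastAtMostSuc_conv insert_commute)
    have pq: "?p \<notin> {1..2*n}" "?q \<notin> {1..2*n}" by simp_all
    have 1: "A \<union> {?p, ?q} = {1..2*n} \<union> {?p, ?q} \<longleftrightarrow> A = {1..2*n}" if "?p \<notin> A" "?q \<notin> A"
      using that pq by blast
    have 2: "A \<noteq> {1..2*n}" if "?p \<in> A \<or> ?q \<in> A"
      using that pq by blast
    have 3: "A \<noteq> {1..2*n} \<union> {?p, ?q}" if "?p \<notin> A \<or> ?q \<notin> A"
      using that by blast
    have 4: "A - {?p, ?q} \<noteq> {1..2*n} \<union> {?p, ?q}"
      by blast
    show ?thesis
      unfolding I gmonom_def
      by (cases "?p \<in> A"; cases "?q \<in> A"; simp only: pair_fourier_simps 1 2 3 4 simp_thms if_True if_False; simp)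
  qed
  then have "pair_fourier s (Suc n) (gmonom {1..2 * Suc n}) = (\<lambda>A. 2 * gmonom {1..2*n} A)" ..
  then show ?case
    using Suc by (simp add: grassmann_linear_scale[OF grassmann_linear_grassmann_fourier] mult.assoc del: mult_Suc_right)
qed

lemma berezin_fourier_eq:
  assumes s: "s = 1 \<or> s = - 1" and a: "\<And>A. \<not> A \<subseteq> {1..2*n} \<Longrightarrow> a A = 0"
  shows "berezin_fourier n c (- \<i> * of_real s / 2) a = (\<lambda>B. exp c * grassmann_fourier s n a B)"
proof -
  let ?\<Phi> = "berezin_fourier n c (- \<i> * of_real s / 2)" and ?E = "grassmann_fourier s n"
  note lin = grassmann_linear_berezin_fourier[of n c "- \<i> * of_real s / 2"]
  note linE = grassmann_linear_grassmann_fourier[of s n]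
  \<comment> \<open>Induction on the set \<open>D\<close> of generators removed from the top
    monomial. Each removal is a derivative up to the sign \<open>gsgn\<close>, and both transforms
    turn it into the same multiplication.\<close>
  have monom: "?\<Phi> (gmonom ({1..2*n} - D)) = (\<lambda>B. exp c * ?E (gmonom ({1..2*n} - D)) B)"
    if "finite D" "D \<subseteq> {1..2*n}" for D
    using that
  proof (induction D rule: finite_induct)
    case empty
    show ?case unfolding Diff_empty berezin_fourier_top grassmann_fourier_top by (simp add: mult_ac)
  next
    case (insert l D)
    let ?C = "{1..2*n} - insert l D" and ?C' = "{1..2*n} - D"
    have l: "l \<in> {1..2*n}" using insert.prems by auto
    have "insert l A = ?C' \<longleftrightarrow> A = ?C" if "l \<notin> A" for A
      using that l insert.hyps by auto
    then have C: "gmonom ?C = (\<lambda>A. gsgn l ?C * gderiv l (gmonom ?C') A)"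
      by (auto simp: fun_eq_iff gmonom_def gderiv_altdef)
    have IH: "?\<Phi> (gmonom ?C') = (\<lambda>B. exp c * ?E (gmonom ?C') B)"
      using insert by auto
    show ?case
      unfolding C grassmann_linear_scale[OF lin] grassmann_linear_scale[OF linE]
        berezin_fourier_gderiv[OF l] grassmann_fourier_gderiv[OF s l] IH
        grassmann_linear_scale[OF grassmann_linear_gext]
      by (simp add: mult_ac)
  qed
  have monom': "?\<Phi> (gmonom ({1..2*n} - D)) = (\<lambda>B. exp c * ?E (gmonom ({1..2*n} - D)) B)"
    if "D \<subseteq> {1..2*n}" for D
    using that by (intro monom finite_subset[OF that]) auto
  have a_eq: "a = (\<lambda>A. \<Sum>D\<in>Pow {1..2*n}. a ({1..2*n} - D) * gmonom ({1..2*n} - D) A)"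
  proof
    fix A
    have "(\<Sum>D\<in>Pow {1..2*n}. a ({1..2*n} - D) * gmonom ({1..2*n} - D) A)
        = (\<Sum>C\<in>Pow {1..2*n}. a C * gmonom C A)"
      by (rule sum.reindex_bij_witness[of _ "\<lambda>C. {1..2*n} - C" "\<lambda>C. {1..2*n} - C"]) (auto simp: double_diff)
    also have "\<dots> = a A"
      using a[of A] by (cases "A \<subseteq> {1..2*n}") (auto simp: gmonom_def if_distrib cong: if_cong)
    finally show "a A = (\<Sum>D\<in>Pow {1..2*n}. a ({1..2*n} - D) * gmonom ({1..2*n} - D) A)" ..
  qed
  have "?\<Phi> a = (\<lambda>B. \<Sum>D\<in>Pow {1..2*n}. a ({1..2*n} - D) * ?\<Phi> (gmonom ({1..2*n} - D)) B)"
    by (subst a_eq) (simp only: grassmann_linear_sum[OF lin] grassmann_linear_scale[OF lin])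
  also have "\<dots> = (\<lambda>B. exp c * (\<Sum>D\<in>Pow {1..2*n}. a ({1..2*n} - D) * ?E (gmonom ({1..2*n} - D)) B))"
  proof (rule ext, unfold sum_distrib_left, rule sum.cong[OF refl])
    fix B D assume "D \<in> Pow {1..2*n}"
    then have "?\<Phi> (gmonom ({1..2*n} - D)) B = exp c * ?E (gmonom ({1..2*n} - D)) B"
      by (simp only: Pow_iff monom')
    then show "a ({1..2*n} - D) * ?\<Phi> (gmonom ({1..2*n} - D)) B
        = exp c * (a ({1..2*n} - D) * ?E (gmonom ({1..2*n} - D)) B)"
      by (simp only: mult.left_commute)
  qed
  also have "(\<lambda>B. \<Sum>D\<in>Pow {1..2*n}. a ({1..2*n} - D) * ?E (gmonom ({1..2*n} - D)) B)
      = ?E (\<lambda>A. \<Sum>D\<in>Pow {1..2*n}. a ({1..2*n} - D) * gmonom ({1..2*n} - D) A)"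
    by (simp only: grassmann_linear_sum[OF linE] grassmann_linear_scale[OF linE])
  also note a_eq[symmetric]
  finally show ?thesis .
qed

section \<open>From the auxiliary operators back to the Grassmann product\<close>

definition finitary :: "grassmann \<Rightarrow> bool" where
  "finitary a \<longleftrightarrow> (\<forall>A. infinite A \<longrightarrow> a A = 0)"

lemma finitary_gone: "finitary gone"
  by (auto simp: finitary_def gone_def)

lemma gmult_gext_finitary: "gmult (gext i b) a = gext i (gmult b a)"
proof
  fix C show "gmult (gext i b) a C = gext i (gmult b a) C"
    by (cases "finite C") (simp_all add: gmult_gext, simp add: gext_def gmult_infinite)
qed

text \<open>This is why \<open>finitary\<close> is introduced: \<open>gmult\<close> vanishes on
  infinite sets, so \<open>gone\<close> is a left unit precisely for families that vanish there
  too.\<close>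

lemma gmult_gone_finitary: "finitary a \<Longrightarrow> gmult gone a = a"
proof
  fix C assume "finitary a"
  then show "gmult gone a C = a C"
    by (cases "finite C") (simp_all add: gmult_gone gmult_infinite finitary_def)
qed

lemma pair_flip_eq:
  assumes j: "j \<ge> 1"
  shows "pair_flip j a A = 4 * gderiv (2*j-1) (gderiv (2*j) a) A - gext (2*j-1) (gext (2*j) a) A"
proof -
  define p where "p = 2*j-1"
  have q: "2*j = Suc p" using j by (simp add: p_def)
  have "insert (Suc p) (insert p A) = A \<union> {p, Suc p}" "A - {p} - {Suc p} = A - {p, Suc p}" by auto
  then show ?thesis
    unfolding pair_flip_def p_def[symmetric] q
    by (cases "p \<in> A"; cases "Suc p \<in> A")
      (simp_all add: gderiv_altdef gext_def gsgn_insert gsgn_remove gsgn_Suc)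
qed

lemma ferm_op_eq_pair_sum:
  assumes "finitary a"
  shows "ferm_op n a = pair_sum n 0 a"
proof
  fix A
  have "pair_flip j a A = 4 * gderiv (2*j-1) (gderiv (2*j) a) A
      - gmult (gmult (gvar (2*j-1)) (gvar (2*j))) a A" if "j \<in> {1..n}" for j
    using that by (simp only: pair_flip_eq atLeastAtMost_iff gmult_gvar_gvar gmult_gext_finitary
        gmult_gone_finitary[OF assms])
  then have "(\<Sum>j=1..n. 2 * a A + pair_flip j a A) = (\<Sum>j=1..n. 2 * a A + (4 * gderiv (2*j-1) (gderiv (2*j) a) A
      - gmult (gmult (gvar (2*j-1)) (gvar (2*j))) a A))"
    by (intro sum.cong) auto
  then show "ferm_op n a A = pair_sum n 0 a A"
    by (simp add: ferm_op_def pair_sum_def sum.distrib sum_subtractf sum_distrib_left)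
qed

lemma finitary_pair_sum:
  assumes "finitary a"
  shows "finitary (pair_sum n c a)"
  using assms by (auto simp: finitary_def pair_sum_def pair_flip_def Diff_infinite_finite intro!: sum.neutral)

lemma ferm_exp_eq:
  assumes s: "s = 1 \<or> s = - 1" and a: "finitary a"
  shows "ferm_exp n (s * pi / 4) a = grassmann_fourier s n a"
proof
  fix A
  have fin: "finitary ((pair_sum n 0 ^^ k) a)" for k
    by (induction k) (auto simp: a finitary_pair_sum)
  have "(ferm_op n ^^ k) a = (pair_sum n 0 ^^ k) a" for k
    by (induction k) (simp_all add: ferm_op_eq_pair_sum[OF fin])
  then show "ferm_exp n (s * pi / 4) a A = grassmann_fourier s n a A"
    using pair_sum_exp_sums[OF s refl, of n 0 a A] by (simp add: ferm_exp_def sums_iff)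
qed

lemma finitary_pairing_op:
  assumes "finitary a"
  shows "finitary (pairing_op n c \<kappa> a)"
  using assms by (auto simp: finitary_def pairing_op_def gext_def intro!: sum.neutral)

lemma finitary_pairing_op_funpow: "finitary a \<Longrightarrow> finitary ((pairing_op n c \<kappa> ^^ k) a)"
  by (induction k) (auto simp: finitary_pairing_op)

lemma pairing_op_gmult: "gmult (pairing_op n c \<kappa> b) a = pairing_op n c \<kappa> (gmult b a)"
proof -
  note lin = grassmann_linear_gmult_left[of a]
  show ?thesis
    unfolding pairing_op_def
    by (simp add: grassmann_linear_add[OF lin] grassmann_linear_scale[OF lin] grassmann_linear_sum[OF lin]
        gmult_gext_finitary)
qed

lemma sum_pairs: "(\<Sum>j=1..n. f (2*j-1) + f (2*j)) = (\<Sum>i=1..2*n. f i)" for f :: "nat \<Rightarrow> 'a::comm_monoid_add"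
  by (induction n) (simp_all add: add.assoc)

lemma pairing_eq_pairing_op:
  "(\<lambda>A. - of_real s * \<i> * pairing m n x y A)
     = pairing_op n (\<i> * of_real (s * (\<Sum>i=1..m. x i * y i))) (- \<i> * of_real s / 2) gone"
proof
  fix A
  let ?f = "\<lambda>i. orient i * gext i (gext (2*n + partner i) gone) A"
  have "gmult (gvar (2*j-1)) (gvar (2*n + 2*j)) A - gmult (gvar (2*j)) (gvar (2*n + (2*j-1))) A
      = ?f (2*j-1) + ?f (2*j)" if "j \<in> {1..n}" for j
  proof -
    have "orient (2*j-1) = 1" "partner (2*j-1) = 2*j" "orient (2*j) = -1" "partner (2*j) = 2*j-1"
      using that by (auto simp: orient_def partner_def)
    then show ?thesis by (simp add: gmult_gvar_gvar)
  qed
  then have "(\<Sum>j=1..n. gmult (gvar (2*j-1)) (gvar (2*n + 2*j)) A - gmult (gvar (2*j)) (gvar (2*n + (2*j-1))) A)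
      = (\<Sum>i=1..2*n. ?f i)"
    unfolding sum_pairs[symmetric] by (intro sum.cong) auto
  then show "- of_real s * \<i> * pairing m n x y A
     = pairing_op n (\<i> * of_real (s * (\<Sum>i=1..m. x i * y i))) (- \<i> * of_real s / 2) gone A"
    unfolding pairing_def pairing_op_def by (simp add: algebra_simps)
qed

text \<open>\<open>pairing_op\<close> commutes with right multiplication, so each power of the
  exponent, multiplied by \<open>a\<close>, is an iterate of the operator on \<open>a\<close>. At a
  finite \<open>C\<close> the product is a finite sum, which can be interchanged with the
  exponential series.\<close>

lemma gmult_gexp_pairing_op:
  assumes a: "finitary a"
  shows "gmult (gexp (pairing_op n c \<kappa> gone)) a = pairing_exp n c \<kappa> a"
proof
  fix C
  let ?T = "pairing_op n c \<kappa>"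
  have "gmult (?T gone) b = ?T b" if "finitary b" for b
    using that by (simp add: pairing_op_gmult gmult_gone_finitary)
  then have pow: "(gmult (?T gone) ^^ k) gone = (?T ^^ k) gone" for k
    by (induction k) (simp_all add: finitary_pairing_op_funpow finitary_gone)
  have mult: "gmult ((?T ^^ k) gone) a = (?T ^^ k) a" for k
    by (induction k) (simp_all add: gmult_gone_finitary a pairing_op_gmult)
  have S: "(\<lambda>k. (?T ^^ k) b A / fact k) sums pairing_exp n c \<kappa> b A" for b A
    unfolding pairing_exp_def by (rule summable_sums[OF pairing_op_summable])
  have "(\<lambda>k. \<Sum>A\<in>Pow C. gsign A (C - A) * ((?T ^^ k) gone A / fact k) * a (C - A)) sums
      gmult (pairing_exp n c \<kappa> gone) a C"
    unfolding gmult_def by (intro sums_sum sums_mult sums_mult2 S)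
  moreover have "(\<Sum>A\<in>Pow C. gsign A (C - A) * ((?T ^^ k) gone A / fact k) * a (C - A))
      = (?T ^^ k) a C / fact k" for k
    unfolding mult[symmetric] by (simp add: gmult_def sum_divide_distrib)
  ultimately have "(\<lambda>k. (?T ^^ k) a C / fact k) sums gmult (pairing_exp n c \<kappa> gone) a C"
    by simp
  with S[of a C] have "gmult (pairing_exp n c \<kappa> gone) a C = pairing_exp n c \<kappa> a C"
    by (rule sums_unique2[symmetric])
  then show "gmult (gexp (?T gone)) a C = pairing_exp n c \<kappa> a C"
    by (simp add: gexp_def pow pairing_exp_def)
qed

lemma berezin_exp_pairing:
  assumes s: "s = 1 \<or> s = - 1" and a: "\<And>A. \<not> A \<subseteq> {1..2*n} \<Longrightarrow> a A = 0"
  shows "of_real ((2 * pi) ^ n) *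
      berezin n (gmult (gexp (\<lambda>A. - of_real s * \<i> * pairing m n x y A)) a) ((+) (2*n) ` B)
    = exp (\<i> * of_real (s * (\<Sum>i=1..m. x i * y i))) * grassmann_fourier s n a B"
proof -
  have "finitary a"
    using a finite_subset[OF _ finite_atLeastAtMost] unfolding finitary_def by blast
  then have g: "gmult (gexp (\<lambda>A. - of_real s * \<i> * pairing m n x y A)) a
      = pairing_exp n (\<i> * of_real (s * (\<Sum>i=1..m. x i * y i))) (- \<i> * of_real s / 2) a"
    unfolding pairing_eq_pairing_op by (rule gmult_gexp_pairing_op)
  have "of_real ((2 * pi) ^ n) * (z / of_real (pi ^ n)) = 2 ^ n * z" for z :: complex
    by (simp add: power_mult_distrib)
  moreover have "berezin_fourier n (\<i> * of_real (s * (\<Sum>i=1..m. x i * y i))) (- \<i> * of_real s / 2) a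
      = (\<lambda>B. exp (\<i> * of_real (s * (\<Sum>i=1..m. x i * y i))) * grassmann_fourier s n a B)"
    by (rule berezin_fourier_eq[OF s]) (rule a)
  ultimately show ?thesis
    unfolding g berezin_def by (simp only: berezin_fourier_def fun_eq_iff)
qed

section \<open>Schwartz functions\<close>

lemma smooth_has_vector_derivative:
  assumes "smooth m \<phi>" "is \<in> lists {1..m}" "i \<in> {1..m}"
  shows "((\<lambda>t. fold pdiff is \<phi> (x(i := t))) has_vector_derivative
    pdiff i (fold pdiff is \<phi>) (x(i := u))) (at u)"
proof -
  have "(\<lambda>t. fold pdiff is \<phi> ((x(i := u))(i := t))) differentiable (at ((x(i := u)) i))"
    using assms unfolding smooth_def by blast
  then show ?thesis
    by (simp add: pdiff_def vector_derivative_works)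
qed

text \<open>The Leibniz rule: the commutator of an iterated derivative with a coordinate is a sum of
  iterated derivatives of \<open>\<phi>\<close>. Which ones occur is immaterial for the Schwartz
  estimates, hence the bare list \<open>L\<close>.\<close>

lemma fold_pdiff_coord:
  assumes \<phi>: "smooth m \<phi>" and "is \<in> lists {1..m}"
  shows "\<exists>L. set L \<subseteq> lists {1..m} \<and> fold pdiff is (\<lambda>x. of_real (x i) * \<phi> x)
      = (\<lambda>x. of_real (x i) * fold pdiff is \<phi> x + (\<Sum>l\<leftarrow>L. fold pdiff l \<phi> x))"
  using assms(2)
proof (induction "is" rule: rev_induct)
  case Nil
  show ?case by (rule exI[of _ "[]"]) simp
next
  case (snoc j js)
  then have js: "js \<in> lists {1..m}" and j: "j \<in> {1..m}" by auto
  then obtain L where L: "set L \<subseteq> lists {1..m}"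
    and eq: "fold pdiff js (\<lambda>x. of_real (x i) * \<phi> x)
      = (\<lambda>x. of_real (x i) * fold pdiff js \<phi> x + (\<Sum>l\<leftarrow>L. fold pdiff l \<phi> x))"
    using snoc.IH by blast
  let ?L = "(if i = j then [js] else []) @ map (\<lambda>l. l @ [j]) L"
  have "pdiff j (\<lambda>x. of_real (x i) * fold pdiff js \<phi> x + (\<Sum>l\<leftarrow>L. fold pdiff l \<phi> x)) x
      = of_real (x i) * pdiff j (fold pdiff js \<phi>) x + (\<Sum>l\<leftarrow>?L. fold pdiff l \<phi> x)" for x
  proof -
    have d: "((\<lambda>t. fold pdiff l \<phi> (x(j := t))) has_vector_derivative pdiff j (fold pdiff l \<phi>) x) (at (x j))"
      if "l \<in> lists {1..m}" for l
      using smooth_has_vector_derivative[OF \<phi> that j, of x "x j"] by simp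
    have 1: "((\<lambda>t. of_real ((x(j := t)) i) :: complex) has_vector_derivative (if i = j then 1 else 0)) (at (x j))"
      by (auto intro!: derivative_eq_intros)
    have 2: "((\<lambda>t. \<Sum>l\<leftarrow>K. fold pdiff l \<phi> (x(j := t))) has_vector_derivative
        (\<Sum>l\<leftarrow>K. fold pdiff (l @ [j]) \<phi> x)) (at (x j))" if "set K \<subseteq> lists {1..m}" for K
      using that by (induction K) (auto intro!: has_vector_derivative_add d)
    have "((\<lambda>t. of_real ((x(j := t)) i) * fold pdiff js \<phi> (x(j := t)) + (\<Sum>l\<leftarrow>L. fold pdiff l \<phi> (x(j := t))))
        has_vector_derivative
        (of_real ((x(j := x j)) i) * pdiff j (fold pdiff js \<phi>) x + (if i = j then 1 else 0) * fold pdiff js \<phi> (x(j := x j))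
          + (\<Sum>l\<leftarrow>L. fold pdiff (l @ [j]) \<phi> x))) (at (x j))"
      by (intro has_vector_derivative_add has_vector_derivative_mult 1 2 d L js)
    from vector_derivative_at[OF this] show ?thesis
      unfolding pdiff_def[of j "\<lambda>x. _ x + _ x"] by (simp add: comp_def)
  qed
  then have "fold pdiff (js @ [j]) (\<lambda>x. of_real (x i) * \<phi> x)
      = (\<lambda>x. of_real (x i) * fold pdiff (js @ [j]) \<phi> x + (\<Sum>l\<leftarrow>?L. fold pdiff l \<phi> x))"
    unfolding fold_append comp_apply eq fold.simps id_apply by (rule ext)
  moreover have "set ?L \<subseteq> lists {1..m}"
  proof
    fix l assume "l \<in> set ?L"
    then consider "l = js" | l' where "l' \<in> set L" "l = l' @ [j]" by (auto split: if_splits)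
    then show "l \<in> lists {1..m}"
    proof cases
      case (2 l')
      then show ?thesis
        using subsetD[OF L 2(1)] j by (simp only: append_in_lists_conv Cons_in_lists_iff lists.Nil simp_thms)
    qed (simp only: js)
  qed
  ultimately show ?case by blast
qed

lemma schwartz_bound:
  assumes "\<phi> \<in> schwartz m" "is \<in> lists {1..m}"
  shows "\<exists>B. \<forall>x. norm (of_real (\<Prod>i=1..m. x i ^ \<alpha> i) * fold pdiff is \<phi> x) \<le> B"
  using assms unfolding schwartz_def by blast

lemma schwartz_coord:
  assumes \<phi>: "\<phi> \<in> schwartz m" and i: "i \<in> {1..m}"
  shows "(\<lambda>x. of_real (x i) * \<phi> x) \<in> schwartz m"
proof -
  have sm: "smooth m \<phi>" and dep: "depends_on_coords m \<phi>" using \<phi> by (auto simp: schwartz_def)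
  have "depends_on_coords m (\<lambda>x. of_real (x i) * \<phi> x)"
    using dep i unfolding depends_on_coords_def by metis
  moreover have "smooth m (\<lambda>x. of_real (x i) * \<phi> x)"
    unfolding smooth_def
  proof (intro ballI conjI allI)
    fix "is" assume is_in: "is \<in> lists {1..m}"
    obtain L where L: "set L \<subseteq> lists {1..m}" and eq: "fold pdiff is (\<lambda>x. of_real (x i) * \<phi> x)
      = (\<lambda>x. of_real (x i) * fold pdiff is \<phi> x + (\<Sum>l\<leftarrow>L. fold pdiff l \<phi> x))"
      using fold_pdiff_coord[OF sm is_in] by blast
    have c: "continuous_on UNIV (fold pdiff l \<phi>)" if "l \<in> lists {1..m}" for l
      using sm that unfolding smooth_def by blast
    have "continuous_on UNIV (\<lambda>x. \<Sum>l\<leftarrow>K. fold pdiff l \<phi> x)" if "set K \<subseteq> lists {1..m}" for K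
      using that by (induction K) (auto intro!: continuous_intros c)
    moreover have "continuous_on UNIV (\<lambda>x::nat \<Rightarrow> real. of_real (x i) :: complex)"
      by (intro continuous_intros continuous_on_product_coordinates)
    ultimately show "continuous_on UNIV (fold pdiff is (\<lambda>x. of_real (x i) * \<phi> x))"
      unfolding eq using L is_in by (intro continuous_on_add continuous_on_mult c)
    fix j x assume j: "j \<in> {1..m}"
    have d: "(\<lambda>t. fold pdiff l \<phi> (x(j := t))) differentiable (at (x j))" if "l \<in> lists {1..m}" for l
      using sm that j unfolding smooth_def by blast
    have "(\<lambda>t. \<Sum>l\<leftarrow>K. fold pdiff l \<phi> (x(j := t))) differentiable (at (x j))" if "set K \<subseteq> lists {1..m}" for K
      using that by (induction K) (auto intro!: differentiable_add d)
    moreover have "(\<lambda>t. of_real ((x(j := t)) i) :: complex) differentiable (at (x j))"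
    proof (rule differentiableI_vector)
      show "((\<lambda>t. of_real ((x(j := t)) i) :: complex) has_vector_derivative (if i = j then 1 else 0)) (at (x j))"
        by (auto intro!: derivative_eq_intros)
    qed
    ultimately show "(\<lambda>t. fold pdiff is (\<lambda>x. of_real (x i) * \<phi> x) (x(j := t))) differentiable (at (x j))"
      unfolding eq using L is_in by (intro differentiable_add differentiable_mult d)
  qed
  moreover have "\<exists>B. \<forall>x. norm (of_real (\<Prod>i=1..m. x i ^ \<alpha> i) * fold pdiff is (\<lambda>x. of_real (x i) * \<phi> x) x) \<le> B"
    if is_in: "is \<in> lists {1..m}" for \<alpha> :: "nat \<Rightarrow> nat" and "is"
  proof -
    obtain L where L: "set L \<subseteq> lists {1..m}" and eq: "fold pdiff is (\<lambda>x. of_real (x i) * \<phi> x)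
      = (\<lambda>x. of_real (x i) * fold pdiff is \<phi> x + (\<Sum>l\<leftarrow>L. fold pdiff l \<phi> x))"
      using fold_pdiff_coord[OF sm is_in] by blast
    let ?p = "\<lambda>\<alpha> x. of_real (\<Prod>i=1..m. x i ^ \<alpha> i) :: complex"
    have p: "?p \<alpha> x * of_real (x i) = ?p (\<alpha>(i := Suc (\<alpha> i))) x" for x
    proof -
      have "(\<Prod>k=1..m. x k ^ (\<alpha>(i := Suc (\<alpha> i))) k) = x i ^ Suc (\<alpha> i) * (\<Prod>k\<in>{1..m}-{i}. x k ^ (\<alpha>(i := Suc (\<alpha> i))) k)"
        using i by (subst prod.remove[of _ i]) auto
      also have "(\<Prod>k\<in>{1..m}-{i}. x k ^ (\<alpha>(i := Suc (\<alpha> i))) k) = (\<Prod>k\<in>{1..m}-{i}. x k ^ \<alpha> k)"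
        by (intro prod.cong) auto
      also have "x i ^ Suc (\<alpha> i) * \<dots> = x i * (\<Prod>k=1..m. x k ^ \<alpha> k)"
        using i by (subst (2) prod.remove[of _ i]) auto
      finally show ?thesis by (metis mult.commute of_real_mult)
    qed
    obtain B1 where B1: "norm (?p (\<alpha>(i := Suc (\<alpha> i))) x * fold pdiff is \<phi> x) \<le> B1" for x
      using schwartz_bound[OF \<phi> is_in] by blast
    have "\<exists>B. \<forall>x. norm (?p \<alpha> x * (\<Sum>l\<leftarrow>K. fold pdiff l \<phi> x)) \<le> B" if "set K \<subseteq> lists {1..m}" for K
      using that
    proof (induction K)
      case (Cons l K)
      obtain B where B: "\<And>x. norm (?p \<alpha> x * (\<Sum>l\<leftarrow>K. fold pdiff l \<phi> x)) \<le> B" using Cons by auto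
      obtain B' where B': "\<And>x. norm (?p \<alpha> x * fold pdiff l \<phi> x) \<le> B'"
        using schwartz_bound[OF \<phi>, of l \<alpha>] Cons.prems by auto
      have "norm (?p \<alpha> x * (\<Sum>l\<leftarrow>l # K. fold pdiff l \<phi> x)) \<le> B' + B" for x
        using norm_triangle_mono[OF B' B] by (simp add: distrib_left)
      then show ?case by blast
    qed auto
    then obtain B2 where B2: "norm (?p \<alpha> x * (\<Sum>l\<leftarrow>L. fold pdiff l \<phi> x)) \<le> B2" for x
      using L by blast
    have "norm (?p \<alpha> x * fold pdiff is (\<lambda>x. of_real (x i) * \<phi> x) x) \<le> B1 + B2" for x
      using norm_triangle_mono[OF B1 B2, of x x] unfolding eq distrib_left mult.assoc[symmetric] p .
    then show ?thesis by blast
  qed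
  ultimately show ?thesis unfolding schwartz_def by blast
qed

lemma depends_on_coords_pdiff:
  assumes "depends_on_coords m \<phi>"
  shows "depends_on_coords m (pdiff i \<phi>)"
  unfolding depends_on_coords_def
proof (intro allI impI)
  fix x y :: "nat \<Rightarrow> real" assume xy: "\<forall>j\<in>{1..m}. x j = y j"
  show "pdiff i \<phi> x = pdiff i \<phi> y"
  proof (cases "i \<in> {1..m}")
    case True
    have "\<phi> (x(i := t)) = \<phi> (y(i := t))" for t
      using assms xy unfolding depends_on_coords_def by auto
    then show ?thesis using xy True by (simp add: pdiff_def)
  next
    case False
    then have "\<phi> (z(i := t)) = \<phi> z" for z t
      using assms unfolding depends_on_coords_def by auto
    then show ?thesis by (simp add: pdiff_def)
  qed
qed

lemma schwartz_pdiff: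
  assumes \<phi>: "\<phi> \<in> schwartz m" and i: "i \<in> {1..m}"
  shows "pdiff i \<phi> \<in> schwartz m"
proof -
  have f: "fold pdiff is (pdiff i \<phi>) = fold pdiff (i # is) \<phi>" for "is" by simp
  have "i # is \<in> lists {1..m}" if "is \<in> lists {1..m}" for "is" using that i by auto
  then show ?thesis
    using \<phi> depends_on_coords_pdiff[of m \<phi> i] unfolding schwartz_def smooth_def mem_Collect_eq f by blast
qed

text \<open>The oscillator in one coordinate. It keeps the function in the Schwartz space and
  multiplies its Hermite coefficients by \<open>2 k_i + 1\<close>, so its iterates will yield their
  decay.\<close>

lemma schwartz_oscillator:
  assumes "\<phi> \<in> schwartz m" "i \<in> {1..m}"
  shows "(\<lambda>x. - pdiff i (pdiff i \<phi>) x + of_real ((x i)\<^sup>2) * \<phi> x) \<in> schwartz m"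
  using schwartz_lincomb[OF schwartz_pdiff[OF schwartz_pdiff[OF assms] assms(2)]
      schwartz_coord[OF schwartz_coord[OF assms] assms(2)], of "-1" 1]
  by (simp add: power2_eq_square mult.assoc)

lemma schwartz_weight:
  assumes "\<phi> \<in> schwartz m" "S \<subseteq> {1..m}"
  shows "(\<lambda>x. of_real (\<Prod>i\<in>S. 1 + (x i)\<^sup>2) * \<phi> x) \<in> schwartz m"
proof -
  have "finite S" using assms(2) by (rule finite_subset) auto
  then show ?thesis using assms(2)
  proof (induction S rule: finite_induct)
    case (insert i S)
    let ?\<psi> = "\<lambda>x. of_real (\<Prod>i\<in>S. 1 + (x i)\<^sup>2) * \<phi> x"
    have "?\<psi> \<in> schwartz m" "i \<in> {1..m}" using insert by auto
    from schwartz_lincomb[OF this(1) schwartz_coord[OF schwartz_coord[OF this] this(2)], of 1 1]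
    show ?case using insert.hyps by (simp add: power2_eq_square algebra_simps)
  qed (simp add: assms)
qed

text \<open>A majorant that is a product of integrable functions of one variable. With all
  coordinates it gives integrability on the whole space, with a single one it controls the
  coordinate lines.\<close>

lemma schwartz_decay:
  assumes "\<phi> \<in> schwartz m" "S \<subseteq> {1..m}"
  obtains B where "\<And>x. norm (\<phi> x) \<le> B * (\<Prod>i\<in>S. inverse (1 + (x i)\<^sup>2))"
proof -
  obtain B where B: "norm (of_real (\<Prod>i\<in>S. 1 + (x i)\<^sup>2) * \<phi> x) \<le> B" for x
    using schwartz_bound[OF schwartz_weight[OF assms], of "[]" "\<lambda>_. 0"] by auto
  show thesis
  proof (rule that)
    fix x :: "nat \<Rightarrow> real"
    have pos: "(\<Prod>i\<in>S. 1 + (x i)\<^sup>2) > 0"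
      by (intro prod_pos) (simp add: add_pos_nonneg)
    then have "(\<Prod>i\<in>S. 1 + (x i)\<^sup>2) * norm (\<phi> x) \<le> B"
      using B[of x] by (simp only: norm_mult norm_of_real abs_of_pos)
    then show "norm (\<phi> x) \<le> B * (\<Prod>i\<in>S. inverse (1 + (x i)\<^sup>2))"
      using pos unfolding prod_inversef[unfolded comp_def]
      by (simp only: divide_inverse[symmetric] pos_le_divide_eq mult.commute)
  qed
qed

lemma integrable_inverse_square: "integrable lborel (\<lambda>t::real. inverse (1 + t\<^sup>2))"
  using integrable_inverse_1_plus_square by (simp add: set_integrable_def einterval_def)

abbreviation lborel_pow :: "nat \<Rightarrow> (nat \<Rightarrow> real) measure" where
  "lborel_pow m \<equiv> PiM {1..m} (\<lambda>_. lborel)"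

text \<open>The product measure lives on functions that are \<open>undefined\<close> outside
  \<open>{1..m}\<close>, while continuity refers to all coordinates. The inclusion is measurable
  because the remaining coordinates are constant.\<close>

lemma continuous_imp_measurable_pow:
  fixes f :: "(nat \<Rightarrow> real) \<Rightarrow> complex"
  assumes "continuous_on UNIV f"
  shows "f \<in> borel_measurable (lborel_pow m)"
proof -
  have "(\<lambda>x. x) \<in> measurable (lborel_pow m) (PiM UNIV (\<lambda>_. borel))"
  proof (rule measurable_PiM_single')
    fix i :: nat
    show "(\<lambda>x. x i) \<in> measurable (lborel_pow m) borel"
    proof (cases "i \<in> {1..m}")
      case True
      then have "(\<lambda>x. x i) \<in> measurable (lborel_pow m) lborel" by (rule measurable_component_singleton)
      then show ?thesis by simp
    next
      case False
      have "(\<lambda>x. undefined) \<in> measurable (lborel_pow m) borel" by simp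
      then show ?thesis
        by (rule measurable_cong[THEN iffD1, rotated]) (use False in \<open>auto simp: space_PiM PiE_def extensional_def\<close>)
    qed
  qed auto
  then have "(\<lambda>x. x) \<in> measurable (lborel_pow m) (borel :: (nat \<Rightarrow> real) measure)"
    using measurable_cong_sets[OF refl sets_PiM_equal_borel] by blast
  then show ?thesis
    using measurable_compose[OF _ borel_measurable_continuous_onI[OF assms]] by blast
qed

lemma schwartz_continuous: "\<phi> \<in> schwartz m \<Longrightarrow> continuous_on UNIV \<phi>"
  unfolding schwartz_def smooth_def by (metis (mono_tags, lifting) fold_simps(1) lists.Nil mem_Collect_eq)

lemma schwartz_measurable: "\<phi> \<in> schwartz m \<Longrightarrow> \<phi> \<in> borel_measurable (lborel_pow m)"
  by (intro continuous_imp_measurable_pow schwartz_continuous)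

lemma schwartz_integrable:
  assumes "\<phi> \<in> schwartz m"
  shows "integrable (lborel_pow m) \<phi>"
proof -
  interpret product_sigma_finite "\<lambda>_::nat. lborel :: real measure" by standard
  obtain B where B: "\<And>x. norm (\<phi> x) \<le> B * (\<Prod>i=1..m. inverse (1 + (x i)\<^sup>2))"
    using schwartz_decay[OF assms order.refl] by blast
  have "integrable (lborel_pow m) (\<lambda>x. B * (\<Prod>i=1..m. inverse (1 + (x i)\<^sup>2)))"
    by (intro integrable_mult_right product_integrable_prod integrable_inverse_square) auto
  then show ?thesis
    by (rule Bochner_Integration.integrable_bound[OF _ schwartz_measurable[OF assms]])
      (intro AE_I2, rule order.trans[OF B], simp)
qed

lemma schwartz_line:
  assumes \<phi>: "\<phi> \<in> schwartz m" and i: "i \<in> {1..m}"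
  shows "((\<lambda>t. \<phi> (x(i := t))) has_vector_derivative pdiff i \<phi> (x(i := t))) (at t)"
    and "isCont (\<lambda>t. \<phi> (x(i := t))) t"
    and "integrable lborel (\<lambda>t. \<phi> (x(i := t)))"
    and "((\<lambda>t. \<phi> (x(i := t))) \<longlongrightarrow> 0) at_top" "((\<lambda>t. \<phi> (x(i := t))) \<longlongrightarrow> 0) at_bot"
proof -
  show d: "((\<lambda>t. \<phi> (x(i := t))) has_vector_derivative pdiff i \<phi> (x(i := t))) (at t)" for t
    using smooth_has_vector_derivative[of m \<phi> "[]" i x t] \<phi> i by (simp add: schwartz_def)
  show c: "isCont (\<lambda>t. \<phi> (x(i := t))) t" for t
    using has_vector_derivative_continuous[OF d] .
  obtain B where B: "norm (\<phi> x) \<le> B * inverse (1 + (x i)\<^sup>2)" for x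
    using schwartz_decay[OF \<phi>, of "{i}"] i by auto
  have B': "norm (\<phi> (x(i := t))) \<le> B * inverse (1 + t\<^sup>2)" for t
    using B[of "x(i := t)"] by simp
  have m: "(\<lambda>t. \<phi> (x(i := t))) \<in> borel_measurable lborel"
    using c by (simp add: borel_measurable_continuous_onI continuous_at_imp_continuous_on)
  show "integrable lborel (\<lambda>t. \<phi> (x(i := t)))"
    by (rule Bochner_Integration.integrable_bound[OF integrable_mult_right[OF integrable_inverse_square, of B] m])
      (auto intro!: AE_I2 intro: order.trans[OF B'])
  have "((\<lambda>t::real. B * inverse (1 + t\<^sup>2)) \<longlongrightarrow> 0) at_top" "((\<lambda>t::real. B * inverse (1 + t\<^sup>2)) \<longlongrightarrow> 0) at_bot"
    by real_asymp+
  then show "((\<lambda>t. \<phi> (x(i := t))) \<longlongrightarrow> 0) at_top" "((\<lambda>t. \<phi> (x(i := t))) \<longlongrightarrow> 0) at_bot"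
    by (auto intro: Lim_null_comparison[rotated] simp: B')
qed

section \<open>Hermite expansions\<close>

no_notation Infinite_Sum.abs_summable_on (infixr "abs'_summable'_on" 46)

lemma hermite_gauss_bounded: "\<exists>C. \<forall>t. \<bar>poly (hermite k) t * exp (- t\<^sup>2 / 2)\<bar> \<le> C"
proof -
  define N where "N = sqrt (2 ^ k * fact k * sqrt pi)"
  have N: "N > 0" by (simp add: N_def)
  have "\<bar>poly (hermite k) t * exp (- t\<^sup>2 / 2)\<bar> \<le> N * (2 * (real k + 1))" for t
  proof -
    have "poly (hermite k) t * exp (- t\<^sup>2 / 2) = N * hermite_fun1 k t"
      using N by (simp add: hermite_fun1_def N_def[symmetric])
    then have "\<bar>poly (hermite k) t * exp (- t\<^sup>2 / 2)\<bar> = N * \<bar>hermite_fun1 k t\<bar>"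
      using N by (simp only: abs_mult abs_of_pos)
    also have "\<dots> \<le> N * (2 * (real k + 1))"
      using N by (intro mult_left_mono hermite_fun1_bound) auto
    finally show ?thesis .
  qed
  then show ?thesis by blast
qed

text \<open>Differentiation yields the polynomial \<open>(hermite k)' - t * hermite k\<close>, which
  by the recursion is half of \<open>(hermite k)' - hermite (Suc k)\<close>. Both terms are
  multiples of Hermite polynomials, so the bound on Hermite functions applies.\<close>

lemma hermite_fun1_deriv_bounded:
  assumes h: "\<And>t. (hermite_fun1 k has_real_derivative h t) (at t)"
  shows "\<exists>C. \<forall>t. \<bar>h t\<bar> \<le> C"
proof -
  define c where "c = inverse (sqrt (2 ^ k * fact k * sqrt pi))"
  have e: "hermite_fun1 k = (\<lambda>t. poly (hermite k) t * exp (- t\<^sup>2 / 2) * c)"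
    by (rule ext) (simp only: hermite_fun1_def c_def divide_inverse[of "_ * _"])
  have ht: "h t = poly (pderiv (hermite k) - [:0, 1:] * hermite k) t * exp (- t\<^sup>2 / 2) * c" for t
    using DERIV_unique[OF h[of t]] gauss_poly_deriv[of "hermite k" c t] unfolding e by blast
  have q: "poly (pderiv (hermite k) - [:0, 1:] * hermite k) t
      = poly (pderiv (hermite k)) t / 2 - poly (hermite (Suc k)) t / 2" for t
    by (simp add: field_simps)
  obtain C1 where C1: "\<bar>poly (hermite (Suc k)) t * exp (- t\<^sup>2 / 2)\<bar> \<le> C1" for t
    using hermite_gauss_bounded by blast
  obtain C2 where C2: "\<bar>poly (pderiv (hermite k)) t * exp (- t\<^sup>2 / 2)\<bar> \<le> C2" for t
  proof (cases k)
    case 0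
    then show ?thesis using that[of 0] by (simp add: pderiv_1)
  next
    case (Suc j)
    obtain C where C: "\<bar>poly (hermite j) t * exp (- t\<^sup>2 / 2)\<bar> \<le> C" for t
      using hermite_gauss_bounded by blast
    show ?thesis
    proof (rule that)
      fix t
      have "poly (pderiv (hermite k)) t * exp (- t\<^sup>2 / 2) = (2 * real k) * (poly (hermite j) t * exp (- t\<^sup>2 / 2))"
        unfolding Suc pderiv_hermite_Suc by simp
      then show "\<bar>poly (pderiv (hermite k)) t * exp (- t\<^sup>2 / 2)\<bar> \<le> (2 * real k) * C"
        using mult_left_mono[OF C[of t], of "2 * real k"] by (simp only: abs_mult) simp
    qed
  qed
  have "\<bar>h t\<bar> \<le> (C2 / 2 + C1 / 2) * \<bar>c\<bar>" for t
  proof -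
    have "h t = (poly (pderiv (hermite k)) t * exp (- t\<^sup>2 / 2) / 2 - poly (hermite (Suc k)) t * exp (- t\<^sup>2 / 2) / 2) * c"
      unfolding ht q by (simp add: algebra_simps)
    moreover have "\<bar>poly (pderiv (hermite k)) t * exp (- t\<^sup>2 / 2) / 2 - poly (hermite (Suc k)) t * exp (- t\<^sup>2 / 2) / 2\<bar>
        \<le> C2 / 2 + C1 / 2"
      using C1[of t] C2[of t] by linarith
    ultimately show ?thesis by (simp only: abs_mult mult_right_mono abs_ge_zero)
  qed
  then show ?thesis by blast
qed

text \<open>Symmetry of the oscillator along a coordinate line. The integrand is the derivative of
  the Wronskian expression \<open>h_k' f - h_k f'\<close>, which vanishes at both ends because
  \<open>h_k\<close> and \<open>h_k'\<close> are bounded and \<open>f\<close>, \<open>f'\<close>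
  tend to 0.\<close>

lemma integral_hermite_oscillator_line:
  assumes \<phi>: "\<phi> \<in> schwartz m" and i: "i \<in> {1..m}"
  shows "(\<integral>t. of_real (hermite_fun1 k t) * (- pdiff i (pdiff i \<phi>) (x(i := t)) + of_real (t\<^sup>2) * \<phi> (x(i := t))
      - (2 * of_nat k + 1) * \<phi> (x(i := t))) \<partial>lborel) = 0"
proof -
  obtain h where h: "\<And>t. (hermite_fun1 k has_real_derivative h t) (at t)"
    "\<And>t. (h has_real_derivative (t\<^sup>2 - 2 * of_nat k - 1) * hermite_fun1 k t) (at t)"
    using hermite_fun1_deriv2 by blast
  obtain C where C: "\<bar>h t\<bar> \<le> C" for t using hermite_fun1_deriv_bounded[OF h(1)] by blast
  let ?H = "\<lambda>t. complex_of_real (hermite_fun1 k t)"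
  let ?f = "\<lambda>t. \<phi> (x(i := t))" and ?f' = "\<lambda>t. pdiff i \<phi> (x(i := t))" and ?f'' = "\<lambda>t. pdiff i (pdiff i \<phi>) (x(i := t))"
  let ?F = "\<lambda>t. of_real (h t) * ?f t - ?H t * ?f' t"
  let ?G = "\<lambda>t. ?H t * (- ?f'' t + of_real (t\<^sup>2) * ?f t - (2 * of_nat k + 1) * ?f t)"
  have H: "(?H has_vector_derivative of_real (h t)) (at t)" for t
    using h(1) by (intro has_vector_derivative_of_real) (simp add: has_real_derivative_iff_has_vector_derivative)
  have H': "((\<lambda>t. complex_of_real (h t)) has_vector_derivative of_real ((t\<^sup>2 - 2 * of_nat k - 1) * hermite_fun1 k t)) (at t)" for t
    using h(2) by (intro has_vector_derivative_of_real) (simp add: has_real_derivative_iff_has_vector_derivative)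
  note p1 = schwartz_pdiff[OF \<phi> i]
  note p2 = schwartz_pdiff[OF p1 i]
  define \<psi> where "\<psi> = (\<lambda>x. (- pdiff i (pdiff i \<phi>) x + of_real ((x i)\<^sup>2) * \<phi> x) - (2 * of_nat k + 1) * \<phi> x)"
  have \<psi>: "\<psi> \<in> schwartz m"
    using schwartz_lincomb[OF schwartz_oscillator[OF \<phi> i] \<phi>, of 1 "- (2 * of_nat k + 1)"]
    by (simp only: \<psi>_def mult_1_left mult_minus_left add_uminus_conv_diff)
  have \<psi>_line: "\<psi> (x(i := t)) = - ?f'' t + of_real (t\<^sup>2) * ?f t - (2 * of_nat k + 1) * ?f t" for t
    by (simp add: \<psi>_def)
  have Hb: "norm (?H t) \<le> 2 * (real k + 1)" for t using hermite_fun1_bound by simp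
  have F: "(?F has_vector_derivative ?G t) (at t)" for t
  proof -
    have "(?F has_vector_derivative
      (of_real (h t) * ?f' t + of_real ((t\<^sup>2 - 2 * of_nat k - 1) * hermite_fun1 k t) * ?f t)
      - (?H t * ?f'' t + of_real (h t) * ?f' t)) (at t)"
      by (intro has_vector_derivative_diff has_vector_derivative_mult H H' schwartz_line[OF \<phi> i] schwartz_line[OF p1 i])
    moreover have "(of_real (h t) * ?f' t + of_real ((t\<^sup>2 - 2 * of_nat k - 1) * hermite_fun1 k t) * ?f t)
      - (?H t * ?f'' t + of_real (h t) * ?f' t) = ?G t"
      by (simp add: algebra_simps)
    ultimately show ?thesis by simp
  qed
  have contH: "isCont ?H t" for t using has_vector_derivative_continuous[OF H] .
  have contG: "isCont ?G t" for t
    unfolding \<psi>_line[symmetric] by (intro continuous_mult contH schwartz_line[OF \<psi> i])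
  have intG: "integrable lborel ?G"
    unfolding \<psi>_line[symmetric]
  proof (rule Bochner_Integration.integrable_bound[OF integrable_mult_right[OF integrable_norm[OF schwartz_line(3)[OF \<psi> i, of x]], of "2 * (real k + 1)"]])
    show "(\<lambda>t. ?H t * \<psi> (x(i := t))) \<in> borel_measurable lborel"
      using contG unfolding \<psi>_line[symmetric] by (simp add: borel_measurable_continuous_onI continuous_at_imp_continuous_on)
    show "AE t in lborel. norm (?H t * \<psi> (x(i := t))) \<le> norm (2 * (real k + 1) * norm (\<psi> (x(i := t))))"
      using mult_right_mono[OF Hb norm_ge_zero] by (intro AE_I2) (simp add: norm_mult)
  qed
  have lim: "(?F \<longlongrightarrow> 0) Fl" if "(?f \<longlongrightarrow> 0) Fl" "(?f' \<longlongrightarrow> 0) Fl" for Fl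
  proof -
    have 1: "((\<lambda>t. C * norm (?f t) + 2 * (real k + 1) * norm (?f' t)) \<longlongrightarrow> 0) Fl"
      using that by (auto intro!: tendsto_eq_intros)
    have 2: "norm (?F t) \<le> C * norm (?f t) + 2 * (real k + 1) * norm (?f' t)" for t
      by (rule order.trans[OF norm_triangle_ineq4])
        (unfold norm_mult, intro add_mono mult_right_mono Hb norm_ge_zero, simp add: C)
    show ?thesis by (rule Lim_null_comparison[OF _ 1]) (simp only: 2 eventually_True)
  qed
  have "(LBINT t=-\<infinity>..\<infinity>. ?G t) = 0 - 0"
  proof (rule interval_integral_FTC_integrable[where F = ?F])
    show "set_integrable lborel (einterval (-\<infinity>) \<infinity>) ?G"
      using intG by (simp add: set_integrable_def einterval_def)
    show "((?F \<circ> real_of_ereal) \<longlongrightarrow> 0) (at_right (-\<infinity>))" "((?F \<circ> real_of_ereal) \<longlongrightarrow> 0) (at_left \<infinity>)"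
      unfolding ereal_tendsto_simps1 by (intro lim schwartz_line[OF \<phi> i] schwartz_line[OF p1 i])+
  qed (use F contG in auto)
  then show ?thesis by (simp add: interval_integral_to_infinity_eq interval_lebesgue_integral_def einterval_def set_lebesgue_integral_def)
qed

lemma hermite_fun_bound: "norm (hermite_fun m k x) \<le> (\<Prod>i=1..m. 2 * (real (k i) + 1))"
  unfolding hermite_fun_def norm_of_real abs_prod
  by (intro prod_mono conjI abs_ge_zero hermite_fun1_bound)

lemma hermite_fun1_continuous: "continuous_on A (hermite_fun1 k)"
  unfolding hermite_fun1_def by (intro continuous_intros) auto

lemma hermite_fun1_measurable: "hermite_fun1 k \<in> borel_measurable borel"
  by (intro borel_measurable_continuous_onI hermite_fun1_continuous)

lemma hermite_fun_measurable: "hermite_fun m k \<in> borel_measurable (lborel_pow m)"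
proof -
  have "(\<lambda>x. hermite_fun1 (k i) (x i)) \<in> borel_measurable (lborel_pow m)" if "i \<in> {1..m}" for i
    using measurable_compose[OF measurable_component_singleton[OF that], of "hermite_fun1 (k i)" "\<lambda>_. lborel" borel]
      hermite_fun1_measurable[of "k i"] by simp
  then have "(\<lambda>x. \<Prod>i=1..m. hermite_fun1 (k i) (x i)) \<in> borel_measurable (lborel_pow m)"
    by (rule borel_measurable_prod)
  then show ?thesis
    unfolding hermite_fun_def[abs_def] by (rule measurable_compose[OF _ borel_measurable_of_real]) 
qed

lemma integrable_hermite_fun_mult:
  assumes "\<phi> \<in> schwartz m"
  shows "integrable (lborel_pow m) (\<lambda>x. hermite_fun m k x * \<phi> x)"
proof (rule Bochner_Integration.integrable_bound[OF integrable_mult_right[OF integrable_norm[OF schwartz_integrable[OF assms]],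
        of "\<Prod>i=1..m. 2 * (real (k i) + 1)"]])
  show "(\<lambda>x. hermite_fun m k x * \<phi> x) \<in> borel_measurable (lborel_pow m)"
    by (intro borel_measurable_times hermite_fun_measurable schwartz_measurable assms)
  show "AE x in lborel_pow m. norm (hermite_fun m k x * \<phi> x) \<le> norm ((\<Prod>i=1..m. 2 * (real (k i) + 1)) * norm (\<phi> x))"
    using mult_right_mono[OF hermite_fun_bound norm_ge_zero]
    by (intro AE_I2) (simp add: norm_mult abs_mult abs_of_nonneg[OF prod_nonneg])
qed

text \<open>Integrating first over coordinate \<open>i\<close>, where the other Hermite factors are
  constant, reduces this to the identity on a line.\<close>

lemma hermite_coeff_oscillator:
  assumes \<phi>: "\<phi> \<in> schwartz m" and i: "i \<in> {1..m}"
  shows "hermite_coeff m (\<lambda>x. - pdiff i (pdiff i \<phi>) x + of_real ((x i)\<^sup>2) * \<phi> x) k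
    = (2 * of_nat (k i) + 1) * hermite_coeff m \<phi> k"
proof -
  interpret product_sigma_finite "\<lambda>_::nat. lborel :: real measure" by standard
  let ?\<psi> = "\<lambda>x. - pdiff i (pdiff i \<phi>) x + of_real ((x i)\<^sup>2) * \<phi> x"
  let ?I = "{1..m} - {i}"
  let ?g = "\<lambda>x. hermite_fun m k x * ?\<psi> x - (2 * of_nat (k i) + 1) * (hermite_fun m k x * \<phi> x)"
  have ins: "insert i ?I = {1..m}" using i by auto
  have int: "integrable (lborel_pow m) ?g"
    by (intro Bochner_Integration.integrable_diff integrable_mult_right integrable_hermite_fun_mult schwartz_oscillator \<phi> i)
  have "(\<integral>x. ?g x \<partial>lborel_pow m) = (\<integral>x. \<integral>t. ?g (x(i := t)) \<partial>lborel \<partial>PiM ?I (\<lambda>_. lborel))"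
    using product_integral_insert[of ?I i ?g] int unfolding ins by simp
  also have "\<dots> = 0"
  proof -
    have "(\<integral>t. ?g (x(i := t)) \<partial>lborel) = 0" for x
    proof -
      define P where "P = complex_of_real (\<Prod>j\<in>?I. hermite_fun1 (k j) (x j))"
      have H: "hermite_fun m k (x(i := t)) = P * of_real (hermite_fun1 (k i) t)" for t
      proof -
        have "(\<Prod>j=1..m. hermite_fun1 (k j) ((x(i := t)) j))
            = hermite_fun1 (k i) t * (\<Prod>j\<in>?I. hermite_fun1 (k j) ((x(i := t)) j))"
          using i by (subst prod.remove[of _ i]) auto
        also have "(\<Prod>j\<in>?I. hermite_fun1 (k j) ((x(i := t)) j)) = (\<Prod>j\<in>?I. hermite_fun1 (k j) (x j))"
          by (intro prod.cong) auto
        finally show ?thesis by (simp only: hermite_fun_def P_def of_real_mult mult.commute)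
      qed
      have "?g (x(i := t)) = P * (of_real (hermite_fun1 (k i) t) *
          (- pdiff i (pdiff i \<phi>) (x(i := t)) + of_real (t\<^sup>2) * \<phi> (x(i := t)) - (2 * of_nat (k i) + 1) * \<phi> (x(i := t))))" for t
        unfolding H by (simp add: algebra_simps)
      then have "(\<integral>t. ?g (x(i := t)) \<partial>lborel) = (\<integral>t. P * (of_real (hermite_fun1 (k i) t) *
          (- pdiff i (pdiff i \<phi>) (x(i := t)) + of_real (t\<^sup>2) * \<phi> (x(i := t)) - (2 * of_nat (k i) + 1) * \<phi> (x(i := t)))) \<partial>lborel)"
        by (simp only:)
      also have "\<dots> = 0"
        unfolding integral_mult_right_zero integral_hermite_oscillator_line[OF \<phi> i] by simp
      finally show ?thesis .
    qed
    then show ?thesis by (simp only: integral_zero)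
  qed
  finally have "(\<integral>x. ?g x \<partial>lborel_pow m) = 0" .
  then show ?thesis
    unfolding hermite_coeff_def
    by (simp only: Bochner_Integration.integral_diff[OF integrable_hermite_fun_mult[OF schwartz_oscillator[OF \<phi> i]]
          integrable_mult_right[OF integrable_hermite_fun_mult[OF \<phi>]]] integral_mult_right_zero right_minus_eq)
qed

text \<open>The source of rapid decay: coefficients multiplied by any such power are again
  coefficients of a Schwartz function, hence of at most fixed polynomial growth.\<close>

lemma hermite_coeff_oscillator_power:
  assumes \<phi>: "\<phi> \<in> schwartz m" and S: "S \<subseteq> {1..m}"
  shows "\<exists>\<psi>\<in>schwartz m. \<forall>k. hermite_coeff m \<psi> k = (\<Prod>i\<in>S. (2 * of_nat (k i) + 1) ^ N) * hermite_coeff m \<phi> k"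
proof -
  have one: "\<exists>\<psi>\<in>schwartz m. \<forall>k. hermite_coeff m \<psi> k = (2 * of_nat (k i) + 1) ^ N * hermite_coeff m \<phi> k"
    if \<phi>: "\<phi> \<in> schwartz m" and i: "i \<in> {1..m}" for \<phi> i N
  proof (induction N)
    case 0
    show ?case using \<phi> by auto
  next
    case (Suc N)
    then obtain \<psi> where \<psi>: "\<psi> \<in> schwartz m"
      "\<And>k. hermite_coeff m \<psi> k = (2 * of_nat (k i) + 1) ^ N * hermite_coeff m \<phi> k" by blast
    show ?case
      by (rule bexI[OF _ schwartz_oscillator[OF \<psi>(1) i]])
        (simp only: hermite_coeff_oscillator[OF \<psi>(1) i] \<psi>(2) power_Suc mult.assoc simp_thms)
  qed
  have "finite S" using S by (rule finite_subset) auto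
  then show ?thesis using S
  proof (induction S rule: finite_induct)
    case empty
    show ?case using \<phi> by auto
  next
    case (insert i S)
    then obtain \<psi> where \<psi>: "\<psi> \<in> schwartz m"
      "\<And>k. hermite_coeff m \<psi> k = (\<Prod>i\<in>S. (2 * of_nat (k i) + 1) ^ N) * hermite_coeff m \<phi> k" by blast
    with one[OF \<psi>(1), of i N] insert show ?case by (auto simp: mult.assoc)
  qed
qed

lemma hermite_coeff_bound:
  assumes "\<psi> \<in> schwartz m"
  shows "norm (hermite_coeff m \<psi> k) \<le> (\<Prod>i=1..m. 2 * (real (k i) + 1)) * (\<integral>x. norm (\<psi> x) \<partial>lborel_pow m)"
proof -
  have "norm (hermite_coeff m \<psi> k) \<le> (\<integral>x. norm (hermite_fun m k x * \<psi> x) \<partial>lborel_pow m)"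
    unfolding hermite_coeff_def by (rule integral_norm_bound)
  also have "\<dots> \<le> (\<integral>x. (\<Prod>i=1..m. 2 * (real (k i) + 1)) * norm (\<psi> x) \<partial>lborel_pow m)"
    using assms
    by (intro integral_mono integrable_norm integrable_hermite_fun_mult integrable_mult_right schwartz_integrable)
      (simp_all only: norm_mult mult_right_mono[OF hermite_fun_bound norm_ge_zero])
  finally show ?thesis by simp
qed

lemma hermite_expansion_abs_summable:
  assumes \<phi>: "\<phi> \<in> schwartz m"
  shows "(\<lambda>k. hermite_coeff m \<phi> k * hermite_fun m k y) abs_summable_on (PiE {1..m} (\<lambda>_. UNIV))"
proof -
  \<comment> \<open>Of the four powers in each coordinate, two compensate the factors
    \<open>2 (k_i + 1)\<close> that bound the coefficient of \<open>\<psi>\<close> and the Hermite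
    function at \<open>y\<close>; the other two leave a summable
    \<open>1 / (k_i + 1)^2\<close>.\<close>
  obtain \<psi> where \<psi>: "\<psi> \<in> schwartz m"
    "\<And>k. hermite_coeff m \<psi> k = (\<Prod>i=1..m. (2 * of_nat (k i) + 1) ^ 4) * hermite_coeff m \<phi> k"
    using hermite_coeff_oscillator_power[OF \<phi> order.refl] by blast
  define M where "M = (\<integral>x. norm (\<psi> x) \<partial>lborel_pow m)"
  have M: "M \<ge> 0" by (simp add: M_def)
  have bound: "norm (hermite_coeff m \<phi> k * hermite_fun m k y) \<le> M * (\<Prod>i=1..m. 4 * (1 / (real (k i) + 1)\<^sup>2))" for k
  proof -
    let ?W = "\<Prod>i=1..m. (2 * real (k i) + 1) ^ 4" and ?U = "\<Prod>i=1..m. 2 * (real (k i) + 1)"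
    have W: "?W > 0" by (intro prod_pos) (simp add: add_pos_nonneg)
    have "?W * norm (hermite_coeff m \<phi> k) = norm (hermite_coeff m \<psi> k)"
    proof -
      have "norm ((\<Prod>i=1..m. (2 * of_nat (k i) + 1) ^ 4) :: complex) = ?W"
        unfolding prod_norm[symmetric] norm_power
        by (intro prod.cong refl) (metis (no_types) abs_of_nonneg add_nonneg_nonneg mult_nonneg_nonneg norm_of_real of_nat_0_le_iff of_real_1 of_real_add of_real_mult of_real_numeral of_real_of_nat_eq zero_le_numeral zero_le_one)
      then show ?thesis by (simp only: \<psi>(2) norm_mult)
    qed
    also have "\<dots> \<le> ?U * M" unfolding M_def by (rule hermite_coeff_bound[OF \<psi>(1)])
    finally have "norm (hermite_coeff m \<phi> k) \<le> ?U * M / ?W"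
      using W by (simp only: pos_le_divide_eq mult.commute)
    then have "norm (hermite_coeff m \<phi> k * hermite_fun m k y) \<le> ?U * M / ?W * ?U"
      unfolding norm_mult using W M by (intro mult_mono hermite_fun_bound) (auto intro!: divide_nonneg_pos mult_nonneg_nonneg prod_nonneg)
    also have "\<dots> = M * (\<Prod>i=1..m. 2 * (real (k i) + 1) * (2 * (real (k i) + 1)) / (2 * real (k i) + 1) ^ 4)"
      by (simp add: prod.distrib prod_dividef)
    also have "\<dots> \<le> M * (\<Prod>i=1..m. 4 * (1 / (real (k i) + 1)\<^sup>2))"
    proof (intro mult_left_mono M prod_mono conjI)
      fix i
      define a where "a = real (k i) + 1"
      have a: "a \<ge> 1" by (simp add: a_def)
      have "2 * a * (2 * a) / (2 * real (k i) + 1) ^ 4 \<le> 2 * a * (2 * a) / a ^ 4"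
        using a by (intro divide_left_mono power_mono) (auto simp: a_def)
      also have "\<dots> = 4 * (1 / a\<^sup>2)" using a by (simp add: field_simps power2_eq_square power4_eq_xxxx)
      finally show "2 * (real (k i) + 1) * (2 * (real (k i) + 1)) / (2 * real (k i) + 1) ^ 4 \<le> 4 * (1 / (real (k i) + 1)\<^sup>2)"
        by (simp only: a_def)
    qed auto
    finally show ?thesis .
  qed
  have "summable (\<lambda>j. 1 / (real j + 1)\<^sup>2)"
    using summable_Suc_iff[of "\<lambda>j. inverse ((real j)\<^sup>2)"] inverse_power_summable[of 2, where 'a = real]
    by (simp add: inverse_eq_divide add.commute)
  from summable_mult[OF this, of 4] have "(\<lambda>j::nat. 4 * (1 / (real j + 1)\<^sup>2)) abs_summable_on UNIV"
    by (simp add: abs_summable_on_nat_iff')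
  then have "(\<lambda>k. \<Prod>i=1..m. 4 * (1 / (real (k i) + 1)\<^sup>2)) abs_summable_on (PiE {1..m} (\<lambda>_. UNIV :: nat set))"
    by (intro abs_summable_on_prod_PiE) auto
  then have "(\<lambda>k. M * (\<Prod>i=1..m. 4 * (1 / (real (k i) + 1)\<^sup>2))) abs_summable_on (PiE {1..m} (\<lambda>_. UNIV :: nat set))"
    by (intro abs_summable_on_cmult_right)
  then show ?thesis
    by (rule abs_summable_on_comparison_test') (rule bound)
qed

section \<open>Abel summation of the Hermite expansion\<close>

abbreviation multi_indices :: "nat \<Rightarrow> (nat \<Rightarrow> nat) set" where
  "multi_indices m \<equiv> PiE {1..m} (\<lambda>_. UNIV)"

lemma countable_multi_indices: "countable (multi_indices m)"
  by (intro countable_PiE) auto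

lemma hermite_kernel_imag_measurable:
  assumes "s = 1 \<or> s = - 1"
  shows "(\<lambda>x. hermite_kernel (\<i> * of_real s * of_real r) x y) \<in> borel_measurable borel"
  unfolding hermite_kernel_imag[OF assms] by measurable

lemma measurable_prod_coords:
  fixes f :: "nat \<Rightarrow> real \<Rightarrow> complex"
  assumes "\<And>i. f i \<in> borel_measurable borel"
  shows "(\<lambda>x. \<Prod>i=1..m. f i (x i)) \<in> borel_measurable (lborel_pow m)"
proof (rule borel_measurable_prod)
  fix i assume i: "i \<in> {1..m}"
  show "(\<lambda>x. f i (x i)) \<in> borel_measurable (lborel_pow m)"
    using measurable_compose[OF measurable_component_singleton[OF i], of "f i" "\<lambda>_. lborel" borel] assms by simp
qed

lemma summable_power_mult_square:
  assumes "0 \<le> r" "r < (1::real)"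
  shows "summable (\<lambda>j. r ^ j * (2 * (real j + 1)) ^ 2)"
proof (rule summable_in_conv_radius[where f = "\<lambda>j. (2 * (real j + 1)) ^ 2" and z = r, THEN summable_cong[THEN iffD1, rotated]])
  have "conv_radius (\<lambda>j. (2 * (real j + 1)) ^ 2) = 1"
  proof (rule conv_radius_ratio_limit_nonzero)
    show "(\<lambda>n. norm ((2 * (real n + 1))\<^sup>2) / norm ((2 * (real (Suc n) + 1))\<^sup>2)) \<longlonglongrightarrow> 1"
      by (simp, real_asymp)
  qed auto
  then show "ereal (norm r) < conv_radius (\<lambda>j. (2 * (real j + 1)) ^ 2)" using assms by simp
qed (simp add: mult.commute)

text \<open>For \<open>r < 1\<close> the powers of \<open>r\<close> outweigh the growth of the
  Hermite functions, so sum and integral may be exchanged; the sum is written over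
  \<open>count_space\<close> to make this an instance of Fubini's theorem. The inner sum over
  multi-indices then factors into one-dimensional kernels.\<close>

lemma hermite_coeff_generating:
  assumes s: "s = 1 \<or> s = - 1" and r: "0 \<le> r" "r < 1" and \<phi>: "\<phi> \<in> schwartz m"
  shows "(\<integral>k. (\<i> * of_real s * of_real r) ^ (\<Sum>i=1..m. k i) * (hermite_coeff m \<phi> k * hermite_fun m k y)
        \<partial>count_space (multi_indices m))
    = (\<integral>x. (\<Prod>i=1..m. hermite_kernel (\<i> * of_real s * of_real r) (x i) (y i)) * \<phi> x \<partial>lborel_pow m)"
proof -
  let ?z = "\<i> * of_real s * of_real r :: complex" and ?K = "multi_indices m"
  have z: "norm ?z = r" using s r by (auto simp: norm_mult)
  interpret PS: product_sigma_finite "\<lambda>_::nat. lborel :: real measure" by standard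
  interpret FP: finite_product_sigma_finite "\<lambda>_::nat. lborel :: real measure" "{1..m}" by standard auto
  interpret CS: sigma_finite_measure "count_space ?K"
    by (rule sigma_finite_measure_count_space_countable[OF countable_multi_indices])
  interpret pair_sigma_finite "count_space ?K" "lborel_pow m" ..
  let ?G = "\<lambda>k x. (?z ^ (\<Sum>i=1..m. k i) * hermite_fun m k y) * (hermite_fun m k x * \<phi> x)"
  \<comment> \<open>The square comes from bounding the Hermite function once at \<open>x\<close> and
    once at \<open>y\<close>.\<close>
  let ?w = "\<lambda>k. \<Prod>i=1..m. r ^ k i * (2 * (real (k i) + 1)) ^ 2"
  have w: "(\<lambda>k. ?w k) abs_summable_on ?K"
    by (rule abs_summable_on_prod_PiE)
      (use summable_power_mult_square[OF r] r in \<open>auto simp: abs_summable_on_nat_iff' abs_mult\<close>)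
  have int: "integrable (lborel_pow m) (?G k)" for k
    by (intro integrable_mult_right integrable_hermite_fun_mult \<phi>)
  have G_bound: "norm (?G k x) \<le> ?w k * norm (\<phi> x)" for k x
  proof -
    have "norm (?G k x) = r ^ (\<Sum>i=1..m. k i) * norm (hermite_fun m k y) * (norm (hermite_fun m k x) * norm (\<phi> x))"
      by (simp only: norm_mult[of "?z ^ _ * _"] norm_mult[of "?z ^ _"] norm_mult[of "hermite_fun m k x"] norm_power z)
    also have "\<dots> \<le> (r ^ (\<Sum>i=1..m. k i) * (\<Prod>i=1..m. 2 * (real (k i) + 1)))
        * ((\<Prod>i=1..m. 2 * (real (k i) + 1)) * norm (\<phi> x))"
      using r by (intro mult_mono mult_left_mono mult_right_mono hermite_fun_bound mult_nonneg_nonneg prod_nonneg) auto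
    also have "\<dots> = ?w k * norm (\<phi> x)"
      by (simp add: power_sum prod.distrib power2_eq_square)
    finally show ?thesis .
  qed
  have Fubini: "integrable (count_space ?K \<Otimes>\<^sub>M lborel_pow m) (case_prod ?G)"
  proof (rule Fubini_integrable)
    show "case_prod ?G \<in> borel_measurable (count_space ?K \<Otimes>\<^sub>M lborel_pow m)"
      by (rule measurable_pair_measure_countable1[OF countable_multi_indices])
        (simp only: prod.case borel_measurable_integrable[OF int])
    have "(\<lambda>k. ?w k * (\<integral>x. norm (\<phi> x) \<partial>lborel_pow m)) abs_summable_on ?K"
      by (intro abs_summable_on_cmult_left w)
    then have "(\<lambda>k. \<integral>x. norm (case_prod ?G (k, x)) \<partial>lborel_pow m) abs_summable_on ?K"
    proof (rule abs_summable_on_comparison_test')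
      fix k
      have "(\<integral>x. norm (?G k x) \<partial>lborel_pow m) \<le> (\<integral>x. ?w k * norm (\<phi> x) \<partial>lborel_pow m)"
        by (intro integral_mono integrable_norm int integrable_mult_right schwartz_integrable \<phi> G_bound)
      moreover have "0 \<le> (\<integral>x. norm (?G k x) \<partial>lborel_pow m)"
        by (rule Bochner_Integration.integral_nonneg) (rule norm_ge_zero)
      ultimately show "norm (\<integral>x. norm (case_prod ?G (k, x)) \<partial>lborel_pow m) \<le> ?w k * (\<integral>x. norm (\<phi> x) \<partial>lborel_pow m)"
        by (simp only: prod.case integral_mult_right_zero real_norm_def abs_of_nonneg)
    qed
    then show "integrable (count_space ?K) (\<lambda>k. \<integral>x. norm (case_prod ?G (k, x)) \<partial>lborel_pow m)"
      by (simp only: abs_summable_on_def)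
    show "AE k in count_space ?K. integrable (lborel_pow m) (\<lambda>x. case_prod ?G (k, x))"
      unfolding prod.case by (intro AE_I2 int)
  qed
  have "(\<integral>k. ?z ^ (\<Sum>i=1..m. k i) * (hermite_coeff m \<phi> k * hermite_fun m k y) \<partial>count_space ?K)
      = (\<integral>k. (\<integral>x. ?G k x \<partial>lborel_pow m) \<partial>count_space ?K)"
    unfolding integral_mult_right_zero hermite_coeff_def by (simp only: mult_ac)
  also have "\<dots> = (\<integral>x. (\<integral>k. ?G k x \<partial>count_space ?K) \<partial>lborel_pow m)"
    by (rule Fubini_integral[OF Fubini, symmetric])
  also have "\<dots> = (\<integral>x. (\<Prod>i=1..m. hermite_kernel ?z (x i) (y i)) * \<phi> x \<partial>lborel_pow m)"
  proof (intro Bochner_Integration.integral_cong refl)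
    fix x
    let ?f = "\<lambda>i j. of_real (hermite_fun1 j (x i) * hermite_fun1 j (y i)) * ?z ^ j"
    have f: "?f i abs_summable_on UNIV" for i
    proof (rule abs_summable_on_comparison_test')
      show "(\<lambda>j. r ^ j * (2 * (real j + 1)) ^ 2) abs_summable_on UNIV"
        using summable_power_mult_square[OF r] r by (simp add: abs_summable_on_nat_iff' abs_mult)
      show "norm (?f i j) \<le> r ^ j * (2 * (real j + 1)) ^ 2" for j
      proof -
        have "norm (?f i j) = r ^ j * (\<bar>hermite_fun1 j (x i)\<bar> * \<bar>hermite_fun1 j (y i)\<bar>)"
          unfolding norm_mult[of "of_real _"] norm_power z norm_of_real abs_mult by (rule mult.commute)
        also have "\<dots> \<le> r ^ j * (2 * (real j + 1) * (2 * (real j + 1)))"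
          using r by (intro mult_left_mono mult_mono hermite_fun1_bound) auto
        finally show ?thesis by (simp only: power2_eq_square)
      qed
    qed
    have "(\<integral>k. ?G k x \<partial>count_space ?K) = (\<integral>k. (\<Prod>i=1..m. ?f i (k i)) * \<phi> x \<partial>count_space ?K)"
      unfolding hermite_fun_def of_real_prod by (simp add: prod.distrib power_sum mult_ac)
    also have "\<dots> = infsetsum (\<lambda>k. \<Prod>i=1..m. ?f i (k i)) ?K * \<phi> x"
      unfolding infsetsum_def by (rule integral_mult_left_zero)
    also have "infsetsum (\<lambda>k. \<Prod>i=1..m. ?f i (k i)) ?K = (\<Prod>i=1..m. infsetsum (?f i) UNIV)"
      by (rule infsetsum_prod_PiE) (use f in auto)
    also have "\<dots> = (\<Prod>i=1..m. hermite_kernel ?z (x i) (y i))"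
    proof (rule prod.cong[OF refl])
      fix i
      have "norm ?z < 1" using z r by simp
      then show "infsetsum (?f i) UNIV = hermite_kernel ?z (x i) (y i)"
        using infsetsum_nat'[OF f[of i]] sums_unique[OF hermite_kernel_sums[of ?z "x i" "y i"]] by simp
    qed
    finally show "(\<integral>k. ?G k x \<partial>count_space ?K) = (\<Prod>i=1..m. hermite_kernel ?z (x i) (y i)) * \<phi> x" .
  qed
  finally show ?thesis .
qed

lemma hermite_expansion_fourier:
  assumes s: "s = 1 \<or> s = - 1" and \<phi>: "\<phi> \<in> schwartz m"
  shows "infsetsum (\<lambda>k. (\<i> * of_real s) ^ (\<Sum>i=1..m. k i) * (hermite_coeff m \<phi> k * hermite_fun m k y)) (multi_indices m)
    = (\<integral>x. (\<Prod>i=1..m. of_real (1 / sqrt (2 * pi)) * exp (\<i> * of_real (s * (x i * y i)))) * \<phi> x \<partial>lborel_pow m)"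
proof -
  let ?K = "multi_indices m" and ?z = "\<i> * of_real s :: complex"
  \<comment> \<open>A sequence in \<open>[0, 1)\<close> with limit 1, so that the limit can be taken
    by dominated convergence on both sides.\<close>
  define R where "R j = real j / (real j + 1)" for j
  have R: "R \<longlonglongrightarrow> 1" unfolding R_def by real_asymp
  have R01: "0 \<le> R j" "R j < 1" for j by (simp_all add: R_def)
  have z: "norm ?z = 1" using s by auto
  have zR: "(\<lambda>j. ?z * of_real (R j)) \<longlonglongrightarrow> ?z"
    using tendsto_mult[OF tendsto_const tendsto_of_real[OF R], of ?z] by simp
  let ?a = "\<lambda>k. hermite_coeff m \<phi> k * hermite_fun m k y"
  have a: "integrable (count_space ?K) ?a"
    using hermite_expansion_abs_summable[OF \<phi>, of y] by (simp add: abs_summable_on_def)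
  have "(\<lambda>j. \<integral>k. (?z * of_real (R j)) ^ (\<Sum>i=1..m. k i) * ?a k \<partial>count_space ?K)
      \<longlonglongrightarrow> (\<integral>k. ?z ^ (\<Sum>i=1..m. k i) * ?a k \<partial>count_space ?K)"
  proof (rule integral_dominated_convergence[where w = "\<lambda>k. norm (?a k)"])
    show "AE k in count_space ?K. (\<lambda>j. (?z * of_real (R j)) ^ (\<Sum>i=1..m. k i) * ?a k) \<longlonglongrightarrow> ?z ^ (\<Sum>i=1..m. k i) * ?a k"
      by (intro AE_I2 tendsto_mult[OF tendsto_power[OF zR] tendsto_const])
    show "AE k in count_space ?K. norm ((?z * of_real (R j)) ^ (\<Sum>i=1..m. k i) * ?a k) \<le> norm (?a k)" for j
    proof (intro AE_I2)
      fix k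
      have "norm (?z * of_real (R j)) \<le> 1" unfolding norm_mult[of ?z] z using R01[of j] by simp
      then have "norm ((?z * of_real (R j)) ^ (\<Sum>i=1..m. k i)) \<le> 1" unfolding norm_power by (intro power_le_one) auto
      then show "norm ((?z * of_real (R j)) ^ (\<Sum>i=1..m. k i) * ?a k) \<le> norm (?a k)"
        unfolding norm_mult[of _ "?a k"] by (intro mult_left_le_one_le) auto
    qed
  qed (use a in auto)
  moreover have "(\<lambda>j. \<integral>x. (\<Prod>i=1..m. hermite_kernel (?z * of_real (R j)) (x i) (y i)) * \<phi> x \<partial>lborel_pow m)
      \<longlonglongrightarrow> (\<integral>x. (\<Prod>i=1..m. of_real (1 / sqrt (2 * pi)) * exp (\<i> * of_real (s * (x i * y i)))) * \<phi> x \<partial>lborel_pow m)"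
  proof (rule integral_dominated_convergence[where w = "\<lambda>x. norm (\<phi> x)"])
    show "(\<lambda>x. (\<Prod>i=1..m. of_real (1 / sqrt (2 * pi)) * exp (\<i> * of_real (s * (x i * y i)))) * \<phi> x) \<in> borel_measurable (lborel_pow m)"
      by (intro borel_measurable_times schwartz_measurable \<phi> measurable_prod_coords[where f = "\<lambda>i x. of_real (1 / sqrt (2 * pi)) * exp (\<i> * of_real (s * (x * y i)))"]) measurable
    show "(\<lambda>x. (\<Prod>i=1..m. hermite_kernel (?z * of_real (R j)) (x i) (y i)) * \<phi> x) \<in> borel_measurable (lborel_pow m)" for j
      by (intro borel_measurable_times schwartz_measurable \<phi>
          measurable_prod_coords[where f = "\<lambda>i x. hermite_kernel (?z * of_real (R j)) x (y i)"] hermite_kernel_imag_measurable s)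
    show "integrable (lborel_pow m) (\<lambda>x. norm (\<phi> x))"
      by (intro integrable_norm schwartz_integrable \<phi>)
    show "AE x in lborel_pow m. (\<lambda>j. (\<Prod>i=1..m. hermite_kernel (?z * of_real (R j)) (x i) (y i)) * \<phi> x)
        \<longlonglongrightarrow> (\<Prod>i=1..m. of_real (1 / sqrt (2 * pi)) * exp (\<i> * of_real (s * (x i * y i)))) * \<phi> x"
      by (intro AE_I2 tendsto_mult tendsto_prod tendsto_const hermite_kernel_imag_tendsto[OF s R])
    show "AE x in lborel_pow m. norm ((\<Prod>i=1..m. hermite_kernel (?z * of_real (R j)) (x i) (y i)) * \<phi> x) \<le> norm (\<phi> x)" for j
    proof (intro AE_I2)
      fix x
      have "norm (\<Prod>i=1..m. hermite_kernel (?z * of_real (R j)) (x i) (y i)) \<le> 1"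
        unfolding prod_norm[symmetric]
        by (intro prod_le_1 conjI norm_ge_zero norm_hermite_kernel_imag_le s R01)
      then show "norm ((\<Prod>i=1..m. hermite_kernel (?z * of_real (R j)) (x i) (y i)) * \<phi> x) \<le> norm (\<phi> x)"
        unfolding norm_mult[of _ "\<phi> x"] by (intro mult_left_le_one_le) auto
    qed
  qed
  ultimately show ?thesis
    unfolding infsetsum_def hermite_coeff_generating[OF s R01 \<phi>] by (rule LIMSEQ_unique)
qed

lemma bos_exp_eq_fourier:
  assumes s: "s = 1 \<or> s = - 1" and \<phi>: "\<phi> \<in> schwartz m"
  shows "bos_exp m (s * pi / 4) \<phi> y = of_real ((2 * pi) powr (- real m / 2)) *
    (\<integral>x. exp (\<i> * of_real (s * (\<Sum>i=1..m. x i * y i))) * \<phi> x \<partial>lborel_pow m)"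
proof -
  let ?K = "multi_indices m"
  let ?b = "\<lambda>k. (\<i> * of_real s) ^ (\<Sum>i=1..m. k i) * (hermite_coeff m \<phi> k * hermite_fun m k y)"
  have e: "exp (\<i> * of_real (s * pi / 4) * hermite_eigval m k) = (\<i> * of_real s) ^ (\<Sum>i=1..m. k i)" for k
  proof -
    have "exp (\<i> * of_real (s * pi / 4) * hermite_eigval m k)
        = exp (of_nat (\<Sum>i=1..m. k i) * (\<i> * of_real (s * pi / 4) * 2))"
      by (simp only: hermite_eigval_eq mult_ac)
    then show ?thesis by (simp only: exp_of_nat_mult exp_quarter_turns[OF s])
  qed
  \<comment> \<open>Absolute summability identifies the \<open>infsum\<close> in
    \<open>bos_exp\<close> with the \<open>infsetsum\<close> treated above.\<close>
  have "?b abs_summable_on ?K"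
  proof (rule abs_summable_on_comparison_test[OF hermite_expansion_abs_summable[OF \<phi>, of y]])
    show "norm (?b k) \<le> norm (hermite_coeff m \<phi> k * hermite_fun m k y)" for k
    proof -
      have "norm (\<i> * of_real s) = 1" using s by auto
      then show ?thesis by (simp only: norm_mult[of "(\<i> * of_real s) ^ _"] norm_power power_one mult_1_left order.refl)
    qed
  qed
  then have "bos_exp m (s * pi / 4) \<phi> y = infsetsum ?b ?K"
    unfolding bos_exp_def e by (simp only: infsetsum_infsum mult.assoc)
  also have "\<dots> = (\<integral>x. of_real ((2 * pi) powr (- real m / 2)) *
      (exp (\<i> * of_real (s * (\<Sum>i=1..m. x i * y i))) * \<phi> x) \<partial>lborel_pow m)"
  proof -
    have "(1 / sqrt (2 * pi)) ^ m = (2 * pi) powr (- real m / 2)"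
    proof -
      have "(1 / sqrt (2 * pi)) = (2 * pi) powr (- 1 / 2)"
        by (simp add: powr_minus powr_half_sqrt inverse_eq_divide)
      then show ?thesis by (simp add: powr_realpow[symmetric] powr_powr)
    qed
    moreover have "(\<Prod>i=1..m. exp (\<i> * of_real (s * (x i * y i)))) = exp (\<i> * of_real (s * (\<Sum>i=1..m. x i * y i)))" for x
      by (simp add: exp_sum[symmetric] sum_distrib_left)
    ultimately have "(\<Prod>i=1..m. of_real (1 / sqrt (2 * pi)) * exp (\<i> * of_real (s * (x i * y i)))) * \<phi> x
        = of_real ((2 * pi) powr (- real m / 2)) * (exp (\<i> * of_real (s * (\<Sum>i=1..m. x i * y i))) * \<phi> x)" for x
      unfolding prod.distrib by (simp only: prod_constant card_atLeastAtMost of_real_power[symmetric] mult.assoc diff_Suc_1 Suc_eq_plus1[symmetric])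
    then show ?thesis unfolding hermite_expansion_fourier[OF s \<phi>] by (simp only:)
  qed
  finally show ?thesis by simp
qed

section \<open>The super Fourier transform\<close>

text \<open>Each component of \<open>pair_fourier\<close> is a constant multiple of a single
  component of its argument, so the components remain Schwartz functions and the bosonic result can
  be applied to them.\<close>

lemma schwartz_grassmann_fourier:
  assumes "\<And>A. (\<lambda>x. f x A) \<in> schwartz m"
  shows "(\<lambda>x. grassmann_fourier s n (f x) A) \<in> schwartz m"
  using assms
proof (induction n arbitrary: f A)
  case (Suc n)
  have "(\<lambda>x. pair_fourier s (Suc n) (f x) A) \<in> schwartz m" for A
  proof -
    have c: "(\<lambda>x. z * f x B) \<in> schwartz m" for z B
      using schwartz_lincomb[OF Suc.prems Suc.prems, of z B 0 B] by simp
    have "\<exists>z B. \<forall>x. pair_fourier s (Suc n) (f x) A = z * f x B"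
    proof -
      consider "2 * Suc n - 1 \<in> A" "2 * Suc n \<in> A" | "2 * Suc n - 1 \<notin> A" "2 * Suc n \<notin> A"
        | "2 * Suc n - 1 \<in> A" "2 * Suc n \<notin> A" | "2 * Suc n - 1 \<notin> A" "2 * Suc n \<in> A" by blast
      then show ?thesis
      proof cases
        case 1
        show ?thesis by (intro exI[of _ "1/2"] exI[of _ "A - {2 * Suc n - 1, 2 * Suc n}"]) (simp only: pair_fourier_simps(1)[OF 1], simp)
      next
        case 2
        show ?thesis by (intro exI[of _ 2] exI[of _ "A \<union> {2 * Suc n - 1, 2 * Suc n}"]) (simp only: pair_fourier_simps(2)[OF 2], simp)
      next
        case 3
        show ?thesis by (intro exI[of _ "\<i> * of_real s"] exI[of _ A]) (simp only: pair_fourier_simps(3)[OF 3], simp)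
      next
        case 4
        show ?thesis by (intro exI[of _ "\<i> * of_real s"] exI[of _ A]) (simp only: pair_fourier_simps(4)[OF 4], simp)
      qed
    qed
    then show ?thesis using c by (metis (no_types, lifting) ext)
  qed
  then show ?case using Suc.IH[of "\<lambda>x. pair_fourier s (Suc n) (f x)"] by simp
qed simp

lemma fourier_scalar_eq_super_exp_scalar:
  assumes s: "s = 1 \<or> s = - 1" and f: "f \<in> schwartz_grassmann m n"
  shows "fourier_scalar m n s f = super_exp_scalar m n (s * pi / 4) f"
proof (intro ext)
  fix y B
  have sch: "(\<lambda>x. f x A) \<in> schwartz m" for A using f by (simp add: schwartz_grassmann_def)
  have supp: "f x A = 0" if "\<not> A \<subseteq> {1..2*n}" for x A
    using f that unfolding schwartz_grassmann_def by (metis (mono_tags, lifting) mem_Collect_eq)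
  have fin: "finitary (f x)" for x
    using supp finite_subset[OF _ finite_atLeastAtMost] unfolding finitary_def by blast
  \<comment> \<open>Since \<open>- M / 2 = - m / 2 + n\<close>, a factor \<open>(2 pi)^n\<close> is
    available for the Berezin integral.\<close>
  have p: "(2 * pi) powr (- of_int (superdim m n) / 2) = (2 * pi) powr (- real m / 2) * (2 * pi) ^ n"
  proof -
    have "- of_int (superdim m n) / 2 = - real m / 2 + real n" by (simp add: superdim_def field_simps)
    then show ?thesis by (simp only: powr_add) (simp add: powr_realpow)
  qed
  let ?C = "of_real ((2 * pi) powr (- real m / 2)) :: complex"
  have "fourier_scalar m n s f y B = ?C * (of_real ((2 * pi) ^ n) *
      (\<integral>x. berezin n (gmult (gexp (\<lambda>A. - of_real s * \<i> * pairing m n x y A)) (f x)) ((+) (2 * n) ` B) \<partial>lborel_pow m))"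
    unfolding fourier_scalar_def p by (simp only: of_real_mult mult.assoc)
  also have "\<dots> = ?C * (\<integral>x. exp (\<i> * of_real (s * (\<Sum>i=1..m. x i * y i))) * grassmann_fourier s n (f x) B \<partial>lborel_pow m)"
  proof -
    have "of_real ((2 * pi) ^ n) *
        berezin n (gmult (gexp (\<lambda>A. - of_real s * \<i> * pairing m n x y A)) (f x)) ((+) (2*n) ` B)
      = exp (\<i> * of_real (s * (\<Sum>i=1..m. x i * y i))) * grassmann_fourier s n (f x) B" for x
      by (rule berezin_exp_pairing[OF s]) (rule supp)
    then show ?thesis unfolding integral_mult_right_zero[symmetric] by (simp only:)
  qed
  also have "\<dots> = bos_exp m (s * pi / 4) (\<lambda>x. grassmann_fourier s n (f x) B) y"
    by (rule bos_exp_eq_fourier[OF s schwartz_grassmann_fourier[OF sch], symmetric])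
  also have "\<dots> = super_exp_scalar m n (s * pi / 4) f y B"
    by (simp only: super_exp_scalar_def ferm_exp_eq[OF s fin])
  finally show "fourier_scalar m n s f y B = super_exp_scalar m n (s * pi / 4) f y B" .
qed

text \<open>\<open>tensor_id\<close> sees its operator only on the components of admissible
  decompositions. Operators that agree on \<open>schwartz_grassmann\<close> thus give the same
  predicate under the definite description.\<close>

lemma tensor_id_cong:
  assumes "\<And>\<phi>. \<phi> \<in> schwartz_grassmann m n \<Longrightarrow> S \<phi> = T \<phi>"
  shows "tensor_id m n S f = tensor_id m n T f"
proof -
  have "tensor_sum m n N (\<lambda>k. S (\<phi> k)) c = tensor_sum m n N (\<lambda>k. T (\<phi> k)) c"
    if "\<forall>k<N. \<phi> k \<in> schwartz_grassmann m n \<and> c k \<in> cw_free_algebra m n" for N \<phi> c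
    using that assms by (simp add: tensor_sum_def)
  then show ?thesis unfolding tensor_id_def by (metis (no_types, lifting))
qed

theorem theorem10:
  fixes m n :: nat and s :: real
  assumes "s = 1 \<or> s = -1"
  shows "\<forall>f \<in> super_schwartz m n. super_fourier m n s f = super_exp m n (s * pi / 4) f"
  unfolding super_fourier_def super_exp_def
  by (intro ballI tensor_id_cong fourier_scalar_eq_super_exp_scalar assms)

end
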